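(* Let $0\le V\in\mathcal{L}_{1,\infty}$ and let $A\in\mathcal{L}_\infty$. Define $$\zeta_{A,V}(z):=\mathrm{Tr}(AV^{1+z}),\qquad \Re(z)>0.$$ If there exists $\varepsilon>0$ such that $\zeta_{A,V}$ admits an analytic continuation to the set $\{z\in\mathbb{C}:\Re(z)>-\varepsilon\}\setminus\{0\}$ with a simple pole at $0$, then for every normalised trace $\varphi$ on $\mathcal{L}_{1,\infty}$ we have $$\varphi(AV)=\mathrm{Res}_{z=0}\,\zeta_{A,V}(z).$$ In particular, $AV$ is universally measurable.
   Context: $H$ is a separable infinite-dimensional complex Hilbert space, $\mathcal{L}_\infty$ is the algebra of bounded operators on $H$, $\mu(k,T)$ ($k\ge0$) are the singular values of $T$ in non-increasing order, and $\mathcal{L}_{1,\infty}=\{T\in\mathcal{L}_\infty:\sup_{k\ge0}(k+1)\mu(k,T)<\infty\}$. A trace on $\mathcal{L}_{1,\infty}$ is a linear functional $\varphi:\mathcal{L}_{1,\infty}\to\mathbb{C}$ (no continuity or positivity assumed) with $\varphi(U^*TU)=\varphi(T)$ for all $T\in\mathcal{L}_{1,\infty}$ and all unitary $U$; it is normalised if $\varphi(\mathrm{diag}(\{\frac1{k+1}\}_{k\ge0}))=1$, the diagonal being taken in some fixed orthonormal basis. An operator $T\in\mathcal{L}_{1,\infty}$ is universally measurable if all normalised traces on $\mathcal{L}_{1,\infty}$ take the same value on $T$. $\mathrm{Tr}$ is the classical trace. *)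

theory Defs
  imports "HOL-Complex_Analysis.Complex_Analysis"
begin

section \<open>Complex Hilbert spaces\<close>

text \<open>A complex Hilbert space; the sesquilinear form is linear in its \<^emph>\<open>first\<close> argument. The class
  extends \<^class>\<open>real_inner\<close>, so that the norm is the one induced by the form and the library theory
  of the underlying real Hilbert space is available.\<close>

class complex_hilbert = real_inner + complete_space +
  fixes scaleC :: "complex \<Rightarrow> 'a \<Rightarrow> 'a"  (infixr \<open>*\<^sub>C\<close> 75)
    and cinner :: "'a \<Rightarrow> 'a \<Rightarrow> complex"
  assumes scaleC_add_right: "c *\<^sub>C (x + y) = c *\<^sub>C x + c *\<^sub>C y"
    and scaleC_add_left: "(c + d) *\<^sub>C x = c *\<^sub>C x + d *\<^sub>C x"
    and scaleC_scaleC: "c *\<^sub>C d *\<^sub>C x = (c * d) *\<^sub>C x"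
    and scaleC_of_real: "complex_of_real r *\<^sub>C x = r *\<^sub>R x"
    and cinner_add_left: "cinner (x + y) z = cinner x z + cinner y z"
    and cinner_scaleC_left: "cinner (c *\<^sub>C x) y = c * cinner x y"
    and cinner_commute: "cinner x y = cnj (cinner y x)"
    and inner_eq_Re_cinner: "x \<bullet> y = Re (cinner x y)"

instance complex_hilbert \<subseteq> banach ..

lemma scaleC_one [simp]: "1 *\<^sub>C x = (x::'h::complex_hilbert)"
  using scaleC_of_real[of 1 x] by simp

global_interpretation complex_vector:
  vector_space "scaleC :: complex \<Rightarrow> 'h \<Rightarrow> 'h::complex_hilbert"
  defines cspan = complex_vector.span and cdim = complex_vector.dim
  by unfold_locales (simp_all add: scaleC_add_right scaleC_add_left scaleC_scaleC)

lemma cinner_self: "cinner x x = complex_of_real ((norm x)\<^sup>2)" for x :: "'h::complex_hilbert"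
proof -
  have "Im (cinner x x) = 0"
    using arg_cong[OF cinner_commute[of x x], of Im] by simp
  moreover have "Re (cinner x x) = (norm x)\<^sup>2"
    using inner_eq_Re_cinner[of x x] by (simp add: power2_norm_eq_inner)
  ultimately show ?thesis by (simp add: complex_eq_iff)
qed

definition orthonormal_basis :: "'h::complex_hilbert set \<Rightarrow> bool" where
  "orthonormal_basis B \<longleftrightarrow>
     (\<forall>e\<in>B. \<forall>f\<in>B. cinner e f = (if e = f then 1 else 0)) \<and> closure (cspan B) = UNIV"


section \<open>Bounded operators\<close>

definition bounded_operators :: "('h::complex_hilbert \<Rightarrow> 'h) set" where
  "bounded_operators = {T. bounded_linear T \<and> (\<forall>c x. T (c *\<^sub>C x) = c *\<^sub>C T x)}"

definition cadjoint :: "('h::complex_hilbert \<Rightarrow> 'h) \<Rightarrow> 'h \<Rightarrow> 'h" where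
  "cadjoint T = (THE S. \<forall>x y. cinner (T x) y = cinner x (S y))"

definition unitary :: "('h::complex_hilbert \<Rightarrow> 'h) \<Rightarrow> bool" where
  "unitary U \<longleftrightarrow> U \<in> bounded_operators \<and> cadjoint U \<circ> U = id \<and> U \<circ> cadjoint U = id"

definition positive_operator :: "('h::complex_hilbert \<Rightarrow> 'h) \<Rightarrow> bool" where
  "positive_operator T \<longleftrightarrow> T \<in> bounded_operators \<and> (\<forall>x. cinner (T x) x \<in> \<real>\<^sub>\<ge>\<^sub>0)"

definition compact_operator :: "('h::complex_hilbert \<Rightarrow> 'h) \<Rightarrow> bool" where
  "compact_operator T \<longleftrightarrow> T \<in> bounded_operators \<and> compact (closure (T ` cball 0 1))"

definition diag_operator :: "(nat \<Rightarrow> 'h::complex_hilbert) \<Rightarrow> (nat \<Rightarrow> complex) \<Rightarrow> 'h \<Rightarrow> 'h" where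
  "diag_operator b a x = (\<Sum>k. (a k * cinner x (b k)) *\<^sub>C b k)"

text \<open>The value common to all orthonormal bases is meaningful exactly for trace class operators.\<close>

definition classical_trace :: "('h::complex_hilbert \<Rightarrow> 'h) \<Rightarrow> complex" where
  "classical_trace T =
     (THE t. \<forall>B. orthonormal_basis B \<longrightarrow> ((\<lambda>e. cinner (T e) e) has_sum t) B)"


section \<open>Singular values and the ideal of weak trace class operators\<close>

text \<open>The sequence \<open>s\<close> lists the singular values of \<open>T\<close> (the eigenvalues of \<open>(T\<^sup>*T)\<^sup>1\<^sup>/\<^sup>2\<close>) in
  non-increasing order and with multiplicity: each \<open>t > 0\<close> occurs as often as the dimension of the
  eigenspace of \<open>T\<^sup>*T\<close> for \<open>t\<^sup>2\<close>. As usual, if \<open>T\<close> has finite rank the list is padded with zeros,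
  and otherwise the kernel is not recorded. For compact \<open>T\<close> on an infinite-dimensional space there
  is exactly one such sequence; non-compact operators are not in the ideal below, so the value of
  \<open>singular_value\<close> on them is irrelevant.\<close>

definition lists_singular_values :: "('h::complex_hilbert \<Rightarrow> 'h) \<Rightarrow> (nat \<Rightarrow> real) \<Rightarrow> bool" where
  "lists_singular_values T s \<longleftrightarrow>
     decseq s \<and> (\<forall>k. 0 \<le> s k) \<and>
     (\<forall>t>0. finite {k. s k = t} \<and>
            card {k. s k = t} = cdim {x. cadjoint T (T x) = complex_of_real (t\<^sup>2) *\<^sub>C x})"

definition singular_value :: "nat \<Rightarrow> ('h::complex_hilbert \<Rightarrow> 'h) \<Rightarrow> real" where
  "singular_value k T = (THE s. lists_singular_values T s) k"

definition weak_L1 :: "('h::complex_hilbert \<Rightarrow> 'h) set" where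
  "weak_L1 = {T. compact_operator T \<and> bdd_above (range (\<lambda>k. real (k + 1) * singular_value k T))}"


section \<open>Traces on the ideal\<close>

definition trace_on_weak_L1 :: "(('h::complex_hilbert \<Rightarrow> 'h) \<Rightarrow> complex) \<Rightarrow> bool" where
  "trace_on_weak_L1 \<phi> \<longleftrightarrow>
     (\<forall>S\<in>weak_L1. \<forall>T\<in>weak_L1. \<phi> (\<lambda>x. S x + T x) = \<phi> S + \<phi> T) \<and>
     (\<forall>c. \<forall>T\<in>weak_L1. \<phi> (\<lambda>x. c *\<^sub>C T x) = c * \<phi> T) \<and>
     (\<forall>T\<in>weak_L1. \<forall>U. unitary U \<longrightarrow> \<phi> (cadjoint U \<circ> T \<circ> U) = \<phi> T)"

definition normalised_trace ::
  "(nat \<Rightarrow> 'h::complex_hilbert) \<Rightarrow> (('h \<Rightarrow> 'h) \<Rightarrow> complex) \<Rightarrow> bool" where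
  "normalised_trace b \<phi> \<longleftrightarrow>
     trace_on_weak_L1 \<phi> \<and> \<phi> (diag_operator b (\<lambda>k. 1 / (of_nat k + 1))) = 1"

definition universally_measurable ::
  "(nat \<Rightarrow> 'h::complex_hilbert) \<Rightarrow> ('h \<Rightarrow> 'h) \<Rightarrow> bool" where
  "universally_measurable b T \<longleftrightarrow>
     T \<in> weak_L1 \<and> (\<forall>\<phi> \<psi>. normalised_trace b \<phi> \<longrightarrow> normalised_trace b \<psi> \<longrightarrow> \<phi> T = \<psi> T)"


section \<open>Complex powers and the zeta function\<close>

text \<open>Functional calculus for a positive compact operator \<open>V\<close>: \<open>V\<^sup>w\<close> is the bounded operator acting
  as the scalar \<open>t\<^sup>w\<close> on the eigenspace of \<open>V\<close> for \<open>t\<close>. It is unique because the eigenvectors of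
  \<open>V\<close> span a dense subspace, and it exists when \<open>Re w > 0\<close>. Note that \<open>0 powr w = 0\<close>, so that
  \<open>V\<^sup>w\<close> vanishes on the kernel of \<open>V\<close>.\<close>

definition operator_powr :: "('h::complex_hilbert \<Rightarrow> 'h) \<Rightarrow> complex \<Rightarrow> 'h \<Rightarrow> 'h" where
  "operator_powr V w = (THE S. S \<in> bounded_operators \<and>
     (\<forall>t\<ge>0. \<forall>x. V x = complex_of_real t *\<^sub>C x \<longrightarrow> S x = (complex_of_real t powr w) *\<^sub>C x))"

definition zeta :: "('h::complex_hilbert \<Rightarrow> 'h) \<Rightarrow> ('h \<Rightarrow> 'h) \<Rightarrow> complex \<Rightarrow> complex" where
  "zeta A V z = classical_trace (A \<circ> operator_powr V (1 + z))"

end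

theory Submission
  imports Defs "HOL-Library.Discrete_Functions" "HOL-Combinatorics.Permutations"
begin

text \<open>Write \<open>V = \<Sum> \<mu>\<^sub>k e\<^sub>k \<otimes> e\<^sub>k\<close> and group the eigenvectors into blocks on which \<open>\<mu>\<^sub>k\<close> has order \<open>2\<^sup>-\<^sup>n\<close>; since
  \<open>V\<close> is weak trace class, the \<open>n\<close>-th block has \<open>O(2\<^sup>n)\<close> elements. With \<open>W = \<Sum> 2\<^sup>-\<^sup>n Q\<^sub>n\<close>, \<open>Q\<^sub>n\<close> the block
  projections, \<open>A V = B W\<close> for a bounded \<open>B\<close>.

  The polarised identity \<open>\<phi>(X\<^sup>*X) = \<phi>(XX\<^sup>*)\<close> gives \<open>\<phi>(B W) = \<phi>(W\<^sup>1\<^sup>/\<^sup>2 B W\<^sup>1\<^sup>/\<^sup>2) = \<phi>(W B)\<close>. The off-diagonal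
  blocks of \<open>W\<^sup>1\<^sup>/\<^sup>2 B W\<^sup>1\<^sup>/\<^sup>2\<close> form a commutator \<open>Y W - W Y\<close> with \<open>Y\<close> bounded, so \<open>\<phi>(B W)\<close> depends only on the
  diagonal blocks. Diagonalising those inside the blocks reduces the problem to sequences, where reordering
  each block so that its partial sums stay small shows that the trace depends only on the block sums, and in
  fact vanishes if these have bounded partial sums.

  The partial sums of the block sums of \<open>\<langle>A e\<^sub>k, e\<^sub>k\<rangle> \<mu>\<^sub>k\<close> equal \<open>Res \<zeta> \<cdot> log 2\<^sup>n + O(1)\<close> by a Tauberian theorem
  in the style of M. Riesz and Newman, which uses the continuation of \<open>\<zeta>\<close> in a full neighbourhood of \<open>0\<close>.
  The same holds, with residue \<open>1\<close>, for the harmonic sequence, on which \<open>\<phi>\<close> is normalised.\<close>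

section \<open>Hilbert space geometry up to the spectral theorem\<close>

section \<open>The inner product and orthonormal families\<close>

text \<open>No continuity of \<open>\<phi>\<close> is assumed, so no error term may be removed by a
  limit: whatever disappears must be exhibited as a commutator, as a difference of two
  rearrangements, or as a telescoping of block sums. Exact powers of 2 as eigenvalues of
  \<open>W\<close> serve this purpose, since between blocks the ratios stay away from 1 and the
  commutator equation can be solved explicitly. With \<open>W\<close> on one side only, the
  coefficient on the k-th block diagonal would be 1 / (1 - 2^(-k)), which tends to 1: a triangular
  truncation, unbounded in general. Splitting \<open>W\<close> evenly to both sides of
  \<open>B\<close> gives coefficients that decay in both directions; this is the use of the
  polarised identity.

  The analysis must be equally exact. An error of smaller order than the logarithm would not do for
  all traces, whereas bounded partial sums T turn the block sums into T n - T (n - 1), a difference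
  of two sequences with the same trace. To obtain such a bound, the pole is removed by subtracting c
  ln 2 / (1 - 2^(-z)) instead of c / z, because the former is itself a dyadic series, with constant
  block sums.\<close>

lemma cinner_add_right: "cinner x (y + z) = cinner x y + cinner x z"
  by (metis cinner_add_left cinner_commute complex_cnj_add)

lemma cinner_scaleC_right: "cinner x (c *\<^sub>C y) = cnj c * cinner x y"
  by (metis cinner_commute cinner_scaleC_left complex_cnj_mult)

lemma cinner_0_left [simp]: "cinner 0 x = 0"
  using cinner_add_left[of 0 0 x] by simp

lemma cinner_0_right [simp]: "cinner x 0 = 0"
  using cinner_add_right[of x 0 0] by simp

lemma scaleR_conv_scaleC: "r *\<^sub>R x = complex_of_real r *\<^sub>C x" for x :: "'h::complex_hilbert"
  by (simp add: scaleC_of_real)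

lemma scaleC_minus_one: "(-1) *\<^sub>C x = - x" for x :: "'h::complex_hilbert"
  using scaleC_of_real[of "-1" x] by simp

lemma cinner_minus_left: "cinner (- x) y = - cinner x y"
  by (metis cinner_scaleC_left mult_minus1 scaleC_minus_one)

lemma cinner_minus_right: "cinner x (- y) = - cinner x y"
  by (metis cinner_commute cinner_minus_left complex_cnj_minus)

lemma cinner_diff_left: "cinner (x - y) z = cinner x z - cinner y z"
  using cinner_add_left[of x "- y" z] by (simp add: cinner_minus_left)

lemma cinner_diff_right: "cinner x (y - z) = cinner x y - cinner x z"
  using cinner_add_right[of x y "- z"] by (simp add: cinner_minus_right)

lemma cinner_sum_left: "cinner (sum f A) y = (\<Sum>i\<in>A. cinner (f i) y)"
  by (induction A rule: infinite_finite_induct) (auto simp: cinner_add_left)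

lemma cinner_sum_right: "cinner x (sum f A) = (\<Sum>i\<in>A. cinner x (f i))"
  by (induction A rule: infinite_finite_induct) (auto simp: cinner_add_right)

lemma cinner_cnj: "cnj (cinner x y) = cinner y x"
  by (metis cinner_commute)

lemma cmod_cinner_commute: "cmod (cinner x y) = cmod (cinner y x)"
  by (metis cinner_commute complex_mod_cnj)

lemma norm_scaleC: "norm (c *\<^sub>C x) = cmod c * norm x" for x :: "'h::complex_hilbert"
proof -
  have "cinner (c *\<^sub>C x) (c *\<^sub>C x) = c * cnj c * cinner x x"
    by (simp add: cinner_scaleC_left cinner_scaleC_right)
  then have "complex_of_real ((norm (c *\<^sub>C x))\<^sup>2) = complex_of_real ((cmod c * norm x)\<^sup>2)"
    by (simp only: cinner_self complex_norm_square[symmetric] power_mult_distrib of_real_mult of_real_power)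
  then have "(norm (c *\<^sub>C x))\<^sup>2 = (cmod c * norm x)\<^sup>2"
    using of_real_eq_iff by blast
  then show ?thesis
    by (simp add: power2_eq_iff_nonneg)
qed

text \<open>Rotating \<open>x\<close> by the unimodular number \<open>c\<close> makes the inner
  product real and nonnegative, where it agrees with the real inner product.\<close>

lemma cinner_Cauchy_Schwarz: "cmod (cinner x y) \<le> norm x * norm y"
proof (cases "cinner x y = 0")
  case False
  define c where "c = cnj (cinner x y) / cmod (cinner x y)"
  have c: "cmod c = 1" using False by (simp add: c_def norm_divide)
  have "cinner (c *\<^sub>C x) y = complex_of_real (cmod (cinner x y))"
    using False by (simp add: cinner_scaleC_left c_def complex_norm_square[symmetric] power2_eq_square
        mult.commute)
  then have "cmod (cinner x y) = (c *\<^sub>C x) \<bullet> y"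
    by (simp add: inner_eq_Re_cinner)
  also have "\<dots> \<le> norm (c *\<^sub>C x) * norm y"
    by (rule norm_cauchy_schwarz)
  finally show ?thesis by (simp add: norm_scaleC c)
qed simp

lemma bounded_linear_cinner_left: "bounded_linear (\<lambda>x. cinner x y)"
  by (rule bounded_linear_intro[of _ "norm y"])
    (auto simp: cinner_add_left scaleR_conv_scaleC cinner_scaleC_left scaleR_conv_of_real
      cinner_Cauchy_Schwarz)

lemma bounded_linear_cinner_right: "bounded_linear (\<lambda>y. cinner x y)"
proof (rule bounded_linear_intro[of _ "norm x"])
  show "cmod (cinner x y) \<le> norm y * norm x" for y
    using cinner_Cauchy_Schwarz[of x y] by (simp add: mult.commute)
qed (auto simp: cinner_add_right scaleR_conv_scaleC cinner_scaleC_right scaleR_conv_of_real)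

lemma bounded_linear_scaleC: "bounded_linear (\<lambda>x::'h::complex_hilbert. c *\<^sub>C x)"
proof (rule bounded_linear_intro[of _ "cmod c"])
  show "c *\<^sub>C r *\<^sub>R x = r *\<^sub>R c *\<^sub>C x" for r and x :: 'h
    by (simp add: scaleR_conv_scaleC scaleC_scaleC mult.commute)
qed (auto simp: scaleC_add_right norm_scaleC mult.commute)

lemma norm_power2_conv_cinner: "(norm x)\<^sup>2 = Re (cinner x x)"
  by (simp add: cinner_self)

text \<open>Vectors with an index outside \<open>I\<close> are unconstrained. This suits singular
  vectors, which exist only for the non-zero singular values.\<close>

definition orthonormal_on :: "'i set \<Rightarrow> ('i \<Rightarrow> 'h::complex_hilbert) \<Rightarrow> bool" where
  "orthonormal_on I u \<longleftrightarrow> (\<forall>i\<in>I. \<forall>j\<in>I. cinner (u i) (u j) = (if i = j then 1 else 0))"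

lemma orthonormal_onD:
  "orthonormal_on I u \<Longrightarrow> i \<in> I \<Longrightarrow> j \<in> I \<Longrightarrow> cinner (u i) (u j) = (if i = j then 1 else 0)"
  by (simp add: orthonormal_on_def)

lemma orthonormal_on_subset: "orthonormal_on I u \<Longrightarrow> J \<subseteq> I \<Longrightarrow> orthonormal_on J u"
  unfolding orthonormal_on_def by blast

lemma orthonormal_on_norm:
  assumes "orthonormal_on I u" "i \<in> I" shows "norm (u i) = 1"
proof -
  have "(norm (u i))\<^sup>2 = 1"
    using orthonormal_onD[OF assms(1,2,2)] by (simp add: norm_power2_conv_cinner)
  then show ?thesis by (simp add: power2_eq_1_iff) (smt (verit) norm_ge_zero)
qed

lemma cinner_sum_orthonormal:
  assumes "orthonormal_on I u" "finite F" "F \<subseteq> I" "j \<in> I"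
  shows "cinner (\<Sum>i\<in>F. c i *\<^sub>C u i) (u j) = (if j \<in> F then c j else 0)"
proof -
  have "cinner (\<Sum>i\<in>F. c i *\<^sub>C u i) (u j) = (\<Sum>i\<in>F. if i = j then c i else 0)"
    unfolding cinner_sum_left cinner_scaleC_left
    using assms by (intro sum.cong) (auto simp: orthonormal_onD subset_iff)
  also have "\<dots> = (if j \<in> F then c j else 0)" using assms(2) by (simp add: sum.delta)
  finally show ?thesis .
qed

lemma norm_sum_orthonormal:
  assumes "orthonormal_on F u" "finite F"
  shows "(norm (\<Sum>i\<in>F. c i *\<^sub>C u i))\<^sup>2 = (\<Sum>i\<in>F. (cmod (c i))\<^sup>2)"
proof -
  have "cinner (\<Sum>i\<in>F. c i *\<^sub>C u i) (\<Sum>i\<in>F. c i *\<^sub>C u i)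
      = (\<Sum>j\<in>F. cnj (c j) * cinner (\<Sum>i\<in>F. c i *\<^sub>C u i) (u j))"
    by (simp only: cinner_sum_right cinner_scaleC_right)
  also have "\<dots> = (\<Sum>j\<in>F. cnj (c j) * c j)"
    using cinner_sum_orthonormal[OF assms order_refl] by (intro sum.cong) auto
  also have "\<dots> = complex_of_real (\<Sum>i\<in>F. (cmod (c i))\<^sup>2)"
    by (simp add: complex_norm_square mult.commute del: of_real_power)
  finally show ?thesis by (simp add: norm_power2_conv_cinner)
qed

lemma Bessel_residual:
  assumes "orthonormal_on F u" "finite F"
  shows "(norm (x - (\<Sum>i\<in>F. cinner x (u i) *\<^sub>C u i)))\<^sup>2
    = (norm x)\<^sup>2 - (\<Sum>i\<in>F. (cmod (cinner x (u i)))\<^sup>2)"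
proof -
  let ?p = "\<Sum>i\<in>F. cinner x (u i) *\<^sub>C u i"
  have "cinner x ?p = complex_of_real (\<Sum>i\<in>F. (cmod (cinner x (u i)))\<^sup>2)"
    by (simp add: cinner_sum_right cinner_scaleC_right complex_norm_square mult.commute del: of_real_power)
  then have "Re (cinner x ?p) = (\<Sum>i\<in>F. (cmod (cinner x (u i)))\<^sup>2)"
    by simp
  moreover have "Re (cinner ?p x) = Re (cinner x ?p)"
    by (metis cinner_commute complex_cnj(1) complex_surj cnj.simps(1))
  moreover have "Re (cinner ?p ?p) = (\<Sum>i\<in>F. (cmod (cinner x (u i)))\<^sup>2)"
    using norm_sum_orthonormal[OF assms] by (metis norm_power2_conv_cinner)
  ultimately show ?thesis
    unfolding norm_power2_conv_cinner by (simp only: cinner_diff_left cinner_diff_right minus_complex.simps)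
qed

lemma Bessel_finite:
  assumes "orthonormal_on F u" "finite F"
  shows "(\<Sum>i\<in>F. (cmod (cinner x (u i)))\<^sup>2) \<le> (norm x)\<^sup>2"
  using Bessel_residual[OF assms, of x] by (smt (verit) zero_le_power2)

lemma orthonormal_residual_orthogonal:
  assumes "orthonormal_on F u" "finite F" "j \<in> F"
  shows "cinner (x - (\<Sum>i\<in>F. cinner x (u i) *\<^sub>C u i)) (u j) = 0"
  using cinner_sum_orthonormal[OF assms(1,2) order_refl assms(3)] assms(3) by (simp add: cinner_diff_left)

text \<open>Riesz-Fischer: by Pythagoras, the sections of the vector series and those of the series
  of squared moduli are small together. As \<open>c\<close> vanishes off \<open>I\<close>, the
  unconstrained vectors there do not enter.\<close>

lemma orthonormal_series:
  fixes u :: "nat \<Rightarrow> 'h::complex_hilbert"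
  assumes u: "orthonormal_on I u" and c: "\<And>i. i \<notin> I \<Longrightarrow> c i = 0"
    and s: "summable (\<lambda>i. (cmod (c i))\<^sup>2)"
  shows "summable (\<lambda>i. c i *\<^sub>C u i)"
    and "\<And>j. j \<in> I \<Longrightarrow> cinner (\<Sum>i. c i *\<^sub>C u i) (u j) = c j"
    and "(norm (\<Sum>i. c i *\<^sub>C u i))\<^sup>2 = (\<Sum>i. (cmod (c i))\<^sup>2)"
proof -
  have restr: "(\<Sum>i\<in>F. c i *\<^sub>C u i) = (\<Sum>i\<in>F \<inter> I. c i *\<^sub>C u i)" if "finite F" for F
    using that c by (intro sum.mono_neutral_right) auto
  have fin: "(norm (\<Sum>i\<in>F. c i *\<^sub>C u i))\<^sup>2 = (\<Sum>i\<in>F. (cmod (c i))\<^sup>2)" if "finite F" for F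
  proof -
    have "(norm (\<Sum>i\<in>F. c i *\<^sub>C u i))\<^sup>2 = (\<Sum>i\<in>F \<inter> I. (cmod (c i))\<^sup>2)"
      unfolding restr[OF that] using that
      by (intro norm_sum_orthonormal orthonormal_on_subset[OF u]) auto
    also have "\<dots> = (\<Sum>i\<in>F. (cmod (c i))\<^sup>2)"
      using that c by (intro sum.mono_neutral_left) auto
    finally show ?thesis .
  qed
  show sm: "summable (\<lambda>i. c i *\<^sub>C u i)"
    unfolding summable_Cauchy
  proof (intro allI impI)
    fix e :: real assume "e > 0"
    then obtain N where N: "\<And>m n. m \<ge> N \<Longrightarrow> norm (\<Sum>i=m..<n. (cmod (c i))\<^sup>2) < e\<^sup>2"
      using s unfolding summable_Cauchy by (meson zero_less_power)
    show "\<exists>N. \<forall>m\<ge>N. \<forall>n. norm (\<Sum>i=m..<n. c i *\<^sub>C u i) < e"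
    proof (intro exI allI impI)
      fix m n :: nat assume "m \<ge> N"
      from N[OF this, of n] have "(norm (\<Sum>i=m..<n. c i *\<^sub>C u i))\<^sup>2 < e\<^sup>2"
        by (subst fin) auto
      then show "norm (\<Sum>i=m..<n. c i *\<^sub>C u i) < e"
        using \<open>e > 0\<close> by (simp add: power_less_imp_less_base)
    qed
  qed
  let ?x = "\<Sum>i. c i *\<^sub>C u i"
  show "cinner ?x (u j) = c j" if "j \<in> I" for j
  proof -
    have "(\<lambda>i. cinner (c i *\<^sub>C u i) (u j)) sums cinner ?x (u j)"
      using bounded_linear.sums[OF bounded_linear_cinner_left summable_sums[OF sm]] .
    moreover have "(\<lambda>i. cinner (c i *\<^sub>C u i) (u j)) = (\<lambda>i. if i = j then c j else 0)"
      using that c by (auto simp: fun_eq_iff cinner_scaleC_left)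
        (metis orthonormal_onD[OF u])+
    moreover have "(\<lambda>i. if i = j then c j else 0) sums c j"
      by (rule sums_single)
    ultimately show ?thesis by (metis sums_unique2)
  qed
  have "(\<lambda>n. (norm (\<Sum>i<n. c i *\<^sub>C u i))\<^sup>2) \<longlonglongrightarrow> (norm ?x)\<^sup>2"
    using summable_sums[OF sm] unfolding sums_def by (intro tendsto_intros)
  then have "(\<lambda>i. (cmod (c i))\<^sup>2) sums (norm ?x)\<^sup>2"
    unfolding sums_def by (simp add: fin)
  then show "(norm ?x)\<^sup>2 = (\<Sum>i. (cmod (c i))\<^sup>2)"
    by (simp add: sums_unique)
qed

lemma Bessel_summable:
  fixes u :: "nat \<Rightarrow> 'h::complex_hilbert"
  assumes u: "orthonormal_on I u" and y: "\<And>i. i \<notin> I \<Longrightarrow> y i = 0" and K: "\<And>i. cmod (y i) \<le> K"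
  shows "summable (\<lambda>i. (cmod (y i * cinner x (u i)))\<^sup>2)"
    and "(\<Sum>i. (cmod (y i * cinner x (u i)))\<^sup>2) \<le> K\<^sup>2 * (norm x)\<^sup>2"
proof -
  have K0: "K \<ge> 0" using K[of 0] norm_ge_zero order_trans by blast
  have b: "(\<Sum>i<n. (cmod (y i * cinner x (u i)))\<^sup>2) \<le> K\<^sup>2 * (norm x)\<^sup>2" for n
  proof -
    have "(\<Sum>i<n. (cmod (y i * cinner x (u i)))\<^sup>2)
        = (\<Sum>i\<in>{..<n}\<inter>I. (cmod (y i))\<^sup>2 * (cmod (cinner x (u i)))\<^sup>2)"
      using y by (intro sum.mono_neutral_cong_right) (auto simp: norm_mult power_mult_distrib)
    also have "\<dots> \<le> (\<Sum>i\<in>{..<n}\<inter>I. K\<^sup>2 * (cmod (cinner x (u i)))\<^sup>2)"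
      using K by (intro sum_mono mult_right_mono power_mono) auto
    also have "\<dots> \<le> K\<^sup>2 * (norm x)\<^sup>2"
      unfolding sum_distrib_left[symmetric]
      by (intro mult_left_mono Bessel_finite orthonormal_on_subset[OF u]) auto
    finally show ?thesis .
  qed
  show s: "summable (\<lambda>i. (cmod (y i * cinner x (u i)))\<^sup>2)"
    by (rule summableI_nonneg_bounded[OF _ b]) simp
  show "(\<Sum>i. (cmod (y i * cinner x (u i)))\<^sup>2) \<le> K\<^sup>2 * (norm x)\<^sup>2"
    by (rule suminf_le_const[OF s b])
qed

section \<open>Bounded operators\<close>

lemma bounded_operatorsI:
  assumes "\<And>x y. T (x + y) = T x + T y" "\<And>c x. T (c *\<^sub>C x) = c *\<^sub>C T x" "\<And>x. norm (T x) \<le> K * norm x"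
  shows "T \<in> bounded_operators"
  unfolding bounded_operators_def
  using assms by (auto intro!: bounded_linear_intro[of _ K] simp: scaleR_conv_scaleC mult.commute)

lemma bop_linear: "T \<in> bounded_operators \<Longrightarrow> bounded_linear T"
  by (simp add: bounded_operators_def)

lemma bop_scaleC: "T \<in> bounded_operators \<Longrightarrow> T (c *\<^sub>C x) = c *\<^sub>C T x"
  by (simp add: bounded_operators_def)

lemma bop_add: "T \<in> bounded_operators \<Longrightarrow> T (x + y) = T x + T y"
  by (simp add: bop_linear linear_simps(1))

lemma bop_diff: "T \<in> bounded_operators \<Longrightarrow> T (x - y) = T x - T y"
  by (simp add: bop_linear linear_simps(2))

lemma bop_0 [simp]: "T \<in> bounded_operators \<Longrightarrow> T 0 = 0"
  by (simp add: bop_linear linear_simps(3))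

lemma bop_sum: "T \<in> bounded_operators \<Longrightarrow> T (sum f A) = (\<Sum>i\<in>A. T (f i))"
  by (induction A rule: infinite_finite_induct) (auto simp: bop_add)

lemma bop_bound:
  assumes "T \<in> bounded_operators"
  obtains K where "K > 0" "\<And>x. norm (T x) \<le> K * norm x"
  using bounded_linear.pos_bounded[OF bop_linear[OF assms]] by (auto simp: mult.commute)

lemma bop_id: "(\<lambda>x. x) \<in> bounded_operators"
  by (rule bounded_operatorsI[of _ 1]) auto

lemma bop_comp:
  assumes "S \<in> bounded_operators" "T \<in> bounded_operators"
  shows "(\<lambda>x. S (T x)) \<in> bounded_operators"
  using assms bounded_linear_compose[of S T]
  by (auto simp: bounded_operators_def)

lemma bop_plus:
  assumes "S \<in> bounded_operators" "T \<in> bounded_operators"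
  shows "(\<lambda>x. S x + T x) \<in> bounded_operators"
  using assms bounded_linear_add[of S T]
  by (auto simp: bounded_operators_def scaleC_add_right)

lemma bop_scale:
  assumes "T \<in> bounded_operators"
  shows "(\<lambda>x. c *\<^sub>C T x) \<in> bounded_operators"
  using assms bounded_linear_compose[OF bounded_linear_scaleC, of T c]
  by (auto simp: bounded_operators_def scaleC_scaleC mult.commute)

lemma bop_minus:
  assumes "S \<in> bounded_operators" "T \<in> bounded_operators"
  shows "(\<lambda>x. S x - T x) \<in> bounded_operators"
  using bop_plus[OF assms(1) bop_scale[OF assms(2), of "-1"]] by (simp add: scaleC_minus_one)

section \<open>Diagonal operators along an orthonormal family\<close>

context
  fixes u :: "nat \<Rightarrow> 'h::complex_hilbert" and I y K
  assumes u: "orthonormal_on I u" and y: "\<And>i. i \<notin> I \<Longrightarrow> y i = 0" and K: "\<And>i. cmod (y i) \<le> K"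
begin

lemma diag_operator_sums: "(\<lambda>k. (y k * cinner x (u k)) *\<^sub>C u k) sums diag_operator u y x"
  unfolding diag_operator_def
  by (intro summable_sums orthonormal_series(1)[OF u] Bessel_summable(1)[OF u y K]) (auto simp: y)

lemma diag_operator_coeff: "j \<in> I \<Longrightarrow> cinner (diag_operator u y x) (u j) = y j * cinner x (u j)"
  unfolding diag_operator_def
  by (rule orthonormal_series(2)[OF u]) (auto simp: y Bessel_summable(1)[OF u y K])

lemma diag_operator_norm2: "(norm (diag_operator u y x))\<^sup>2 = (\<Sum>i. (cmod (y i * cinner x (u i)))\<^sup>2)"
  unfolding diag_operator_def
  by (rule orthonormal_series(3)[OF u]) (auto simp: y Bessel_summable(1)[OF u y K])

lemma diag_operator_norm: "norm (diag_operator u y x) \<le> K * norm x"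
proof (rule power2_le_imp_le)
  show "(norm (diag_operator u y x))\<^sup>2 \<le> (K * norm x)\<^sup>2"
    unfolding diag_operator_norm2 using Bessel_summable(2)[OF u y K] by (simp add: power_mult_distrib)
  show "0 \<le> K * norm x" using K[of 0] norm_ge_zero order_trans by (metis mult_nonneg_nonneg)
qed

lemma bop_diag_operator: "diag_operator u y \<in> bounded_operators"
proof (rule bounded_operatorsI[OF _ _ diag_operator_norm])
  fix x z c
  have "(\<lambda>k. (y k * cinner x (u k)) *\<^sub>C u k + (y k * cinner z (u k)) *\<^sub>C u k) sums
      (diag_operator u y x + diag_operator u y z)"
    by (intro sums_add diag_operator_sums)
  also have "(\<lambda>k. (y k * cinner x (u k)) *\<^sub>C u k + (y k * cinner z (u k)) *\<^sub>C u k)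
     = (\<lambda>k. (y k * cinner (x + z) (u k)) *\<^sub>C u k)"
    by (simp add: cinner_add_left distrib_left scaleC_add_left)
  finally show "diag_operator u y (x + z) = diag_operator u y x + diag_operator u y z"
    using diag_operator_sums sums_unique2 by blast
  have "(\<lambda>k. c *\<^sub>C ((y k * cinner x (u k)) *\<^sub>C u k)) sums (c *\<^sub>C diag_operator u y x)"
    by (intro bounded_linear.sums[OF bounded_linear_scaleC] diag_operator_sums)
  also have "(\<lambda>k. c *\<^sub>C ((y k * cinner x (u k)) *\<^sub>C u k)) = (\<lambda>k. (y k * cinner (c *\<^sub>C x) (u k)) *\<^sub>C u k)"
    by (simp add: cinner_scaleC_left scaleC_scaleC mult_ac)
  finally show "diag_operator u y (c *\<^sub>C x) = c *\<^sub>C diag_operator u y x"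
    using diag_operator_sums sums_unique2 by blast
qed

lemma diag_operator_adjoint_aux:
  "(\<lambda>k. y k * cinner x (u k) * cinner (u k) z) sums cinner (diag_operator u y x) z"
  using bounded_linear.sums[OF bounded_linear_cinner_left diag_operator_sums]
  by (simp add: cinner_scaleC_left)

end

lemma diag_operator_adjoint:
  fixes u :: "nat \<Rightarrow> 'h::complex_hilbert"
  assumes u: "orthonormal_on I u" and y: "\<And>i. i \<notin> I \<Longrightarrow> y i = 0" and K: "\<And>i. cmod (y i) \<le> K"
  shows "cinner (diag_operator u y x) z = cinner x (diag_operator u (\<lambda>i. cnj (y i)) z)"
proof -
  have "(\<lambda>k. cnj (y k) * cinner z (u k) * cinner (u k) x) sums cinner (diag_operator u (\<lambda>i. cnj (y i)) z) x"
    by (rule diag_operator_adjoint_aux[OF u]) (use y K in auto)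
  from sums_cnj[THEN iffD2, OF this]
  have "(\<lambda>k. y k * cinner x (u k) * cinner (u k) z) sums cinner x (diag_operator u (\<lambda>i. cnj (y i)) z)"
    by (simp add: cinner_cnj mult_ac)
  from sums_unique2[OF diag_operator_adjoint_aux[OF u y K] this] show ?thesis .
qed

section \<open>Orthonormal bases indexed by the natural numbers\<close>

text \<open>Totality is stated through the trivial orthogonal complement, which is what a maximality
  argument produces directly.\<close>

definition onb :: "(nat \<Rightarrow> 'h::complex_hilbert) \<Rightarrow> bool" where
  "onb e \<longleftrightarrow> orthonormal_on UNIV e \<and> (\<forall>x. (\<forall>i. cinner x (e i) = 0) \<longrightarrow> x = 0)"

lemma onb_orthonormal: "onb e \<Longrightarrow> orthonormal_on I e"
  by (auto simp: onb_def orthonormal_on_def)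

lemma onb_cinner: "onb e \<Longrightarrow> cinner (e i) (e j) = (if i = j then 1 else 0)"
  by (auto simp: onb_def orthonormal_on_def)

lemma onb_norm [simp]: "onb e \<Longrightarrow> norm (e i) = 1"
  using orthonormal_on_norm[OF onb_orthonormal[of e UNIV]] by auto

lemma onb_eqI:
  assumes "onb e" "\<And>i. cinner x (e i) = cinner y (e i)"
  shows "x = y"
proof -
  have "cinner (x - y) (e i) = 0" for i by (simp add: cinner_diff_left assms(2))
  then have "x - y = 0" using assms(1) unfolding onb_def by blast
  then show ?thesis by simp
qed

lemma onb_diag_coeff:
  assumes "onb e" "\<And>i. cmod (y i) \<le> K"
  shows "cinner (diag_operator e y x) (e j) = y j * cinner x (e j)"
  by (rule diag_operator_coeff[OF onb_orthonormal[of e UNIV]]) (use assms in auto)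

lemma onb_bop_diag:
  assumes "onb e" "\<And>i. cmod (y i) \<le> K"
  shows "diag_operator e y \<in> bounded_operators"
  by (rule bop_diag_operator[OF onb_orthonormal[of e UNIV]]) (use assms in auto)

lemma onb_diag_basis:
  assumes "onb e" "\<And>i. cmod (y i) \<le> K"
  shows "diag_operator e y (e k) = y k *\<^sub>C e k"
  by (rule onb_eqI[OF assms(1)])
    (auto simp: onb_diag_coeff[OF assms] cinner_scaleC_left onb_cinner[OF assms(1)])

lemma onb_sums:
  assumes "onb e"
  shows "(\<lambda>i. cinner x (e i) *\<^sub>C e i) sums x"
proof -
  have b: "cmod ((\<lambda>_. 1) i) \<le> 1" for i :: nat by simp
  have "diag_operator e (\<lambda>_. 1) x = x"
    by (rule onb_eqI[OF assms]) (simp add: onb_diag_coeff[OF assms b])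
  with diag_operator_sums[OF onb_orthonormal[OF assms, of UNIV] _ b, of x] show ?thesis by simp
qed

lemma onb_Parseval:
  assumes "onb e"
  shows "(\<lambda>i. (cmod (cinner x (e i)))\<^sup>2) sums (norm x)\<^sup>2"
proof -
  have b: "cmod ((\<lambda>_. 1) i) \<le> 1" for i :: nat by simp
  have s: "summable (\<lambda>i. (cmod (cinner x (e i)))\<^sup>2)"
    using Bessel_summable(1)[OF onb_orthonormal[OF assms, of UNIV] _ b, of x] by simp
  from orthonormal_series(3)[OF onb_orthonormal[OF assms, of UNIV] _ s]
  have "(norm x)\<^sup>2 = (\<Sum>i. (cmod (cinner x (e i)))\<^sup>2)"
    using onb_sums[OF assms, of x] by (simp add: sums_iff)
  with s show ?thesis by (simp add: sums_iff)
qed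

lemma onb_cinner_sums:
  assumes "onb e"
  shows "(\<lambda>i. cinner x (e i) * cinner (e i) y) sums cinner x y"
  using bounded_linear.sums[OF bounded_linear_cinner_left onb_sums[OF assms]]
  by (simp add: cinner_scaleC_left)

lemma onb_norm_le:
  assumes "onb e" "\<And>i. cmod (cinner x (e i)) \<le> K * cmod (cinner y (e i))" "K \<ge> 0"
  shows "norm x \<le> K * norm y"
proof (rule power2_le_imp_le)
  have "(norm x)\<^sup>2 \<le> K\<^sup>2 * (norm y)\<^sup>2"
  proof (rule sums_le[OF _ onb_Parseval[OF assms(1), of x] sums_mult[OF onb_Parseval[OF assms(1), of y]]])
    fix i
    show "(cmod (cinner x (e i)))\<^sup>2 \<le> K\<^sup>2 * (cmod (cinner y (e i)))\<^sup>2"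
      using power_mono[OF assms(2)[of i], of 2] by (simp add: power_mult_distrib)
  qed
  then show "(norm x)\<^sup>2 \<le> (K * norm y)\<^sup>2" by (simp add: power_mult_distrib)
qed (use assms in auto)

lemma bop_eqI:
  assumes "onb e" "S \<in> bounded_operators" "T \<in> bounded_operators"
    "\<And>i j. cinner (S (e j)) (e i) = cinner (T (e j)) (e i)"
  shows "S = T"
proof
  fix x
  have 1: "S (e j) = T (e j)" for j
    using onb_eqI[OF assms(1)] assms(4) by blast
  note bounded_linear.sums[OF bop_linear[OF assms(2)] onb_sums[OF assms(1)]]
    bounded_linear.sums[OF bop_linear[OF assms(3)] onb_sums[OF assms(1)]]
  then show "S x = T x" unfolding bop_scaleC[OF assms(2)] bop_scaleC[OF assms(3)] 1
    by (rule sums_unique2)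
qed

section \<open>Adjoints\<close>

locale hilbert_basis =
  fixes b :: "nat \<Rightarrow> 'h::complex_hilbert"
  assumes onb_b: "onb b"
begin

text \<open>The coefficients of the adjoint at \<open>y\<close> have to be \<open>c y k\<close>.
  Testing \<open>y\<close> against \<open>T\<close> of their truncated expansion gives s \<le> norm
  y * K * sqrt s for the truncated sum s of squares, hence a bound independent of the
  truncation.\<close>

lemma adjoint_exists:
  fixes T :: "'h \<Rightarrow> 'h"
  assumes T: "T \<in> bounded_operators"
  obtains S where "S \<in> bounded_operators" "\<And>x y. cinner (T x) y = cinner x (S y)"
proof -
  obtain K where K: "K > 0" "\<And>x. norm (T x) \<le> K * norm x" using bop_bound[OF T] by blast
  define c where "c y k = cinner y (T (b k))" for y k
  have bnd: "(\<Sum>k<n. (cmod (c y k))\<^sup>2) \<le> (K * norm y)\<^sup>2" for n y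
  proof -
    let ?s = "\<Sum>k<n. (cmod (c y k))\<^sup>2"
    let ?v = "\<Sum>k<n. c y k *\<^sub>C b k"
    have "cinner y (T ?v) = (\<Sum>k<n. cnj (c y k) * c y k)"
      by (simp add: bop_sum[OF T] bop_scaleC[OF T] cinner_sum_right cinner_scaleC_right c_def)
    also have "\<dots> = complex_of_real ?s"
      by (simp add: complex_norm_square mult.commute del: of_real_power)
    finally have "cinner y (T ?v) = complex_of_real ?s" .
    moreover have "cmod (cinner y (T ?v)) \<le> norm y * (K * norm ?v)"
      by (rule order_trans[OF cinner_Cauchy_Schwarz]) (intro mult_left_mono K, simp)
    moreover have s0: "?s \<ge> 0" by (intro sum_nonneg) simp
    ultimately have "?s \<le> norm y * (K * norm ?v)" by (simp only: norm_of_real abs_of_nonneg)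
    then have "?s\<^sup>2 \<le> (norm y * (K * norm ?v))\<^sup>2" using s0 by (rule power_mono)
    also have "\<dots> = (K * norm y)\<^sup>2 * ?s"
      by (simp add: power_mult_distrib norm_sum_orthonormal[OF onb_orthonormal[OF onb_b]] mult_ac)
    finally have "?s * ?s \<le> (K * norm y)\<^sup>2 * ?s" by (simp only: power2_eq_square)
    with s0 show ?thesis
      by (cases "?s = 0") (metis zero_le_power2, metis mult_right_le_imp_le less_le)
  qed
  have sm: "summable (\<lambda>k. (cmod (c y k))\<^sup>2)" for y
    by (rule summableI_nonneg_bounded[OF _ bnd]) simp
  define S where "S y = (\<Sum>k. c y k *\<^sub>C b k)" for y
  note ser = orthonormal_series[OF onb_orthonormal[OF onb_b, of UNIV] _ sm]
  have co: "cinner (S y) (b k) = c y k" for y k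
    unfolding S_def by (rule ser(2)) auto
  have "S \<in> bounded_operators"
  proof (rule bounded_operatorsI)
    show "S (x + y) = S x + S y" for x y
      by (rule onb_eqI[OF onb_b]) (simp add: co cinner_add_left c_def)
    show "S (a *\<^sub>C x) = a *\<^sub>C S x" for a x
      by (rule onb_eqI[OF onb_b]) (simp add: co cinner_scaleC_left c_def)
    show "norm (S y) \<le> K * norm y" for y
    proof (rule power2_le_imp_le)
      have "(norm (S y))\<^sup>2 = (\<Sum>k. (cmod (c y k))\<^sup>2)" unfolding S_def by (rule ser(3)) auto
      also have "\<dots> \<le> (K * norm y)\<^sup>2" by (rule suminf_le_const[OF sm bnd])
      finally show "(norm (S y))\<^sup>2 \<le> (K * norm y)\<^sup>2" .
    qed (use K in auto)
  qed
  moreover have "cinner (T x) y = cinner x (S y)" for x y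
  proof -
    note bounded_linear.sums[OF bop_linear[OF T] onb_sums[OF onb_b]]
    from bounded_linear.sums[OF bounded_linear_cinner_left this]
    have 1: "(\<lambda>i. cinner x (b i) * cinner (T (b i)) y) sums cinner (T x) y"
      by (simp add: bop_scaleC[OF T] cinner_scaleC_left)
    have 2: "(\<lambda>i. cinner x (b i) * cinner (b i) (S y)) sums cinner x (S y)"
      by (rule onb_cinner_sums[OF onb_b])
    have 3: "cinner (b i) (S y) = cinner (T (b i)) y" for i
      using co[of y i] c_def by (metis cinner_commute)
    show ?thesis by (rule sums_unique2[OF 1 2[unfolded 3]])
  qed
  ultimately show ?thesis using that by blast
qed

lemma adjoint_unique:
  fixes T :: "'h \<Rightarrow> 'h"
  assumes "\<And>x y. cinner (T x) y = cinner x (S y)"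
  shows "cadjoint T = S"
  unfolding cadjoint_def
proof (rule the_equality)
  fix R assume R: "\<forall>x y. cinner (T x) y = cinner x (R y)"
  have "cinner (R y) x = cinner (S y) x" for x y
    using R assms by (metis cinner_commute)
  then show "R = S"
    by (intro ext onb_eqI[OF onb_b])
qed (use assms in auto)

lemma
  fixes T :: "'h \<Rightarrow> 'h"
  assumes "T \<in> bounded_operators"
  shows bop_adjoint: "cadjoint T \<in> bounded_operators"
    and cinner_adjoint: "cinner (T x) y = cinner x (cadjoint T y)"
    and cinner_adjoint': "cinner (cadjoint T x) y = cinner x (T y)"
proof -
  obtain S where S: "S \<in> bounded_operators" "\<And>x y. cinner (T x) y = cinner x (S y)"
    by (rule adjoint_exists[OF assms]) blast
  have "cadjoint T = S" by (rule adjoint_unique[OF S(2)])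
  with S show "cadjoint T \<in> bounded_operators" "cinner (T x) y = cinner x (cadjoint T y)"
    "cinner (cadjoint T x) y = cinner x (T y)"
    by (auto, metis S(2) cinner_commute)
qed

lemma adjoint_adjoint: "T \<in> bounded_operators \<Longrightarrow> cadjoint (cadjoint T) = T" for T :: "'h \<Rightarrow> 'h"
  by (rule adjoint_unique) (rule cinner_adjoint')

lemma diag_cadjoint:
  fixes u :: "nat \<Rightarrow> 'h"
  assumes u: "orthonormal_on I u" and y: "\<And>i. i \<notin> I \<Longrightarrow> y i = 0" and K: "\<And>i. cmod (y i) \<le> K"
  shows "cadjoint (diag_operator u y) = diag_operator u (\<lambda>i. cnj (y i))"
  by (rule adjoint_unique) (rule diag_operator_adjoint[OF assms])

end

section \<open>The spectral theorem for positive compact operators\<close>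

text \<open>Zorn's lemma with a side condition \<open>P\<close> on the vectors: being an eigenvector
  leads to the spectral theorem, the trivial condition to the extension of a family to a
  basis.\<close>

lemma maximal_orthonormal:
  fixes P :: "'h::complex_hilbert \<Rightarrow> bool"
  assumes "orthonormal_on E0 (\<lambda>x. x)" "\<And>x. x \<in> E0 \<Longrightarrow> P x"
  obtains E where "E0 \<subseteq> E" "orthonormal_on E (\<lambda>x. x)" "\<And>x. x \<in> E \<Longrightarrow> P x"
    "\<And>x. P x \<Longrightarrow> norm x = 1 \<Longrightarrow> (\<And>e. e \<in> E \<Longrightarrow> cinner x e = 0) \<Longrightarrow> False"
proof -
  define \<A> where "\<A> = {E. E0 \<subseteq> E \<and> orthonormal_on E (\<lambda>x. x) \<and> (\<forall>x\<in>E. P x)}"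
  have "\<exists>M\<in>\<A>. \<forall>X\<in>\<A>. M \<subseteq> X \<longrightarrow> X = M"
  proof (rule subset_Zorn_nonempty)
    show "\<A> \<noteq> {}" using assms by (auto simp: \<A>_def)
    fix C assume C: "C \<noteq> {}" "subset.chain \<A> C"
    have "orthonormal_on (\<Union>C) (\<lambda>x. x)"
      unfolding orthonormal_on_def
    proof (intro ballI)
      fix x y assume "x \<in> \<Union>C" "y \<in> \<Union>C"
      then obtain X Y where XY: "x \<in> X" "y \<in> Y" "X \<in> C" "Y \<in> C" by blast
      with C(2) have "X \<subseteq> Y \<or> Y \<subseteq> X" unfolding subset.chain_def by blast
      then obtain Z where "Z \<in> C" "x \<in> Z" "y \<in> Z" using XY by blast
      moreover from this(1) have "orthonormal_on Z (\<lambda>x. x)"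
        using C(2) unfolding subset.chain_def \<A>_def by blast
      ultimately show "cinner x y = (if x = y then 1 else 0)" by (simp add: orthonormal_on_def)
    qed
    then show "\<Union>C \<in> \<A>" using C unfolding subset.chain_def \<A>_def by blast
  qed
  then obtain E where E: "E \<in> \<A>" "\<And>X. X \<in> \<A> \<Longrightarrow> E \<subseteq> X \<Longrightarrow> X = E" by blast
  show ?thesis
  proof (rule that[of E])
    fix x assume x: "P x" "norm x = 1" "\<And>e. e \<in> E \<Longrightarrow> cinner x e = 0"
    have "cinner x x = 1" using x(2) by (simp add: cinner_self)
    moreover have "cinner e x = 0" if "e \<in> E" for e using x(3)[OF that] by (metis cinner_commute complex_cnj_zero)
    ultimately have "orthonormal_on (insert x E) (\<lambda>x. x)"
      using E(1) x(3) unfolding \<A>_def orthonormal_on_def by auto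
    then have "insert x E \<in> \<A>" using E(1) x(1) unfolding \<A>_def by blast
    then have "x \<in> E" using E(2) by blast
    then show False using x(3) \<open>cinner x x = 1\<close> by force
  qed (use E(1) in \<open>auto simp: \<A>_def\<close>)
qed

lemma dense_span_total:
  fixes x :: "'h::complex_hilbert"
  assumes "closure (cspan B) = UNIV" "\<And>e. e \<in> B \<Longrightarrow> cinner x e = 0"
  shows "x = 0"
proof -
  have "cspan B \<subseteq> {y. cinner x y = 0}"
  proof
    fix y assume "y \<in> cspan B"
    then show "y \<in> {y. cinner x y = 0}"
      by (induction rule: complex_vector.span_induct_alt)
        (auto simp: cinner_add_right cinner_scaleC_right assms(2))
  qed
  moreover have "closed {y. cinner x y = 0}"
    by (intro closed_Collect_eq continuous_intros bounded_linear.continuous_on[OF bounded_linear_cinner_right])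
  ultimately have "x \<in> {y. cinner x y = 0}"
    using closure_minimal assms(1) by blast
  then show ?thesis by (simp add: cinner_self)
qed

lemma positive_bop: "positive_operator V \<Longrightarrow> V \<in> bounded_operators"
  by (simp add: positive_operator_def)

lemma positive_cinner:
  assumes "positive_operator V"
  shows "Re (cinner (V x) x) \<ge> 0" "Im (cinner (V x) x) = 0"
proof -
  have "cinner (V x) x \<in> \<real>\<^sub>\<ge>\<^sub>0" using assms by (simp add: positive_operator_def)
  then show "Re (cinner (V x) x) \<ge> 0" "Im (cinner (V x) x) = 0"
    by (auto elim!: nonneg_Reals_cases)
qed

text \<open>Polarisation: the imaginary part of the quadratic form vanishes at \<open>x + y\<close>
  and at \<open>x + \<i> *\<^sub>C y\<close>.\<close>

lemma positive_symmetric: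
  assumes V: "positive_operator V"
  shows "cinner (V x) y = cinner x (V y)"
proof -
  note b = positive_bop[OF V]
  have "Im (cinner (V (x + y)) (x + y)) = 0" "Im (cinner (V (x + \<i> *\<^sub>C y)) (x + \<i> *\<^sub>C y)) = 0"
    "Im (cinner (V x) x) = 0" "Im (cinner (V y) y) = 0"
    using positive_cinner(2)[OF V] by blast+
  then have "Im (cinner (V x) y) = - Im (cinner (V y) x)" "Re (cinner (V x) y) = Re (cinner (V y) x)"
    by (simp_all add: bop_add[OF b] bop_scaleC[OF b] cinner_add_left cinner_add_right cinner_scaleC_left
        cinner_scaleC_right)
  then have "cinner (V x) y = cnj (cinner (V y) x)" by (simp add: complex_eq_iff)
  then show ?thesis by (simp add: cinner_cnj)
qed

text \<open>Positivity of the form at \<open>x\<close> minus \<open>V x\<close> divided by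
  \<open>q\<close>. The bound by \<open>q\<close> is asked for only at \<open>V x\<close>, so
  \<open>q\<close> may be a supremum over an invariant subspace.\<close>

lemma positive_norm_bound:
  assumes V: "positive_operator V" and q: "q > 0"
    and c: "Re (cinner (V (V x)) (V x)) \<le> q * (norm (V x))\<^sup>2"
  shows "(norm (V x))\<^sup>2 \<le> q * Re (cinner (V x) x)"
proof -
  note b = positive_bop[OF V]
  define r where "r = 1 / q"
  let ?z = "x - complex_of_real r *\<^sub>C V x"
  have "cinner (V (V x)) x = cinner (V x) (V x)" by (rule positive_symmetric[OF V])
  then have "Re (cinner (V ?z) ?z) = Re (cinner (V x) x) - 2 * r * (norm (V x))\<^sup>2
      + r\<^sup>2 * Re (cinner (V (V x)) (V x))"
    by (simp add: bop_diff[OF b] bop_scaleC[OF b] cinner_diff_left cinner_diff_right cinner_scaleC_left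
        cinner_scaleC_right cinner_self power2_eq_square algebra_simps)
  moreover have "r\<^sup>2 * Re (cinner (V (V x)) (V x)) \<le> r\<^sup>2 * (q * (norm (V x))\<^sup>2)"
    by (intro mult_left_mono c) simp
  moreover have "r\<^sup>2 * (q * (norm (V x))\<^sup>2) = r * (norm (V x))\<^sup>2"
    using q by (simp add: r_def power2_eq_square)
  moreover have "Re (cinner (V ?z) ?z) \<ge> 0" by (rule positive_cinner[OF V])
  ultimately have "r * (norm (V x))\<^sup>2 \<le> Re (cinner (V x) x)" by simp
  then show ?thesis using q by (simp add: r_def field_simps)
qed

text \<open>Unit vectors of \<open>M\<close> that nearly maximise the quadratic form are approximate
  eigenvectors for the supremum \<open>q\<close>; compactness turns them into a true one.\<close>

lemma positive_compact_eigenvector: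
  fixes V :: "'h::complex_hilbert \<Rightarrow> 'h"
  assumes V: "positive_operator V" "compact_operator V"
    and M: "closed M" "\<And>x. x \<in> M \<Longrightarrow> V x \<in> M" "\<And>c x. x \<in> M \<Longrightarrow> c *\<^sub>C x \<in> M"
    and ne: "x0 \<in> M" "x0 \<noteq> 0"
  shows "\<exists>x\<in>M. norm x = 1 \<and> (\<exists>t\<ge>0. V x = complex_of_real t *\<^sub>C x)"
proof -
  note b = positive_bop[OF V(1)]
  obtain K where K: "K > 0" "\<And>x. norm (V x) \<le> K * norm x" using bop_bound[OF b] by blast
  define a where "a x = Re (cinner (V x) x)" for x
  have aK: "a x \<le> K" if "norm x = 1" for x
    using complex_Re_le_cmod[of "cinner (V x) x"] cinner_Cauchy_Schwarz[of "V x" x] K(2)[of x] that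
    by (simp add: a_def)
  have a_scale: "a (c *\<^sub>C x) = (cmod c)\<^sup>2 * a x" for c x
  proof -
    have "cinner (V (c *\<^sub>C x)) (c *\<^sub>C x) = complex_of_real ((cmod c)\<^sup>2) * cinner (V x) x"
      by (simp add: bop_scaleC[OF b] cinner_scaleC_left cinner_scaleC_right complex_norm_square
          mult_ac del: of_real_power)
    then show ?thesis by (simp add: a_def del: of_real_power)
  qed
  define q where "q = Sup (a ` {x\<in>M. norm x = 1})"
  have unit: "complex_of_real (1 / norm x) *\<^sub>C x \<in> M" "norm (complex_of_real (1 / norm x) *\<^sub>C x) = 1"
    if "x \<in> M" "x \<noteq> 0" for x
    using that M(3) by (auto simp: norm_scaleC norm_divide)
  have bdd: "bdd_above (a ` {x\<in>M. norm x = 1})" using aK by (auto intro!: bdd_aboveI[of _ K])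
  have q_upper: "a x \<le> q" if "x \<in> M" "norm x = 1" for x
    unfolding q_def using that bdd by (intro cSup_upper) auto
  have q_upper': "a x \<le> q * (norm x)\<^sup>2" if "x \<in> M" for x
  proof (cases "x = 0")
    case False
    have "a (complex_of_real (1 / norm x) *\<^sub>C x) \<le> q"
      by (intro q_upper unit that False)
    then show ?thesis using False unfolding a_scale by (simp add: field_simps norm_divide)
  qed (simp add: a_def b)
  have q0: "q \<ge> 0"
    using q_upper[OF unit[OF ne]] positive_cinner(1)[OF V(1)] unfolding a_def
    by (meson order_trans)
  show ?thesis
  proof (cases "q = 0")
    \<comment> \<open>A vanishing supremum forces \<open>V\<close> to be 0 at the normalised
      \<open>x0\<close>, which then serves with eigenvalue 0. As \<open>q\<close> itself is not
      positive here, the norm bound is used with the constant 1.\<close>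
    case True
    let ?x = "complex_of_real (1 / norm x0) *\<^sub>C x0"
    have "a ?x \<le> 0" using q_upper[OF unit[OF ne]] True by simp
    moreover have "(norm (V ?x))\<^sup>2 \<le> 1 * a ?x"
      unfolding a_def
    proof (rule positive_norm_bound[OF V(1)])
      have "a (V ?x) \<le> q * (norm (V ?x))\<^sup>2" by (intro q_upper' M(2) unit ne)
      then show "Re (cinner (V (V ?x)) (V ?x)) \<le> 1 * (norm (V ?x))\<^sup>2"
        using True by (simp add: a_def) (meson order_trans zero_le_power2)
    qed simp
    ultimately have "V ?x = 0" by (smt (verit) zero_le_power2 power2_less_eq_zero_iff norm_eq_zero)
    then show ?thesis using unit[OF ne]
      by (intro bexI[of _ ?x] conjI exI[of _ 0]) auto
  next
    case False
    then have q: "q > 0" using q0 by simp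
    have "\<exists>x\<in>M. norm x = 1 \<and> q - 1 / real (Suc n) < a x" for n
    proof -
      have "\<exists>y\<in>a ` {x\<in>M. norm x = 1}. q - 1 / real (Suc n) < y"
        unfolding q_def by (rule less_cSupD) (use unit[OF ne] in auto)
      then show ?thesis by auto
    qed
    then obtain X where X: "\<And>n. X n \<in> M" "\<And>n. norm (X n) = 1" "\<And>n. q - 1 / real (Suc n) < a (X n)"
      by metis
    have "\<forall>n. V (X n) \<in> closure (V ` cball 0 1)"
      using X(2) by (intro allI subsetD[OF closure_subset] imageI) (simp add: dist_norm)
    moreover have "seq_compact (closure (V ` cball 0 1))"
      using V(2) compact_imp_seq_compact unfolding compact_operator_def by blast
    ultimately obtain l r where lr: "strict_mono (r :: nat \<Rightarrow> nat)" "((\<lambda>n. V (X n)) \<circ> r) \<longlonglongrightarrow> l"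
      unfolding seq_compact_def by metis
    have lim0: "(\<lambda>n. V (X n) - q *\<^sub>R X n) \<longlonglongrightarrow> 0"
    proof -
      have bound: "(norm (V (X n) - q *\<^sub>R X n))\<^sup>2 \<le> q * (1 / real (Suc n))" for n
      proof -
        have "(norm (V (X n) - q *\<^sub>R X n))\<^sup>2 = (norm (V (X n)))\<^sup>2 - 2 * q * a (X n) + q\<^sup>2"
        proof -
          have "(norm (u - v))\<^sup>2 = (norm u)\<^sup>2 - 2 * (u \<bullet> v) + (norm v)\<^sup>2" for u v :: 'h
            by (simp add: power2_norm_eq_inner inner_diff_left inner_diff_right inner_commute)
          from this[of "V (X n)" "q *\<^sub>R X n"] show ?thesis
            using X(2)[of n] by (simp add: a_def inner_eq_Re_cinner[symmetric])
        qed
        moreover have "(norm (V (X n)))\<^sup>2 \<le> q * a (X n)"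
          unfolding a_def
          by (rule positive_norm_bound[OF V(1) q]) (use q_upper'[OF M(2)[OF X(1)]] in \<open>simp add: a_def\<close>)
        ultimately have "(norm (V (X n) - q *\<^sub>R X n))\<^sup>2 \<le> q * (q - a (X n))"
          by (simp add: power2_eq_square algebra_simps)
        also have "\<dots> \<le> q * (1 / real (Suc n))"
          using X(3)[of n] q by (intro mult_left_mono) auto
        finally show ?thesis .
      qed
      have "(\<lambda>n. q * (1 / real (Suc n))) \<longlonglongrightarrow> q * 0"
        by (intro tendsto_intros LIMSEQ_Suc lim_1_over_n)
      then have L: "(\<lambda>n. q * (1 / real (Suc n))) \<longlonglongrightarrow> 0" by (simp only: mult_zero_right)
      have "(\<lambda>n. (norm (V (X n) - q *\<^sub>R X n))\<^sup>2) \<longlonglongrightarrow> 0"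
        by (rule tendsto_sandwich[OF always_eventually always_eventually tendsto_const L])
          (simp, rule allI, rule bound)
      then have "(\<lambda>n. norm (V (X n) - q *\<^sub>R X n)) \<longlonglongrightarrow> 0"
        using tendsto_real_sqrt[of "\<lambda>n. (norm (V (X n) - q *\<^sub>R X n))\<^sup>2" 0] by simp
      then show ?thesis by (rule tendsto_norm_zero_cancel)
    qed
    \<comment> \<open>The images converge and differ from \<open>q *\<^sub>R X (r n)\<close> by a
      null sequence; since \<open>q\<close> is positive, the vectors themselves converge.\<close>
    have "(\<lambda>n. V (X (r n)) - (V (X (r n)) - q *\<^sub>R X (r n))) \<longlonglongrightarrow> l - 0"
      by (intro tendsto_diff) (use lr LIMSEQ_subseq_LIMSEQ[OF lim0 lr(1)] in \<open>auto simp: o_def\<close>)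
    then have "(\<lambda>n. (1/q) *\<^sub>R (q *\<^sub>R X (r n))) \<longlonglongrightarrow> (1/q) *\<^sub>R l"
      by (intro tendsto_scaleR tendsto_const) simp
    then have x: "(\<lambda>n. X (r n)) \<longlonglongrightarrow> (1/q) *\<^sub>R l" using q by simp
    let ?x = "(1/q) *\<^sub>R l"
    have "?x \<in> M" by (rule closed_sequentially[OF M(1) _ x]) (rule X(1))
    moreover have "norm ?x = 1"
      using LIMSEQ_unique[OF tendsto_norm[OF x], of 1] by (simp only: X(2) tendsto_const)
    moreover have "(\<lambda>n. V (X (r n))) \<longlonglongrightarrow> V ?x"
      by (rule bounded_linear.tendsto[OF bop_linear[OF b] x])
    then have "V ?x = l" using lr(2) LIMSEQ_unique by (auto simp: o_def)
    then have "V ?x = complex_of_real q *\<^sub>C ?x" using q by (simp add: scaleR_conv_scaleC[symmetric])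
    ultimately show ?thesis using q0 by blast
  qed
qed

locale separable_hilbert = hilbert_basis b for b :: "nat \<Rightarrow> 'h::complex_hilbert" +
  assumes separable: "separable_space (euclidean :: 'h topology)"
    and infinite_dimensional: "\<nexists>B :: 'h set. finite B \<and> cspan B = UNIV"
begin

text \<open>Distinct orthonormal vectors have distance at least 1, so choosing for each a point of a
  countable dense set within 1/2 is injective.\<close>

lemma orthonormal_countable:
  fixes E :: "'h set"
  assumes E: "orthonormal_on E (\<lambda>x. x)"
  shows "countable E"
proof -
  obtain D :: "'h set" where D: "countable D" "closure D = UNIV"
    using separable unfolding separable_space_def by auto
  have "\<exists>d\<in>D. dist d e < 1/2" for e
  proof -
    have "e \<in> closure D" using D(2) by simp
    then have "(1/2::real) > 0 \<longrightarrow> (\<exists>y\<in>D. dist y e < 1/2)"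
      unfolding closure_approachable by (rule spec)
    then show ?thesis by (rule mp) simp
  qed
  then obtain d where d: "\<And>e. d e \<in> D" "\<And>e. dist (d e) e < 1/2" by metis
  have "inj_on d E"
  proof (rule inj_onI, rule ccontr)
    fix e f assume ef: "e \<in> E" "f \<in> E" "d e = d f" "e \<noteq> f"
    have "dist e f < 1" using d(2)[of e] d(2)[of f] ef(3) by (metis dist_triangle_half_r)
    moreover have "cinner (e - f) e = 1"
      using orthonormal_onD[OF E ef(1,1)] orthonormal_onD[OF E ef(2,1)] ef(4) by (simp add: cinner_diff_left)
    moreover have "norm e = 1" using orthonormal_on_norm[OF E ef(1)] .
    ultimately show False using cinner_Cauchy_Schwarz[of "e - f" e] by (simp add: dist_norm)
  qed
  moreover have "d ` E \<subseteq> D" using d(1) by blast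
  ultimately show ?thesis using D(1) countable_image_inj_on countable_subset by metis
qed

lemma total_orthonormal_infinite:
  fixes E :: "'h set"
  assumes E: "orthonormal_on E (\<lambda>x. x)" and tot: "\<And>x. (\<And>e. e \<in> E \<Longrightarrow> cinner x e = 0) \<Longrightarrow> x = 0"
  shows "infinite E"
proof
  assume fin: "finite E"
  have "x \<in> cspan E" for x
  proof -
    have "x - (\<Sum>e\<in>E. cinner x e *\<^sub>C e) = 0"
      by (rule tot) (rule orthonormal_residual_orthogonal[OF E fin])
    then have "x = (\<Sum>e\<in>E. cinner x e *\<^sub>C e)" by simp
    also have "\<dots> \<in> cspan E"
      by (intro complex_vector.span_sum complex_vector.span_scale complex_vector.span_base)
    finally show ?thesis .
  qed
  then show False using infinite_dimensional fin by blast
qed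

lemma onb_of_bij:
  fixes E :: "'h set"
  assumes E: "orthonormal_on E (\<lambda>x. x)" and tot: "\<And>x. (\<And>e. e \<in> E \<Longrightarrow> cinner x e = 0) \<Longrightarrow> x = 0"
    and e: "bij_betw e (UNIV :: nat set) E"
  shows "onb e"
  unfolding onb_def orthonormal_on_def
proof (intro conjI ballI allI impI)
  fix i j :: nat
  have "e i \<in> E" "e j \<in> E" using bij_betwE[OF e] by auto
  moreover have "e i = e j \<longleftrightarrow> i = j" using e by (auto simp: bij_betw_def inj_eq)
  ultimately show "cinner (e i) (e j) = (if i = j then 1 else 0)" using orthonormal_onD[OF E] by simp
next
  fix x assume 0: "\<forall>i. cinner x (e i) = 0"
  show "x = 0"
  proof (rule tot)
    fix f assume "f \<in> E"
    then obtain i where "f = e i" using e by (auto simp: bij_betw_def)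
    then show "cinner x f = 0" using 0 by simp
  qed
qed

lemma onb_enumerate:
  fixes E :: "'h set"
  assumes E: "orthonormal_on E (\<lambda>x. x)" and tot: "\<And>x. (\<And>e. e \<in> E \<Longrightarrow> cinner x e = 0) \<Longrightarrow> x = 0"
  obtains e where "onb e" "bij_betw e (UNIV :: nat set) E"
proof -
  have "bij_betw (from_nat_into E) UNIV E"
    by (rule bij_betw_from_nat_into[OF orthonormal_countable[OF E] total_orthonormal_infinite[OF assms]])
  from onb_of_bij[OF assms this] this show ?thesis by (rule that)
qed

text \<open>The images of infinitely many basis vectors with \<open>\<mu> k > \<delta>\<close> would
  keep mutual distance greater than \<open>\<delta>\<close> and so have no convergent
  subsequence.\<close>

lemma positive_compact_finite_eigenvalues:
  fixes e :: "nat \<Rightarrow> 'h"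
  assumes V: "compact_operator V" and e: "orthonormal_on UNIV e"
    and mu: "\<And>k. V (e k) = complex_of_real (\<mu> k) *\<^sub>C e k" and d: "\<delta> > 0"
  shows "finite {k. \<mu> k > \<delta>}"
proof (rule ccontr)
  assume "infinite {k. \<mu> k > \<delta>}"
  from infinite_enumerate[OF this] obtain s :: "nat \<Rightarrow> nat" where s: "strict_mono s" "\<And>n. \<mu> (s n) > \<delta>"
    unfolding mem_Collect_eq by blast
  have "\<forall>n. V (e (s n)) \<in> closure (V ` cball 0 1)"
    using orthonormal_on_norm[OF e]
    by (intro allI subsetD[OF closure_subset] imageI) (simp add: dist_norm)
  moreover have "seq_compact (closure (V ` cball 0 1))"
    using V compact_imp_seq_compact unfolding compact_operator_def by blast
  ultimately obtain l r where lr: "strict_mono (r :: nat \<Rightarrow> nat)" "((\<lambda>n. V (e (s n))) \<circ> r) \<longlonglongrightarrow> l"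
    unfolding seq_compact_def by metis
  obtain N where N: "\<And>m n. m \<ge> N \<Longrightarrow> n \<ge> N \<Longrightarrow> dist (V (e (s (r m)))) (V (e (s (r n)))) < \<delta>"
    using LIMSEQ_imp_Cauchy[OF lr(2)] d unfolding Cauchy_def o_def by metis
  define i j where "i = s (r N)" and "j = s (r (Suc N))"
  have "r N < r (Suc N)" using lr(1) by (simp add: strict_mono_def)
  then have "i < j" using s(1) by (simp add: strict_mono_def i_def j_def)
  have "dist (V (e i)) (V (e j)) < \<delta>" unfolding i_def j_def by (intro N) auto
  moreover have "cinner (V (e i) - V (e j)) (e i) = \<mu> i"
    using \<open>i < j\<close> orthonormal_onD[OF e, of i i] orthonormal_onD[OF e, of j i]
    by (simp add: mu cinner_diff_left cinner_scaleC_left)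
  ultimately show False
    using cinner_Cauchy_Schwarz[of "V (e i) - V (e j)" "e i"] orthonormal_on_norm[OF e, of i] s(2)[of "r N"]
    by (simp add: dist_norm i_def)
qed

theorem spectral_theorem_positive_compact:
  fixes V :: "'h \<Rightarrow> 'h"
  assumes V: "positive_operator V" "compact_operator V"
  obtains e \<mu> K where "onb e" "\<And>k. 0 \<le> \<mu> k" "\<And>k. \<mu> k \<le> K" "\<And>k. V (e k) = complex_of_real (\<mu> k) *\<^sub>C e k"
    "V = diag_operator e (\<lambda>k. complex_of_real (\<mu> k))" "\<And>\<delta>. \<delta> > 0 \<Longrightarrow> finite {k. \<mu> k > \<delta>}"
proof -
  define P where "P x = (\<exists>t\<ge>0. V x = complex_of_real t *\<^sub>C x)" for x
  obtain E where E: "orthonormal_on E (\<lambda>x. x)" "\<And>x. x \<in> E \<Longrightarrow> P x"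
    and mx: "\<And>x. P x \<Longrightarrow> norm x = 1 \<Longrightarrow> (\<And>e. e \<in> E \<Longrightarrow> cinner x e = 0) \<Longrightarrow> False"
    using maximal_orthonormal[of "{}" P] by (auto simp: orthonormal_on_def)
  have tot: "x = 0" if x: "\<And>e. e \<in> E \<Longrightarrow> cinner x e = 0" for x
  proof (rule ccontr)
    assume "x \<noteq> 0"
    define M where "M = (\<Inter>e\<in>E. {y. cinner y e = 0})"
    have "\<exists>x\<in>M. norm x = 1 \<and> (\<exists>t\<ge>0. V x = complex_of_real t *\<^sub>C x)"
    proof (rule positive_compact_eigenvector[OF V])
      show "closed M" unfolding M_def
        by (intro closed_INT ballI closed_Collect_eq continuous_intros
            bounded_linear.continuous_on[OF bounded_linear_cinner_left])
      show "V y \<in> M" if "y \<in> M" for y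
        unfolding M_def
      proof (intro INT_I CollectI)
        fix e assume e: "e \<in> E"
        then obtain t where "V e = complex_of_real t *\<^sub>C e" using E(2) P_def by blast
        then show "cinner (V y) e = 0"
          using that e by (simp add: positive_symmetric[OF V(1)] cinner_scaleC_right M_def)
      qed
    qed (use x \<open>x \<noteq> 0\<close> in \<open>auto simp: M_def cinner_scaleC_left\<close>)
    then show False using mx unfolding P_def M_def by blast
  qed
  obtain e where e: "onb e" "bij_betw e (UNIV :: nat set) E"
    using onb_enumerate[OF E(1) tot] by blast
  have "P (e k)" for k using E(2) bij_betwE[OF e(2)] by auto
  then obtain \<mu> where mu: "\<And>k. 0 \<le> \<mu> k" "\<And>k. V (e k) = complex_of_real (\<mu> k) *\<^sub>C e k"
    unfolding P_def by metis
  obtain K where K: "K > 0" "\<And>x. norm (V x) \<le> K * norm x" using bop_bound[OF positive_bop[OF V(1)]] by blast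
  have muK: "\<mu> k \<le> K" for k
    using K(2)[of "e k"] mu(1)[of k] by (simp add: mu(2) norm_scaleC e(1))
  have bd: "cmod (complex_of_real (\<mu> k)) \<le> K" for k using mu(1) muK by simp
  have "V = diag_operator e (\<lambda>k. complex_of_real (\<mu> k))"
    by (rule bop_eqI[OF e(1) positive_bop[OF V(1)] onb_bop_diag[OF e(1) bd]])
      (simp add: onb_diag_basis[OF e(1) bd] mu(2))
  then show ?thesis
    using that[OF e(1) mu(1) muK mu(2)] positive_compact_finite_eigenvalues[OF V(2) onb_orthonormal[OF e(1)] mu(2)]
    by blast
qed

end

section \<open>Singular values and the weak trace class ideal\<close>

section \<open>Decreasing rearrangements\<close>

text \<open>\<open>s\<close> is the generalised inverse of the counting function \<open>N\<close>.
  Right continuity of \<open>N\<close> turns the infimum into the stated equivalence.\<close>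

lemma decreasing_rearrangement_exists:
  fixes l :: "nat \<Rightarrow> real"
  assumes fin: "\<And>t. t > 0 \<Longrightarrow> finite {j. l j > t}"
  obtains s :: "nat \<Rightarrow> real" where "decseq s" "\<And>k. 0 \<le> s k" "\<And>t k. t > 0 \<Longrightarrow> s k > t \<longleftrightarrow> k < card {j. l j > t}"
proof -
  define N where "N t = card {j. l j > t}" for t
  have N_mono: "N u \<le> N t" if "0 < t" "t \<le> u" for t u
    unfolding N_def using that by (intro card_mono fin) auto
  define A where "A k = {t. t > 0 \<and> N t \<le> k}" for k
  define s where "s k = Inf (A k)" for k
  have A_ne: "A k \<noteq> {}" for k
  proof -
    define M where "M = Max (insert 1 (l ` {j. l j > 1}))"
    have "M \<ge> 1" unfolding M_def using fin[of 1] by (intro Max_ge) auto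
    moreover have "l j \<le> M" for j
    proof (cases "l j > 1")
      case True
      then show ?thesis unfolding M_def using fin[of 1] by (intro Max_ge) auto
    qed (use \<open>M \<ge> 1\<close> in auto)
    then have "{j. l j > M} = {}" by (auto simp: not_less)
    ultimately have "M \<in> A k" unfolding A_def N_def by auto
    then show ?thesis by blast
  qed
  have A_bdd: "bdd_below (A k)" for k unfolding A_def by (rule bdd_belowI[of _ 0]) auto
  have key: "s k > t \<longleftrightarrow> k < N t" if t: "t > 0" for t k
  proof
    assume "s k > t"
    then have "t \<notin> A k" unfolding s_def using cInf_lower[OF _ A_bdd] by (meson not_less)
    then show "k < N t" using t unfolding A_def by auto
  next
    assume k: "k < N t"
    let ?F = "{j. l j > t}"
    have F: "finite ?F" "?F \<noteq> {}" using fin[OF t] k unfolding N_def by (blast, metis card.empty not_less0)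
    \<comment> \<open>Only finitely many values exceed \<open>t\<close>; the smallest of them leaves
      room for some \<open>u > t\<close> at which the count has not dropped.\<close>
    define m where "m = Min (l ` ?F)"
    have m: "m > t" unfolding m_def using F by (subst Min_gr_iff) auto
    then obtain u where u: "t < u" "u < m" using dense by blast
    have "?F \<subseteq> {j. l j > u}"
    proof
      fix j assume j: "j \<in> ?F"
      have "m \<le> l j" unfolding m_def using F j by (intro Min_le) auto
      then show "j \<in> {j. l j > u}" using u by simp
    qed
    then have Nu: "N t \<le> N u" unfolding N_def using t u by (intro card_mono fin) auto
    have "u \<le> s k" unfolding s_def
    proof (rule cInf_greatest[OF A_ne])
      fix v assume "v \<in> A k"
      then have v: "v > 0" "N v \<le> k" unfolding A_def by auto
      show "u \<le> v"
      proof (rule ccontr)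
        assume "\<not> u \<le> v"
        then have "N u \<le> N v" using v by (intro N_mono) auto
        then show False using v k Nu by simp
      qed
    qed
    then show "s k > t" using u by simp
  qed
  have "0 \<le> s k" for k unfolding s_def by (rule cInf_greatest[OF A_ne]) (auto simp: A_def)
  moreover have "decseq s" unfolding decseq_def s_def
    by (intro allI impI cInf_superset_mono A_ne A_bdd) (auto simp: A_def)
  ultimately show ?thesis using that key unfolding N_def by blast
qed

text \<open>Positive values accumulate only at 0, so some \<open>m < t\<close> has no value of
  either sequence strictly between \<open>m\<close> and \<open>t\<close>. A level set is then the
  difference of two superlevel sets.\<close>

lemma card_level_sets_eq:
  fixes s :: "nat \<Rightarrow> real" and l :: "nat \<Rightarrow> real"
  assumes fs: "\<And>t. t > 0 \<Longrightarrow> finite {j. s j > t}" and fl: "\<And>t. t > 0 \<Longrightarrow> finite {j. l j > t}"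
    and eq: "\<And>t. t > 0 \<Longrightarrow> card {j. s j > t} = card {j. l j > t}" and t: "t > 0"
  shows "finite {j. s j = t}" "card {j. s j = t} = card {j. l j = t}"
proof -
  let ?F = "{j. s j > t/2 \<and> s j < t}" and ?G = "{j. l j > t/2 \<and> l j < t}"
  define m where "m = Max (insert (t/2) (s ` ?F \<union> l ` ?G))"
  have F: "finite (insert (t/2) (s ` ?F \<union> l ` ?G))"
    using fs[of "t/2"] fl[of "t/2"] t by (auto elim!: rev_finite_subset)
  have m: "m < t" unfolding m_def using F t by (subst Max_less_iff) auto
  have m2: "t/2 \<le> m" unfolding m_def using F by (intro Max_ge) auto
  have below_s: "s j \<le> m" if "s j < t" for j
  proof (cases "s j > t/2")
    case True
    then show ?thesis unfolding m_def using F that by (intro Max_ge) auto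
  qed (use m2 in auto)
  have below_l: "l j \<le> m" if "l j < t" for j
  proof (cases "l j > t/2")
    case True
    then show ?thesis unfolding m_def using F that by (intro Max_ge) auto
  qed (use m2 in auto)
  have m0: "m > 0" using m2 t by simp
  have s: "{j. s j = t} = {j. s j > m} - {j. s j > t}"
    using m below_s by (auto simp: not_less) (metis antisym_conv2 leD)
  have l: "{j. l j = t} = {j. l j > m} - {j. l j > t}"
    using m below_l by (auto simp: not_less) (metis antisym_conv2 leD)
  show "finite {j. s j = t}" unfolding s using fs[OF m0] by simp
  have "card {j. s j = t} = card {j. s j > m} - card {j. s j > t}"
    unfolding s using fs t m by (intro card_Diff_subset) auto
  moreover have "card {j. l j = t} = card {j. l j > m} - card {j. l j > t}"
    unfolding l using fl t m by (intro card_Diff_subset) auto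
  ultimately show "card {j. s j = t} = card {j. l j = t}" using eq[OF m0] eq[OF t] by simp
qed

lemma card_eq_sum_level_sets:
  "finite A \<Longrightarrow> card A = (\<Sum>v\<in>f ` A. card {k\<in>A. f k = v})"
  using sum.image_gen[of A "\<lambda>_. 1 :: nat" f] by simp

lemma decseq_superlevel:
  fixes s :: "nat \<Rightarrow> real"
  assumes "decseq s" "finite {k. s k > t}"
  shows "s k > t \<longleftrightarrow> k < card {k. s k > t}"
proof -
  have down: "s i > t" if "s j > t" "i \<le> j" for i j
    using decseqD[OF assms(1) that(2)] that(1) by simp
  have "{k. s k > t} = {..<card {k. s k > t}}"
  proof (cases "{k. s k > t} = {}")
    case False
    define m where "m = Max {k. s k > t}"
    have m: "m \<in> {k. s k > t}" unfolding m_def by (rule Max_in[OF assms(2) False])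
    have "{k. s k > t} \<subseteq> {..m}" unfolding m_def by (intro subsetI) (simp add: Max_ge[OF assms(2)])
    moreover have "{..m} \<subseteq> {k. s k > t}" using down m by blast
    ultimately have "{k. s k > t} = {..m}" by blast
    then show ?thesis by (simp add: lessThan_Suc_atMost)
  qed simp
  then show ?thesis by blast
qed

text \<open>The multiplicities of the positive values determine the superlevel counts, and these
  determine a decreasing sequence. This uniqueness gives the definite description in
  \<open>singular_value\<close> its meaning.\<close>

lemma decreasing_rearrangement_unique:
  fixes s s' :: "nat \<Rightarrow> real"
  assumes s: "decseq s" "\<And>k. 0 \<le> s k" "\<And>t. t > 0 \<Longrightarrow> finite {j. s j > t}"
    and s': "decseq s'" "\<And>k. 0 \<le> s' k" "\<And>t. t > 0 \<Longrightarrow> finite {j. s' j = t}"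
    and eq: "\<And>t. t > 0 \<Longrightarrow> card {j. s' j = t} = card {j. s j = t}"
  shows "s' = s"
proof -
  have fs: "finite {j. s j = t}" if "t > 0" for t
    using s(3)[of "t/2"] that by (auto elim!: rev_finite_subset)
  have range_eq: "(\<exists>j. s j = t) \<longleftrightarrow> (\<exists>j. s' j = t)" if "t > 0" for t
    using eq[OF that] fs[OF that] s'(3)[OF that] by (metis (mono_tags, lifting) card_gt_0_iff empty_Collect_eq)
  have img: "s' ` {j. s' j > t} = s ` {j. s j > t}" if t: "t > 0" for t
  proof -
    have "v \<in> s' ` {j. s' j > t} \<longleftrightarrow> v > t \<and> (\<exists>j. s' j = v)" for v by auto
    moreover have "v \<in> s ` {j. s j > t} \<longleftrightarrow> v > t \<and> (\<exists>j. s j = v)" for v by auto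
    ultimately show ?thesis using range_eq t by (intro set_eqI) (smt (verit))
  qed
  have fin': "finite {j. s' j > t}" if t: "t > 0" for t
  proof -
    have "{j. s' j > t} = (\<Union>v\<in>s ` {j. s j > t}. {j. s' j = v})"
      unfolding img[OF t, symmetric] by auto
    also have "finite \<dots>" using s(3)[OF t] t by (intro finite_UN_I s'(3)) auto
    finally show ?thesis .
  qed
  have card_eq: "card {j. s' j > t} = card {j. s j > t}" if t: "t > 0" for t
  proof -
    have "card {j. s' j > t} = (\<Sum>v\<in>s ` {j. s j > t}. card {k\<in>{j. s' j > t}. s' k = v})"
      using card_eq_sum_level_sets[OF fin'[OF t], of s'] unfolding img[OF t] .
    also have "\<dots> = (\<Sum>v\<in>s ` {j. s j > t}. card {k\<in>{j. s j > t}. s k = v})"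
    proof (rule sum.cong[OF refl])
      fix v assume "v \<in> s ` {j. s j > t}"
      then have v: "v > t" by auto
      then have "{k\<in>{j. s' j > t}. s' k = v} = {k. s' k = v}" "{k\<in>{j. s j > t}. s k = v} = {k. s k = v}"
        by auto
      then show "card {k\<in>{j. s' j > t}. s' k = v} = card {k\<in>{j. s j > t}. s k = v}"
        using eq[of v] v t by simp
    qed
    also have "\<dots> = card {j. s j > t}" using card_eq_sum_level_sets[OF s(3)[OF t], of s] by simp
    finally show ?thesis .
  qed
  have iff: "s' k > t \<longleftrightarrow> s k > t" if "t > 0" for t k
  proof -
    have "s' k > t \<longleftrightarrow> k < card {j. s j > t}"
      unfolding card_eq[OF that, symmetric] by (rule decseq_superlevel[OF s'(1) fin'[OF that]])
    also have "\<dots> \<longleftrightarrow> s k > t"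
      by (rule decseq_superlevel[OF s(1) s(3)[OF that], symmetric])
    finally show ?thesis .
  qed
  show ?thesis
  proof
    fix k
    have False if "s k < s' k"
    proof -
      obtain t where t: "s k < t" "t < s' k" using \<open>s k < s' k\<close> dense by blast
      then have "t > 0" using s(2)[of k] by linarith
      with iff[of t k] t show False by linarith
    qed
    moreover have False if "s' k < s k"
    proof -
      obtain t where t: "s' k < t" "t < s k" using \<open>s' k < s k\<close> dense by blast
      then have "t > 0" using s'(2)[of k] by linarith
      with iff[of t k] t show False by linarith
    qed
    ultimately show "s' k = s k" by (meson linorder_neqE_linordered_idom)
  qed
qed

section \<open>Weak trace class operators and approximation numbers\<close>

text \<open>A bound on the Gelfand numbers. Unlike the eigenvalue count behind \<open>singular_value\<close>, it visibly
  passes to sums and products of operators.\<close>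

definition gelfand_weak :: "('h::complex_hilbert \<Rightarrow> 'h) \<Rightarrow> real \<Rightarrow> bool" where
  "gelfand_weak T K \<longleftrightarrow> T \<in> bounded_operators \<and>
    (\<forall>\<delta>>0. \<exists>C. finite C \<and> real (card C) \<le> K / \<delta> \<and> (\<forall>x. (\<forall>c\<in>C. cinner x c = 0) \<longrightarrow> norm (T x) \<le> \<delta> * norm x))"

lemma gelfand_weakD:
  assumes "gelfand_weak T K" "\<delta> > 0"
  obtains C where "finite C" "real (card C) \<le> K / \<delta>"
    "\<And>x. \<forall>c\<in>C. cinner x c = 0 \<Longrightarrow> norm (T x) \<le> \<delta> * norm x"
proof -
  have "\<exists>C. finite C \<and> real (card C) \<le> K / \<delta> \<and> (\<forall>x. (\<forall>c\<in>C. cinner x c = 0) \<longrightarrow> norm (T x) \<le> \<delta> * norm x)"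
    using assms by (simp add: gelfand_weak_def)
  then show ?thesis using that by blast
qed

text \<open>Gaussian elimination: equation \<open>c0\<close> removes the unknown with pivot
  \<open>a j c0\<close>, leaving one equation and one unknown fewer.\<close>

lemma homogeneous_system_solution:
  fixes a :: "'i \<Rightarrow> 'c \<Rightarrow> complex"
  assumes "finite C" "finite S" "card C < card S"
  obtains x where "\<exists>i\<in>S. x i \<noteq> 0" "\<And>c. c \<in> C \<Longrightarrow> (\<Sum>i\<in>S. x i * a i c) = 0"
proof -
  have "\<exists>x. (\<exists>i\<in>S. x i \<noteq> 0) \<and> (\<forall>c\<in>C. (\<Sum>i\<in>S. x i * a i c) = 0)"
    using assms
  proof (induction C arbitrary: S a rule: finite_induct)
    case empty
    then have "S \<noteq> {}" by auto
    then show ?case by (intro exI[of _ "\<lambda>_. 1"]) auto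
  next
    case (insert c0 C)
    show ?case
    proof (cases "\<forall>i\<in>S. a i c0 = 0")
      case True
      have "card C < card S" using insert by simp
      then obtain x where "\<exists>i\<in>S. x i \<noteq> 0" "\<forall>c\<in>C. (\<Sum>i\<in>S. x i * a i c) = 0"
        using insert.IH[OF insert.prems(1), of a] by blast
      then show ?thesis using True by (intro exI[of _ x]) auto
    next
      case False
      then obtain j where j: "j \<in> S" "a j c0 \<noteq> 0" by blast
      define a' where "a' i c = a i c - a i c0 / a j c0 * a j c" for i c
      have "card C < card (S - {j})" using insert.prems insert.hyps j by simp
      then obtain x where x: "\<exists>i\<in>S - {j}. x i \<noteq> 0" "\<forall>c\<in>C. (\<Sum>i\<in>S - {j}. x i * a' i c) = 0"
        using insert.IH[of "S - {j}" a'] insert.prems by blast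
      \<comment> \<open>The value of the eliminated unknown that solves equation
        \<open>c0\<close>.\<close>
      define t where "t = - (\<Sum>i\<in>S - {j}. x i * a i c0) / a j c0"
      define y where "y = x(j := t)"
      have *: "(\<Sum>i\<in>S. y i * a i c) = t * a j c + (\<Sum>i\<in>S - {j}. x i * a i c)" for c
      proof -
        have "(\<Sum>i\<in>S. y i * a i c) = y j * a j c + (\<Sum>i\<in>S - {j}. y i * a i c)"
          by (rule sum.remove[OF insert.prems(1) j(1)])
        also have "(\<Sum>i\<in>S - {j}. y i * a i c) = (\<Sum>i\<in>S - {j}. x i * a i c)"
          by (intro sum.cong) (auto simp: y_def)
        finally show ?thesis by (simp add: y_def)
      qed
      have "(\<Sum>i\<in>S. y i * a i c) = 0" if "c \<in> insert c0 C" for c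
      proof (cases "c = c0")
        case True
        then show ?thesis using j by (simp add: * t_def)
      next
        case False
        then have "0 = (\<Sum>i\<in>S - {j}. x i * a' i c)" using that x(2) by simp
        also have "\<dots> = (\<Sum>i\<in>S - {j}. x i * a i c) - (\<Sum>i\<in>S - {j}. x i * a i c0 * (a j c / a j c0))"
          unfolding sum_subtractf[symmetric] by (intro sum.cong) (auto simp: a'_def algebra_simps)
        also have "\<dots> = (\<Sum>i\<in>S - {j}. x i * a i c) + t * a j c"
          unfolding sum_distrib_right[symmetric] by (simp add: t_def)
        finally show ?thesis by (simp add: * add.commute)
      qed
      moreover have "\<exists>i\<in>S. y i \<noteq> 0" using x(1) by (auto simp: y_def)
      ultimately show ?thesis by blast
    qed
  qed
  then show ?thesis using that by blast
qed

text \<open>A dimension count: if there are fewer test vectors than elements of \<open>S\<close>,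
  some non-zero combination is orthogonal to all of them, and there \<open>T\<close> would be both
  small and large.\<close>

lemma gelfand_weak_card:
  fixes e :: "'i \<Rightarrow> 'h::complex_hilbert"
  assumes T: "gelfand_weak T K" and d: "\<delta> > 0" and S: "finite S" "orthonormal_on S e"
    and big: "\<And>x. \<exists>i\<in>S. x i \<noteq> 0 \<Longrightarrow> norm (T (\<Sum>i\<in>S. x i *\<^sub>C e i)) > \<delta> * norm (\<Sum>i\<in>S. x i *\<^sub>C e i)"
  shows "real (card S) \<le> K / \<delta>"
proof (rule ccontr)
  assume "\<not> real (card S) \<le> K / \<delta>"
  obtain C where C: "finite C" "real (card C) \<le> K / \<delta>"
    "\<And>x. \<forall>c\<in>C. cinner x c = 0 \<Longrightarrow> norm (T x) \<le> \<delta> * norm x"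
    using gelfand_weakD[OF T d] by blast
  have "card C < card S" using C(2) \<open>\<not> real (card S) \<le> K / \<delta>\<close> by linarith
  then obtain x where x: "\<exists>i\<in>S. x i \<noteq> 0" "\<And>c. c \<in> C \<Longrightarrow> (\<Sum>i\<in>S. x i * cinner (e i) c) = 0"
    using homogeneous_system_solution[OF C(1) S(1), of "\<lambda>i c. cinner (e i) c"] by blast
  have "norm (T (\<Sum>i\<in>S. x i *\<^sub>C e i)) \<le> \<delta> * norm (\<Sum>i\<in>S. x i *\<^sub>C e i)"
    by (rule C(3)) (simp add: cinner_sum_left cinner_scaleC_left x(2))
  with big[OF x(1)] show False by simp
qed

text \<open>Serves to replace the test vectors of a Gelfand bound by orthonormal ones, for which the
  projection is an explicit finite sum.\<close>

lemma Gram_Schmidt: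
  fixes C :: "'h::complex_hilbert set"
  assumes "finite C"
  obtains F where "finite F" "orthonormal_on F (\<lambda>x. x)"
    "\<And>x. \<forall>f\<in>F. cinner x f = 0 \<Longrightarrow> \<forall>c\<in>C. cinner x c = 0"
proof -
  have "\<exists>F. finite F \<and> orthonormal_on F (\<lambda>x. x) \<and> (\<forall>x. (\<forall>f\<in>F. cinner x f = 0) \<longrightarrow> (\<forall>c\<in>C. cinner x c = 0))"
    using assms
  proof (induction C rule: finite_induct)
    case empty
    then show ?case by (intro exI[of _ "{}"]) (auto simp: orthonormal_on_def)
  next
    case (insert c C)
    then obtain F where F: "finite F" "orthonormal_on F (\<lambda>x. x)"
      "\<And>x. (\<forall>f\<in>F. cinner x f = 0) \<Longrightarrow> (\<forall>c\<in>C. cinner x c = 0)" by blast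
    define d where "d = c - (\<Sum>f\<in>F. cinner c f *\<^sub>C f)"
    have perp: "cinner x c = cinner x d" if "\<forall>f\<in>F. cinner x f = 0" for x
      using that by (simp add: d_def cinner_diff_right cinner_sum_right cinner_scaleC_right)
    have dF: "cinner d f = 0" if "f \<in> F" for f
      unfolding d_def by (rule orthonormal_residual_orthogonal[OF F(2,1) that])
    show ?case
    proof (cases "d = 0")
      case True
      then show ?thesis using F perp by (intro exI[of _ F]) auto
    next
      case False
      define g where "g = complex_of_real (1 / norm d) *\<^sub>C d"
      have "cinner g g = 1" using False by (simp add: cinner_self norm_scaleC g_def norm_divide)
      moreover have "cinner g f = 0" if "f \<in> F" for f using dF[OF that] by (simp add: g_def cinner_scaleC_left)
      moreover from this have "cinner f g = 0" if "f \<in> F" for f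
        using that by (metis cinner_commute complex_cnj_zero)
      ultimately have "orthonormal_on (insert g F) (\<lambda>x. x)"
        using F(2) unfolding orthonormal_on_def by auto
      moreover have "cinner x d = 0" if "cinner x g = 0" for x
        using that False by (simp add: g_def cinner_scaleC_right)
      ultimately show ?thesis using F perp by (intro exI[of _ "insert g F"]) auto
    qed
  qed
  then show ?thesis using that by blast
qed

lemma compact_finite_combinations:
  fixes F :: "'h::complex_hilbert set"
  assumes "finite F"
  shows "compact {\<Sum>f\<in>F. c f *\<^sub>C f | c. \<forall>f. cmod (c f) \<le> 1}"
  using assms
proof (induction F rule: finite_induct)
  case empty
  have "{\<Sum>f\<in>{}. c f *\<^sub>C f | c. \<forall>f. cmod (c f) \<le> 1} = {0 :: 'h}"
    by (auto intro: exI[of _ "\<lambda>_. 0"])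
  then show ?case by simp
next
  case (insert g F)
  have cont: "continuous_on (cball 0 1) (\<lambda>a. a *\<^sub>C g)"
  proof -
    have "bounded_linear (\<lambda>a. a *\<^sub>C g)"
      by (rule bounded_linear_intro[of _ "norm g"])
        (auto simp: scaleC_add_left scaleR_conv_scaleC scaleR_conv_of_real scaleC_scaleC norm_scaleC)
    then show ?thesis by (rule bounded_linear.continuous_on) (intro continuous_intros)
  qed
  let ?S = "{\<Sum>f\<in>F. c f *\<^sub>C f | c. \<forall>f. cmod (c f) \<le> 1}"
  have "{\<Sum>f\<in>insert g F. c f *\<^sub>C f | c. \<forall>f. cmod (c f) \<le> 1}
      = {x + y | x y. x \<in> (\<lambda>a. a *\<^sub>C g) ` cball 0 1 \<and> y \<in> ?S}" (is "?L = ?R")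
  proof
    show "?L \<subseteq> ?R"
    proof
      fix z assume "z \<in> ?L"
      then obtain c where c: "\<forall>f. cmod (c f) \<le> 1" "z = c g *\<^sub>C g + (\<Sum>f\<in>F. c f *\<^sub>C f)"
        using insert.hyps by auto
      moreover have "c g *\<^sub>C g \<in> (\<lambda>a. a *\<^sub>C g) ` cball 0 1" using c by (intro imageI) (simp add: dist_norm)
      ultimately show "z \<in> ?R" by blast
    qed
    show "?R \<subseteq> ?L"
    proof
      fix z assume "z \<in> ?R"
      then obtain a c where ac: "cmod a \<le> 1" "\<forall>f. cmod (c f) \<le> 1" "z = a *\<^sub>C g + (\<Sum>f\<in>F. c f *\<^sub>C f)"
        by (auto simp: dist_norm)
      have "(\<Sum>f\<in>F. (c(g := a)) f *\<^sub>C f) = (\<Sum>f\<in>F. c f *\<^sub>C f)"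
        using insert.hyps by (intro sum.cong) auto
      then have "z = (\<Sum>f\<in>insert g F. (c(g := a)) f *\<^sub>C f)"
        using insert.hyps ac(3) by simp
      moreover have "\<forall>f. cmod ((c(g := a)) f) \<le> 1" using ac by simp
      ultimately show "z \<in> ?L" by blast
    qed
  qed
  moreover have "compact ?R"
    by (intro compact_sums compact_continuous_image[OF cont] compact_cball insert.IH)
  ultimately show ?case by metis
qed

text \<open>Up to a small error the unit ball is mapped into the image of a bounded part of a
  finite-dimensional space, which is compact; hence the image is totally bounded.\<close>

lemma compact_operatorI:
  fixes T :: "'h::complex_hilbert \<Rightarrow> 'h"
  assumes T: "T \<in> bounded_operators"
    and appr: "\<And>\<delta>. \<delta> > 0 \<Longrightarrow> \<exists>C. finite C \<and> (\<forall>x. (\<forall>c\<in>C. cinner x c = 0) \<longrightarrow> norm (T x) \<le> \<delta> * norm x)"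
  shows "compact_operator T"
proof -
  have "\<exists>k. finite k \<and> closure (T ` cball 0 1) \<subseteq> (\<Union>x\<in>k. ball x \<epsilon>)" if eps: "\<epsilon> > 0" for \<epsilon> :: real
  proof -
    obtain C where C: "finite C" "\<And>x. \<forall>c\<in>C. cinner x c = 0 \<Longrightarrow> norm (T x) \<le> \<epsilon>/4 * norm x"
      using appr[of "\<epsilon>/4"] eps by auto
    obtain F where F: "finite F" "orthonormal_on F (\<lambda>x. x)"
      "\<And>x. \<forall>f\<in>F. cinner x f = 0 \<Longrightarrow> \<forall>c\<in>C. cinner x c = 0"
      using Gram_Schmidt[OF C(1)] by blast
    let ?S = "{\<Sum>f\<in>F. c f *\<^sub>C f | c. \<forall>f. cmod (c f) \<le> 1}"
    have "compact (T ` ?S)"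
      by (intro compact_continuous_image bounded_linear.continuous_on[OF bop_linear[OF T]]
          continuous_intros compact_finite_combinations F(1))
    then obtain k where k: "finite k" "T ` ?S \<subseteq> (\<Union>x\<in>k. ball x (\<epsilon>/4))"
      unfolding compact_eq_totally_bounded using eps by (meson divide_pos_pos zero_less_numeral)
    \<comment> \<open>Closed balls of radius \<epsilon>/2 let the inclusion pass to the closure;
      only afterwards are they enlarged to open balls of radius \<epsilon>.\<close>
    have "T ` cball 0 1 \<subseteq> (\<Union>x\<in>k. cball x (\<epsilon>/2))"
    proof
      fix y assume "y \<in> T ` cball 0 1"
      then obtain x where x: "y = T x" "norm x \<le> 1" by (auto simp: dist_norm)
      define p where "p = (\<Sum>f\<in>F. cinner x f *\<^sub>C f)"
      define c where "c f = (if f \<in> F then cinner x f else 0)" for f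
      have "cmod (c f) \<le> 1" for f
      proof (cases "f \<in> F")
        case True
        then have "norm f = 1" using orthonormal_on_norm[OF F(2)] by blast
        then show ?thesis using cinner_Cauchy_Schwarz[of x f] x(2) by (simp add: c_def)
      qed (simp add: c_def)
      moreover have "p = (\<Sum>f\<in>F. c f *\<^sub>C f)" unfolding p_def c_def by (intro sum.cong) auto
      ultimately have "p \<in> ?S" by blast
      then obtain z where z: "z \<in> k" "dist z (T p) < \<epsilon>/4" using k(2) by (auto simp: image_subset_iff)
      have "(norm (x - p))\<^sup>2 \<le> (norm x)\<^sup>2"
        unfolding p_def Bessel_residual[OF F(2,1)] by (simp add: sum_nonneg)
      then have "norm (x - p) \<le> 1" using x(2) by (meson norm_ge_zero order_trans power2_le_imp_le)
      moreover have "norm (T (x - p)) \<le> \<epsilon>/4 * norm (x - p)"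
      proof (rule C(2), rule F(3))
        show "\<forall>f\<in>F. cinner (x - p) f = 0"
          unfolding p_def by (intro ballI orthonormal_residual_orthogonal[OF F(2,1)])
      qed
      ultimately have "norm (T (x - p)) \<le> \<epsilon>/4"
        using eps by (meson divide_pos_pos less_imp_le mult_left_le order_trans zero_less_numeral)
      then have "dist (T p) (T x) \<le> \<epsilon>/4" by (simp add: dist_norm bop_diff[OF T] norm_minus_commute)
      then have "dist z (T x) \<le> \<epsilon>/2" using z(2) dist_triangle[of z "T x" "T p"] by simp
      then show "y \<in> (\<Union>x\<in>k. cball x (\<epsilon>/2))" using z x by auto
    qed
    then have "closure (T ` cball 0 1) \<subseteq> (\<Union>x\<in>k. cball x (\<epsilon>/2))"
      by (intro closure_minimal closed_UN k(1)) auto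
    also have "\<dots> \<subseteq> (\<Union>x\<in>k. ball x \<epsilon>)" using eps by fastforce
    finally show ?thesis using k(1) by blast
  qed
  then have "compact (closure (T ` cball 0 1))"
    unfolding compact_eq_totally_bounded by (simp add: complete_eq_closed)
  then show ?thesis using T by (simp add: compact_operator_def)
qed

context hilbert_basis
begin

lemma positive_adjoint_comp:
  fixes T :: "'h \<Rightarrow> 'h"
  assumes T: "T \<in> bounded_operators"
  shows "positive_operator (\<lambda>x. cadjoint T (T x))"
proof -
  have "cinner (cadjoint T (T x)) x \<in> \<real>\<^sub>\<ge>\<^sub>0" for x
    by (simp add: cinner_adjoint'[OF T] cinner_self nonneg_Reals_of_real_iff del: of_real_power)
  then show ?thesis unfolding positive_operator_def
    using bop_comp[OF bop_adjoint[OF T] T] by blast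
qed

lemma compact_adjoint_comp:
  fixes T :: "'h \<Rightarrow> 'h"
  assumes T: "compact_operator T"
  shows "compact_operator (\<lambda>x. cadjoint T (T x))"
proof -
  have b: "T \<in> bounded_operators" using T by (simp add: compact_operator_def)
  let ?K = "cadjoint T ` closure (T ` cball 0 1)"
  have "compact ?K"
    using T unfolding compact_operator_def
    by (intro compact_continuous_image bounded_linear.continuous_on[OF bop_linear[OF bop_adjoint[OF b]]]
        continuous_intros) auto
  have "(\<lambda>x. cadjoint T (T x)) ` cball 0 1 \<subseteq> ?K"
    using closure_subset[of "T ` cball 0 1"] by (auto simp: image_subset_iff)
  then have "closure ((\<lambda>x. cadjoint T (T x)) ` cball 0 1) \<subseteq> ?K"
    by (rule closure_minimal[OF _ compact_imp_closed[OF \<open>compact ?K\<close>]])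
  then have "?K \<inter> closure ((\<lambda>x. cadjoint T (T x)) ` cball 0 1) = closure ((\<lambda>x. cadjoint T (T x)) ` cball 0 1)"
    by (rule Int_absorb1)
  with compact_Int_closed[OF \<open>compact ?K\<close> closed_closure, of "(\<lambda>x. cadjoint T (T x)) ` cball 0 1"]
  have "compact (closure ((\<lambda>x. cadjoint T (T x)) ` cball 0 1))"
    by simp
  then show ?thesis unfolding compact_operator_def using bop_comp[OF bop_adjoint[OF b] b] by blast
qed

end

lemma cdim_diag_eigenspace:
  fixes e :: "nat \<Rightarrow> 'h::complex_hilbert"
  assumes e: "onb e" and l: "\<And>k. cmod (l k) \<le> K" and fin: "finite {k. l k = t}"
  shows "cdim {x. diag_operator e l x = t *\<^sub>C x} = card {k. l k = t}"
proof -
  note bop_diag = onb_bop_diag[where y = l, OF e l]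
  let ?S = "{k. l k = t}"
  have inj: "inj_on e ?S"
    using onb_cinner[OF e] by (intro inj_onI) (metis zero_neq_one)
  have span: "{x. diag_operator e l x = t *\<^sub>C x} = cspan (e ` ?S)"
  proof
    show "{x. diag_operator e l x = t *\<^sub>C x} \<subseteq> cspan (e ` ?S)"
    proof
      fix x assume "x \<in> {x. diag_operator e l x = t *\<^sub>C x}"
      then have dx: "diag_operator e l x = t *\<^sub>C x" by simp
      have x: "l k * cinner x (e k) = t * cinner x (e k)" for k
        unfolding cinner_scaleC_left[symmetric] dx[symmetric]
        unfolding cinner_scaleC_left by (rule onb_diag_coeff[where y = l, OF e l, symmetric])
      have "x = (\<Sum>k\<in>?S. cinner x (e k) *\<^sub>C e k)"
      proof (rule onb_eqI[OF e])
        fix i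
        show "cinner x (e i) = cinner (\<Sum>k\<in>?S. cinner x (e k) *\<^sub>C e k) (e i)"
          using x[of i] cinner_sum_orthonormal[OF onb_orthonormal[OF e, of UNIV] fin, of i "\<lambda>k. cinner x (e k)"]
          by auto
      qed
      also have "\<dots> \<in> cspan (e ` ?S)"
        by (intro complex_vector.span_sum complex_vector.span_scale complex_vector.span_base) auto
      finally show "x \<in> cspan (e ` ?S)" .
    qed
    show "cspan (e ` ?S) \<subseteq> {x. diag_operator e l x = t *\<^sub>C x}"
    proof
      fix x assume "x \<in> cspan (e ` ?S)"
      then show "x \<in> {x. diag_operator e l x = t *\<^sub>C x}"
      proof (induction rule: complex_vector.span_induct_alt)
        case base
        show ?case by (simp add: bop_0[OF bop_diag])
      next
        case (step c x y)
        then show ?case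
          by (auto simp: bop_add[OF bop_diag] bop_scaleC[OF bop_diag]
              onb_diag_basis[where y = l, OF e l] scaleC_add_right scaleC_scaleC mult.commute)
      qed
    qed
  qed
  have "\<not> complex_vector.dependent (e ` ?S)"
  proof
    assume "complex_vector.dependent (e ` ?S)"
    then obtain u v where u: "v \<in> e ` ?S" "u v \<noteq> 0" "(\<Sum>v\<in>e ` ?S. u v *\<^sub>C v) = 0"
      using complex_vector.dependent_finite[of "e ` ?S"] fin by auto
    obtain k where k: "v = e k" "k \<in> ?S" using u(1) by blast
    have "cinner (\<Sum>i\<in>?S. u (e i) *\<^sub>C e i) (e k) = u (e k)"
      using cinner_sum_orthonormal[OF onb_orthonormal[OF e, of UNIV] fin, of k "\<lambda>i. u (e i)"] k by simp
    moreover have "(\<Sum>i\<in>?S. u (e i) *\<^sub>C e i) = 0" using u(3) by (simp add: sum.reindex[OF inj])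
    ultimately show False using u(2) k by simp
  qed
  then show ?thesis
    unfolding span by (simp add: complex_vector.dim_span complex_vector.dim_eq_card_independent card_image[OF inj])
qed

context separable_hilbert
begin

text \<open>Evaluates the definite description in \<open>singular_value\<close>: the numbers
  \<open>l k\<close> are the square roots of the eigenvalues of the adjoint of \<open>T\<close>
  times \<open>T\<close>, and their decreasing rearrangement is the only admissible listing.\<close>

lemma compact_singular_values:
  fixes T :: "'h \<Rightarrow> 'h"
  assumes T: "compact_operator T"
  obtains e l where "onb e" "\<And>k. 0 \<le> l k" "\<And>x. (\<lambda>k. (l k)\<^sup>2 * (cmod (cinner x (e k)))\<^sup>2) sums (norm (T x))\<^sup>2"
    "\<And>t. t > 0 \<Longrightarrow> finite {k. l k > t}"
    "\<And>t k. t > 0 \<Longrightarrow> singular_value k T > t \<longleftrightarrow> k < card {j. l j > t}" "\<And>k. 0 \<le> singular_value k T"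
proof -
  have b: "T \<in> bounded_operators" using T by (simp add: compact_operator_def)
  obtain e \<mu> K where e: "onb e" and mu: "\<And>k. 0 \<le> \<mu> k" "\<And>k. \<mu> k \<le> K"
    and TT: "(\<lambda>x. cadjoint T (T x)) = diag_operator e (\<lambda>k. complex_of_real (\<mu> k))"
    and fin: "\<And>\<delta>. \<delta> > 0 \<Longrightarrow> finite {k. \<mu> k > \<delta>}"
    by (rule spectral_theorem_positive_compact[OF positive_adjoint_comp[OF b] compact_adjoint_comp[OF T]], rule that)
  have bd: "cmod (complex_of_real (\<mu> k)) \<le> K" for k using mu by simp
  define l where "l k = sqrt (\<mu> k)" for k
  have l0: "0 \<le> l k" for k using mu by (simp add: l_def)
  have l2: "(l k)\<^sup>2 = \<mu> k" for k using mu by (simp add: l_def)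
  have gt: "l k > t \<longleftrightarrow> \<mu> k > t\<^sup>2" if "t > 0" for t k
  proof
    assume "l k > t"
    then have "t\<^sup>2 < (l k)\<^sup>2" using that by (intro power_strict_mono) auto
    then show "\<mu> k > t\<^sup>2" by (simp only: l2)
  next
    assume "\<mu> k > t\<^sup>2"
    then show "l k > t" unfolding l_def by (rule real_less_rsqrt)
  qed
  have finl: "finite {k. l k > t}" if "t > 0" for t
    using fin[of "t\<^sup>2"] that by (simp add: gt)
  have ns: "(\<lambda>k. (l k)\<^sup>2 * (cmod (cinner x (e k)))\<^sup>2) sums (norm (T x))\<^sup>2" for x
  proof -
    have "cinner (diag_operator e (\<lambda>k. complex_of_real (\<mu> k)) x) x = complex_of_real ((norm (T x))\<^sup>2)"
      unfolding TT[THEN fun_cong, of x, symmetric] by (simp add: cinner_adjoint'[OF b] cinner_self)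
    from onb_cinner_sums[OF e, of "diag_operator e (\<lambda>k. complex_of_real (\<mu> k)) x" x, unfolded this]
    have "(\<lambda>i. cinner (diag_operator e (\<lambda>k. complex_of_real (\<mu> k)) x) (e i) * cinner (e i) x) sums complex_of_real ((norm (T x))\<^sup>2)" .
    moreover have "cinner (diag_operator e (\<lambda>k. complex_of_real (\<mu> k)) x) (e i) * cinner (e i) x
      = complex_of_real ((l i)\<^sup>2 * (cmod (cinner x (e i)))\<^sup>2)" for i
    proof -
      have "cinner x (e i) * cinner (e i) x = complex_of_real ((cmod (cinner x (e i)))\<^sup>2)"
        by (metis cinner_commute complex_norm_square)
      then show ?thesis by (simp add: onb_diag_coeff[where y = "\<lambda>k. complex_of_real (\<mu> k)", OF e bd] l2 del: of_real_power)
    qed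
    ultimately show ?thesis by (simp only: sums_of_real_iff)
  qed
  obtain s :: "nat \<Rightarrow> real" where s: "decseq s" "\<And>k. 0 \<le> s k" "\<And>t k. t > 0 \<Longrightarrow> s k > t \<longleftrightarrow> k < card {j. l j > t}"
    using decreasing_rearrangement_exists[of l] finl by blast
  have sset: "{k. s k > t} = {..<card {j. l j > t}}" if "t > 0" for t using s(3)[OF that] by auto
  have sfin: "finite {k. s k > t}" if "t > 0" for t unfolding sset[OF that] by simp
  have scard: "card {k. s k > t} = card {j. l j > t}" if "t > 0" for t unfolding sset[OF that] by simp
  have dimc: "cdim {x. cadjoint T (T x) = complex_of_real (t\<^sup>2) *\<^sub>C x} = card {k. s k = t}" if t: "t > 0" for t
  proof -
    have eqs: "{k. complex_of_real (\<mu> k) = complex_of_real (t\<^sup>2)} = {k. l k = t}"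
      using t l0 l2 by (auto simp: of_real_eq_iff simp del: of_real_power) (metis abs_of_pos l_def mu(1) real_sqrt_abs)
    have "finite {k. l k = t}" using finl[of "t/2"] t by (auto elim!: rev_finite_subset)
    then have "cdim {x. diag_operator e (\<lambda>k. complex_of_real (\<mu> k)) x = complex_of_real (t\<^sup>2) *\<^sub>C x} = card {k. l k = t}"
      using cdim_diag_eigenspace[where l = "\<lambda>k. complex_of_real (\<mu> k)", OF e bd, of "complex_of_real (t\<^sup>2)"] unfolding eqs by blast
    then show ?thesis
      unfolding TT[symmetric] using card_level_sets_eq(2)[OF sfin finl scard t] by simp
  qed
  have "(THE s. lists_singular_values T s) = s"
  proof (rule the_equality)
    show "lists_singular_values T s"
      unfolding lists_singular_values_def
      using s(1,2) dimc card_level_sets_eq(1)[OF sfin finl scard] by simp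
    fix s' assume s': "lists_singular_values T s'"
    show "s' = s"
    proof (rule decreasing_rearrangement_unique[OF s(1,2) sfin])
      show "decseq s'" "\<And>k. 0 \<le> s' k" "\<And>t. t > 0 \<Longrightarrow> finite {j. s' j = t}"
        using s' unfolding lists_singular_values_def by auto
      show "\<And>t. t > 0 \<Longrightarrow> card {j. s' j = t} = card {j. s j = t}"
        using s' unfolding lists_singular_values_def by (metis dimc)
    qed auto
  qed
  then have "singular_value k T = s k" for k by (simp add: singular_value_def)
  then show ?thesis using that[OF e l0 ns finl] s by simp
qed

text \<open>In one direction the eigenvectors with \<open>l k > \<delta>\<close> are the test
  vectors. In the other, a Gelfand bound limits the number of such eigenvectors, because
  \<open>T\<close> stretches every non-zero vector of their span by more than
  \<open>\<delta>\<close>.\<close>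

theorem weak_L1_iff_gelfand: "(T :: 'h \<Rightarrow> 'h) \<in> weak_L1 \<longleftrightarrow> (\<exists>K. gelfand_weak T K)"
proof
  assume "T \<in> weak_L1"
  then have T: "compact_operator T" and bdd: "bdd_above (range (\<lambda>k. real (k + 1) * singular_value k T))"
    by (auto simp: weak_L1_def)
  obtain K where K: "\<And>k. real (k + 1) * singular_value k T \<le> K" using bdd unfolding bdd_above_def by blast
  obtain e l where e: "onb e" and l: "\<And>k. 0 \<le> l k"
    and ns: "\<And>x. (\<lambda>k. (l k)\<^sup>2 * (cmod (cinner x (e k)))\<^sup>2) sums (norm (T x))\<^sup>2"
    and fin: "\<And>t. t > 0 \<Longrightarrow> finite {k. l k > t}"
    and sv: "\<And>t k. t > 0 \<Longrightarrow> singular_value k T > t \<longleftrightarrow> k < card {j. l j > t}" "\<And>k. 0 \<le> singular_value k T"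
    using compact_singular_values[OF T] by blast
  have "gelfand_weak T K"
    unfolding gelfand_weak_def
  proof (intro conjI allI impI)
    show "T \<in> bounded_operators" using T by (simp add: compact_operator_def)
    fix \<delta> :: real assume d: "\<delta> > 0"
    let ?S = "{k. l k > \<delta>}"
    have "real (card ?S) \<le> K / \<delta>"
    proof (cases "card ?S")
      case 0
      have "0 \<le> K" using K[of 0] sv(2)[of 0] by simp
      then show ?thesis using 0 d by simp
    next
      case (Suc n)
      then have "singular_value n T > \<delta>" using sv(1)[OF d, of n] by simp
      then have "real (n + 1) * \<delta> \<le> real (n + 1) * singular_value n T" by (intro mult_left_mono) auto
      then show ?thesis using K[of n] Suc d by (simp add: field_simps)
    qed
    then have "real (card (e ` ?S)) \<le> K / \<delta>" using card_image_le[OF fin[OF d], of e] by linarith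
    moreover have "norm (T x) \<le> \<delta> * norm x" if x: "\<forall>c\<in>e ` ?S. cinner x c = 0" for x
    proof (rule power2_le_imp_le)
      have "(norm (T x))\<^sup>2 \<le> \<delta>\<^sup>2 * (norm x)\<^sup>2"
      proof (rule sums_le[OF _ ns sums_mult[OF onb_Parseval[OF e]]])
        fix k
        show "(l k)\<^sup>2 * (cmod (cinner x (e k)))\<^sup>2 \<le> \<delta>\<^sup>2 * (cmod (cinner x (e k)))\<^sup>2"
        proof (cases "l k > \<delta>")
          case True
          then show ?thesis using x by simp
        qed (use l in \<open>auto intro!: mult_right_mono power_mono simp: not_less\<close>)
      qed
      then show "(norm (T x))\<^sup>2 \<le> (\<delta> * norm x)\<^sup>2" by (simp add: power_mult_distrib)
    qed (use d in auto)
    ultimately show "\<exists>C. finite C \<and> real (card C) \<le> K / \<delta> \<and>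
        (\<forall>x. (\<forall>c\<in>C. cinner x c = 0) \<longrightarrow> norm (T x) \<le> \<delta> * norm x)"
      using fin[OF d] by (intro exI[of _ "e ` ?S"]) simp
  qed
  then show "\<exists>K. gelfand_weak T K" ..
next
  assume "\<exists>K. gelfand_weak T K"
  then obtain K where G: "gelfand_weak T K" ..
  then have b: "T \<in> bounded_operators" by (simp add: gelfand_weak_def)
  have T: "compact_operator T"
    by (rule compact_operatorI[OF b]) (use G in \<open>unfold gelfand_weak_def, blast\<close>)
  obtain e l where e: "onb e" and l: "\<And>k. 0 \<le> l k"
    and ns: "\<And>x. (\<lambda>k. (l k)\<^sup>2 * (cmod (cinner x (e k)))\<^sup>2) sums (norm (T x))\<^sup>2"
    and fin: "\<And>t. t > 0 \<Longrightarrow> finite {k. l k > t}"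
    and sv: "\<And>t k. t > 0 \<Longrightarrow> singular_value k T > t \<longleftrightarrow> k < card {j. l j > t}" "\<And>k. 0 \<le> singular_value k T"
    using compact_singular_values[OF T] by blast
  have card: "real (card {k. l k > \<delta>}) \<le> K / \<delta>" if d: "\<delta> > 0" for \<delta>
  proof (rule gelfand_weak_card[OF G d fin[OF d] onb_orthonormal[OF e]])
    fix x :: "nat \<Rightarrow> complex" assume x: "\<exists>i\<in>{k. l k > \<delta>}. x i \<noteq> 0"
    let ?S = "{k. l k > \<delta>}"
    let ?v = "\<Sum>i\<in>?S. x i *\<^sub>C e i"
    have co: "cinner ?v (e k) = (if k \<in> ?S then x k else 0)" for k
      by (rule cinner_sum_orthonormal[OF onb_orthonormal[OF e, of UNIV] fin[OF d]]) auto
    have "(\<lambda>k. if k \<in> ?S then (l k)\<^sup>2 * (cmod (x k))\<^sup>2 else 0) sums (norm (T ?v))\<^sup>2"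
      using ns[of ?v] unfolding co by (rule sums_cong[THEN iffD1, rotated]) auto
    then have nT: "(norm (T ?v))\<^sup>2 = (\<Sum>k\<in>?S. (l k)\<^sup>2 * (cmod (x k))\<^sup>2)"
      using sums_If_finite_set[OF fin[OF d], of "\<lambda>k. (l k)\<^sup>2 * (cmod (x k))\<^sup>2"] by (rule sums_unique2)
    obtain i where i: "i \<in> ?S" "x i \<noteq> 0" using x by blast
    have "\<delta>\<^sup>2 * (\<Sum>k\<in>?S. (cmod (x k))\<^sup>2) < (\<Sum>k\<in>?S. (l k)\<^sup>2 * (cmod (x k))\<^sup>2)"
      unfolding sum_distrib_left
    proof (rule sum_strict_mono_ex1[OF fin[OF d]])
      show "\<forall>k\<in>?S. \<delta>\<^sup>2 * (cmod (x k))\<^sup>2 \<le> (l k)\<^sup>2 * (cmod (x k))\<^sup>2"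
        using d by (auto intro!: mult_right_mono power_mono)
      show "\<exists>k\<in>?S. \<delta>\<^sup>2 * (cmod (x k))\<^sup>2 < (l k)\<^sup>2 * (cmod (x k))\<^sup>2"
        using i d by (intro bexI[OF _ i(1)] mult_strict_right_mono power_strict_mono) auto
    qed
    then have "(\<delta> * norm ?v)\<^sup>2 < (norm (T ?v))\<^sup>2"
      unfolding nT power_mult_distrib norm_sum_orthonormal[OF onb_orthonormal[OF e] fin[OF d]] .
    then show "\<delta> * norm ?v < norm (T ?v)" by (rule power2_less_imp_less) simp
  qed
  have "real (k + 1) * singular_value k T \<le> K" for k
  proof (rule ccontr)
    assume "\<not> real (k + 1) * singular_value k T \<le> K"
    then have "K / real (k + 1) < singular_value k T" by (simp add: field_simps)
    moreover have "K \<ge> 0" using card[of 1] by (metis div_by_1 of_nat_0_le_iff order_trans zero_less_one)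
    ultimately obtain t where t: "K / real (k + 1) < t" "t < singular_value k T" using dense by blast
    then have t0: "t > 0" using \<open>K \<ge> 0\<close> by (smt (verit) divide_nonneg_nonneg of_nat_0_le_iff)
    have "real (k + 1) \<le> real (card {j. l j > t})" using sv(1)[OF t0, of k] t(2) by simp
    also have "\<dots> \<le> K / t" by (rule card[OF t0])
    finally show False using t(1) t0 by (simp add: field_simps)
  qed
  then show "T \<in> weak_L1" using T unfolding weak_L1_def by (auto intro!: bdd_aboveI[of _ K])
qed

end

section \<open>The ideal property\<close>

lemma gelfand_weak_add:
  assumes "gelfand_weak S K" "gelfand_weak T L"
  shows "gelfand_weak (\<lambda>x. S x + T x) (2 * K + 2 * L)"
  unfolding gelfand_weak_def
proof (intro conjI allI impI)
  show "(\<lambda>x. S x + T x) \<in> bounded_operators"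
    using assms by (intro bop_plus) (auto simp: gelfand_weak_def)
  fix \<delta> :: real assume "\<delta> > 0"
  then have d: "\<delta> / 2 > 0" by simp
  obtain C where C: "finite C" "real (card C) \<le> K / (\<delta>/2)"
    "\<And>x. \<forall>c\<in>C. cinner x c = 0 \<Longrightarrow> norm (S x) \<le> \<delta>/2 * norm x"
    using gelfand_weakD[OF assms(1) d] by blast
  obtain D where D: "finite D" "real (card D) \<le> L / (\<delta>/2)"
    "\<And>x. \<forall>c\<in>D. cinner x c = 0 \<Longrightarrow> norm (T x) \<le> \<delta>/2 * norm x"
    using gelfand_weakD[OF assms(2) d] by blast
  show "\<exists>C. finite C \<and> real (card C) \<le> (2 * K + 2 * L) / \<delta> \<and>
      (\<forall>x. (\<forall>c\<in>C. cinner x c = 0) \<longrightarrow> norm (S x + T x) \<le> \<delta> * norm x)"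
  proof (intro exI[of _ "C \<union> D"] conjI allI impI)
    have "real (card (C \<union> D)) \<le> real (card C) + real (card D)" using card_Un_le[of C D] by linarith
    also have "\<dots> \<le> (2 * K + 2 * L) / \<delta>" using C(2) D(2) by (simp add: add_divide_distrib mult.commute)
    finally show "real (card (C \<union> D)) \<le> (2 * K + 2 * L) / \<delta>" .
    fix x assume "\<forall>c\<in>C \<union> D. cinner x c = 0"
    then have "norm (S x) \<le> \<delta>/2 * norm x" "norm (T x) \<le> \<delta>/2 * norm x" using C(3) D(3) by auto
    then show "norm (S x + T x) \<le> \<delta> * norm x" using norm_triangle_ineq[of "S x" "T x"] by simp
  qed (use C D in auto)
qed

lemma gelfand_weak_left:
  assumes T: "gelfand_weak T K" and B: "B \<in> bounded_operators" and \<beta>: "\<beta> > 0" "\<And>x. norm (B x) \<le> \<beta> * norm x"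
  shows "gelfand_weak (\<lambda>x. B (T x)) (\<beta> * K)"
  unfolding gelfand_weak_def
proof (intro conjI allI impI)
  show "(\<lambda>x. B (T x)) \<in> bounded_operators"
    using T by (intro bop_comp[OF B]) (simp add: gelfand_weak_def)
  fix \<delta> :: real assume "\<delta> > 0"
  then have d: "\<delta> / \<beta> > 0" using \<beta> by simp
  obtain C where C: "finite C" "real (card C) \<le> K / (\<delta>/\<beta>)"
    "\<And>x. \<forall>c\<in>C. cinner x c = 0 \<Longrightarrow> norm (T x) \<le> \<delta>/\<beta> * norm x"
    using gelfand_weakD[OF T d] by blast
  show "\<exists>C. finite C \<and> real (card C) \<le> \<beta> * K / \<delta> \<and>
      (\<forall>x. (\<forall>c\<in>C. cinner x c = 0) \<longrightarrow> norm (B (T x)) \<le> \<delta> * norm x)"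
  proof (intro exI[of _ C] conjI allI impI)
    fix x assume "\<forall>c\<in>C. cinner x c = 0"
    then have "norm (B (T x)) \<le> \<beta> * (\<delta>/\<beta> * norm x)"
      using C(3)[of x] \<beta> by (meson less_imp_le mult_left_mono order_trans)
    then show "norm (B (T x)) \<le> \<delta> * norm x" using \<beta> by simp
  qed (use C in \<open>auto simp: mult.commute\<close>)
qed

context hilbert_basis
begin

text \<open>The test vectors of \<open>T\<close> are pulled back by the adjoint of \<open>B\<close>,
  which does not increase their number.\<close>

lemma gelfand_weak_right:
  fixes T B :: "'h \<Rightarrow> 'h"
  assumes T: "gelfand_weak T K" and B: "B \<in> bounded_operators" and \<beta>: "\<beta> > 0" "\<And>x. norm (B x) \<le> \<beta> * norm x"
  shows "gelfand_weak (\<lambda>x. T (B x)) (\<beta> * K)"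
  unfolding gelfand_weak_def
proof (intro conjI allI impI)
  show "(\<lambda>x. T (B x)) \<in> bounded_operators"
    using T by (intro bop_comp[OF _ B]) (simp add: gelfand_weak_def)
  fix \<delta> :: real assume "\<delta> > 0"
  then have d: "\<delta> / \<beta> > 0" using \<beta> by simp
  obtain C where C: "finite C" "real (card C) \<le> K / (\<delta>/\<beta>)"
    "\<And>x. \<forall>c\<in>C. cinner x c = 0 \<Longrightarrow> norm (T x) \<le> \<delta>/\<beta> * norm x"
    using gelfand_weakD[OF T d] by blast
  show "\<exists>C. finite C \<and> real (card C) \<le> \<beta> * K / \<delta> \<and>
      (\<forall>x. (\<forall>c\<in>C. cinner x c = 0) \<longrightarrow> norm (T (B x)) \<le> \<delta> * norm x)"
  proof (intro exI[of _ "cadjoint B ` C"] conjI allI impI)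
    have "real (card (cadjoint B ` C)) \<le> K / (\<delta>/\<beta>)"
      using card_image_le[OF C(1), of "cadjoint B"] C(2) by linarith
    then show "real (card (cadjoint B ` C)) \<le> \<beta> * K / \<delta>" by (simp add: mult.commute)
    fix x assume "\<forall>c\<in>cadjoint B ` C. cinner x c = 0"
    then have "\<forall>c\<in>C. cinner (B x) c = 0" by (simp add: cinner_adjoint[OF B])
    then have "norm (T (B x)) \<le> \<delta>/\<beta> * norm (B x)" by (rule C(3))
    also have "\<dots> \<le> \<delta>/\<beta> * (\<beta> * norm x)" using d \<beta>(2) by (intro mult_left_mono) auto
    finally show "norm (T (B x)) \<le> \<delta> * norm x" using \<beta> by simp
  qed (use C in auto)
qed

end

context separable_hilbert
begin

lemma weak_L1_add: "(S :: 'h \<Rightarrow> 'h) \<in> weak_L1 \<Longrightarrow> T \<in> weak_L1 \<Longrightarrow> (\<lambda>x. S x + T x) \<in> weak_L1"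
  unfolding weak_L1_iff_gelfand using gelfand_weak_add by blast

lemma weak_L1_left:
  assumes "(T :: 'h \<Rightarrow> 'h) \<in> weak_L1" "B \<in> bounded_operators"
  shows "(\<lambda>x. B (T x)) \<in> weak_L1"
proof -
  obtain K where K: "K > 0" "\<And>x. norm (B x) \<le> K * norm x" using bop_bound[OF assms(2)] by blast
  show ?thesis using assms gelfand_weak_left[OF _ assms(2) K] unfolding weak_L1_iff_gelfand by blast
qed

lemma weak_L1_right:
  assumes "(T :: 'h \<Rightarrow> 'h) \<in> weak_L1" "B \<in> bounded_operators"
  shows "(\<lambda>x. T (B x)) \<in> weak_L1"
proof -
  obtain K where K: "K > 0" "\<And>x. norm (B x) \<le> K * norm x" using bop_bound[OF assms(2)] by blast
  show ?thesis using assms gelfand_weak_right[OF _ assms(2) K] unfolding weak_L1_iff_gelfand by blast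
qed

lemma weak_L1_scale: "(T :: 'h \<Rightarrow> 'h) \<in> weak_L1 \<Longrightarrow> (\<lambda>x. c *\<^sub>C T x) \<in> weak_L1"
  by (rule weak_L1_left[OF _ bop_scale[OF bop_id]])

end

section \<open>The symmetric functional on sequences induced by a trace\<close>

section \<open>Weak summable sequences\<close>

text \<open>Stated through the distribution function, so that reorderings visibly preserve it.
  Finiteness is demanded separately because \<open>card\<close> of an infinite set is 0.\<close>

definition weak_l1 :: "(nat \<Rightarrow> complex) \<Rightarrow> bool" where
  "weak_l1 y \<longleftrightarrow> (\<exists>K. \<forall>\<delta>>0. finite {k. \<delta> < cmod (y k)} \<and> real (card {k. \<delta> < cmod (y k)}) \<le> K / \<delta>)"

lemma weak_l1_bounded:
  assumes "weak_l1 y" obtains K where "\<And>k. cmod (y k) \<le> K"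
proof -
  obtain K where K: "\<And>\<delta>. \<delta> > 0 \<Longrightarrow> finite {k. \<delta> < cmod (y k)} \<and> real (card {k. \<delta> < cmod (y k)}) \<le> K / \<delta>"
    using assms unfolding weak_l1_def by blast
  have K0: "K \<ge> 0" using K[of 1] by simp
  then have "real (card {k. K + 1 < cmod (y k)}) \<le> K / (K + 1)" using K[of "K + 1"] by simp
  also have "\<dots> < 1" using K0 by simp
  finally have "{k. K + 1 < cmod (y k)} = {}" using K[of "K + 1"] K0 by simp
  then have "cmod (y k) \<le> K + 1" for k using not_less by blast
  then show ?thesis using that by blast
qed

lemma weak_l1_dominated:
  assumes "weak_l1 y" "c > 0" "\<And>k. cmod (z k) \<le> c * cmod (y k)"
  shows "weak_l1 z"
proof -
  obtain K where K: "\<And>\<delta>. \<delta> > 0 \<Longrightarrow> finite {k. \<delta> < cmod (y k)} \<and> real (card {k. \<delta> < cmod (y k)}) \<le> K / \<delta>"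
    using assms unfolding weak_l1_def by blast
  have "finite {k. \<delta> < cmod (z k)} \<and> real (card {k. \<delta> < cmod (z k)}) \<le> (c * K) / \<delta>" if d: "\<delta> > 0" for \<delta>
  proof -
    have sub: "{k. \<delta> < cmod (z k)} \<subseteq> {k. \<delta>/c < cmod (y k)}"
      using assms(2,3) by (auto simp: field_simps intro: less_le_trans)
    have "\<delta>/c > 0" using d assms(2) by simp
    from K[OF this] sub show ?thesis
      using card_mono[OF _ sub] by (auto intro: finite_subset simp: mult.commute)
  qed
  then show ?thesis unfolding weak_l1_def by blast
qed

lemma weak_l1_scale: "weak_l1 y \<Longrightarrow> weak_l1 (\<lambda>k. c * y k)"
  by (erule weak_l1_dominated[of _ "cmod c + 1"]) (auto simp: norm_mult intro!: mult_right_mono add_nonneg_pos)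

lemma weak_l1_reindex:
  assumes "weak_l1 y" "inj \<sigma>"
  shows "weak_l1 (\<lambda>k. y (\<sigma> k))"
proof -
  obtain K where K: "\<And>\<delta>. \<delta> > 0 \<Longrightarrow> finite {k. \<delta> < cmod (y k)} \<and> real (card {k. \<delta> < cmod (y k)}) \<le> K / \<delta>"
    using assms(1) unfolding weak_l1_def by blast
  have "finite {k. \<delta> < cmod (y (\<sigma> k))} \<and> real (card {k. \<delta> < cmod (y (\<sigma> k))}) \<le> K / \<delta>" if d: "\<delta> > 0" for \<delta>
  proof -
    have sub: "\<sigma> ` {k. \<delta> < cmod (y (\<sigma> k))} \<subseteq> {k. \<delta> < cmod (y k)}" by auto
    have inj: "inj_on \<sigma> {k. \<delta> < cmod (y (\<sigma> k))}" using assms(2) by (rule inj_on_subset) simp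
    have "finite {k. \<delta> < cmod (y (\<sigma> k))}"
      using finite_imageD[OF finite_subset[OF sub] inj] K[OF d] by blast
    moreover have "card {k. \<delta> < cmod (y (\<sigma> k))} \<le> card {k. \<delta> < cmod (y k)}"
      using card_inj_on_le[OF inj sub] K[OF d] by blast
    ultimately show ?thesis using K[OF d] by (meson of_nat_le_iff order_trans)
  qed
  then show ?thesis unfolding weak_l1_def by blast
qed

lemma diag_operator_add:
  fixes u :: "nat \<Rightarrow> 'h::complex_hilbert"
  assumes u: "orthonormal_on I u" and y: "\<And>i. i \<notin> I \<Longrightarrow> y i = 0" "\<And>i. i \<notin> I \<Longrightarrow> z i = 0"
    and w: "weak_l1 y" "weak_l1 z"
  shows "diag_operator u (\<lambda>k. y k + z k) = (\<lambda>x. diag_operator u y x + diag_operator u z x)"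
proof
  fix x
  obtain K where K: "\<And>k. cmod (y k) \<le> K" using weak_l1_bounded[OF w(1)] by blast
  obtain L where L: "\<And>k. cmod (z k) \<le> L" using weak_l1_bounded[OF w(2)] by blast
  have KL: "cmod (y k + z k) \<le> K + L" for k
    using norm_triangle_ineq[of "y k" "z k"] K[of k] L[of k] by linarith
  have "(\<lambda>k. (y k * cinner x (u k)) *\<^sub>C u k + (z k * cinner x (u k)) *\<^sub>C u k) sums
      (diag_operator u y x + diag_operator u z x)"
    by (rule sums_add[OF diag_operator_sums[OF u y(1) K] diag_operator_sums[OF u y(2) L]])
  moreover have "(\<lambda>k. ((y k + z k) * cinner x (u k)) *\<^sub>C u k) sums diag_operator u (\<lambda>k. y k + z k) x"
    by (rule diag_operator_sums[OF u _ KL]) (simp add: y)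
  moreover have "(\<lambda>k. (y k * cinner x (u k)) *\<^sub>C u k + (z k * cinner x (u k)) *\<^sub>C u k)
    = (\<lambda>k. ((y k + z k) * cinner x (u k)) *\<^sub>C u k)"
    by (simp add: distrib_right scaleC_add_left)
  ultimately show "diag_operator u (\<lambda>k. y k + z k) x = diag_operator u y x + diag_operator u z x"
    using sums_unique2 by simp
qed

lemma diag_operator_scale:
  fixes u :: "nat \<Rightarrow> 'h::complex_hilbert"
  assumes u: "orthonormal_on I u" and y: "\<And>i. i \<notin> I \<Longrightarrow> y i = 0" and w: "weak_l1 y"
  shows "diag_operator u (\<lambda>k. c * y k) = (\<lambda>x. c *\<^sub>C diag_operator u y x)"
proof
  fix x
  obtain K where K: "\<And>k. cmod (y k) \<le> K" using weak_l1_bounded[OF w] by blast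
  obtain L where L: "\<And>k. cmod (c * y k) \<le> L" using weak_l1_bounded[OF weak_l1_scale[OF w]] by blast
  have "(\<lambda>k. c *\<^sub>C (y k * cinner x (u k)) *\<^sub>C u k) sums (c *\<^sub>C diag_operator u y x)"
    by (rule bounded_linear.sums[OF bounded_linear_scaleC diag_operator_sums[OF u y K]])
  moreover have "(\<lambda>k. (c * y k * cinner x (u k)) *\<^sub>C u k) sums diag_operator u (\<lambda>k. c * y k) x"
    by (rule diag_operator_sums[OF u _ L]) (simp add: y)
  moreover have "(\<lambda>k. c *\<^sub>C (y k * cinner x (u k)) *\<^sub>C u k) = (\<lambda>k. (c * y k * cinner x (u k)) *\<^sub>C u k)"
    by (simp add: scaleC_scaleC mult_ac)
  ultimately show "diag_operator u (\<lambda>k. c * y k) x = c *\<^sub>C diag_operator u y x"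
    using sums_unique2 by simp
qed

context separable_hilbert
begin

lemma diag_weak_L1:
  fixes u :: "nat \<Rightarrow> 'h"
  assumes u: "orthonormal_on I u" and y: "\<And>i. i \<notin> I \<Longrightarrow> y i = 0" and w: "weak_l1 y"
  shows "diag_operator u y \<in> weak_L1"
proof -
  obtain K where K: "\<And>k. cmod (y k) \<le> K" using weak_l1_bounded[OF w] by blast
  obtain L where L: "\<And>\<delta>. \<delta> > 0 \<Longrightarrow> finite {k. \<delta> < cmod (y k)} \<and> real (card {k. \<delta> < cmod (y k)}) \<le> L / \<delta>"
    using w unfolding weak_l1_def by blast
  have "gelfand_weak (diag_operator u y) L"
    unfolding gelfand_weak_def
  proof (intro conjI allI impI)
    show "diag_operator u y \<in> bounded_operators" by (rule bop_diag_operator[OF u y K])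
    fix \<delta> :: real assume d: "\<delta> > 0"
    let ?S = "{k. \<delta> < cmod (y k)}"
    show "\<exists>C. finite C \<and> real (card C) \<le> L / \<delta> \<and>
        (\<forall>x. (\<forall>c\<in>C. cinner x c = 0) \<longrightarrow> norm (diag_operator u y x) \<le> \<delta> * norm x)"
    proof (intro exI[of _ "u ` ?S"] conjI allI impI)
      show "finite (u ` ?S)" using L[OF d] by blast
      show "real (card (u ` ?S)) \<le> L / \<delta>"
        using L[OF d] card_image_le[of ?S u] by (meson of_nat_le_iff order_trans)
      fix x assume x: "\<forall>c\<in>u ` ?S. cinner x c = 0"
      define z where "z k = (if k \<in> ?S then 0 else y k)" for k
      have zd: "cmod (z k) \<le> \<delta>" for k using d by (auto simp: z_def not_less)
      have "diag_operator u y x = diag_operator u z x"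
        unfolding diag_operator_def z_def using x by (intro suminf_cong) auto
      also have "norm \<dots> \<le> \<delta> * norm x"
        by (rule diag_operator_norm[OF u _ zd]) (simp add: z_def y)
      finally show "norm (diag_operator u y x) \<le> \<delta> * norm x" .
    qed
  qed
  then show ?thesis unfolding weak_L1_iff_gelfand by blast
qed

lemma weak_L1_diag_imp_weak_l1:
  fixes e :: "nat \<Rightarrow> 'h"
  assumes e: "onb e" and K: "\<And>k. cmod (y k) \<le> K" and w: "diag_operator e y \<in> weak_L1"
  shows "weak_l1 y"
proof -
  obtain L where G: "gelfand_weak (diag_operator e y) L" using w unfolding weak_L1_iff_gelfand by blast
  note bop = onb_bop_diag[where y = y, OF e K]
  have "finite {k. \<delta> < cmod (y k)} \<and> real (card {k. \<delta> < cmod (y k)}) \<le> L / \<delta>" if d: "\<delta> > 0" for \<delta>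
  proof -
    have sub: "real (card S) \<le> L / \<delta>" if S: "finite S" "S \<subseteq> {k. \<delta> < cmod (y k)}" for S
    proof (rule gelfand_weak_card[OF G d S(1) onb_orthonormal[OF e]])
      fix x :: "nat \<Rightarrow> complex" assume "\<exists>i\<in>S. x i \<noteq> 0"
      then obtain i where i: "i \<in> S" "x i \<noteq> 0" by blast
      let ?v = "\<Sum>i\<in>S. x i *\<^sub>C e i"
      have v: "diag_operator e y ?v = (\<Sum>i\<in>S. (x i * y i) *\<^sub>C e i)"
        by (simp add: bop_sum[OF bop] bop_scaleC[OF bop] onb_diag_basis[where y = y, OF e K] scaleC_scaleC)
      have "\<delta>\<^sup>2 * (\<Sum>k\<in>S. (cmod (x k))\<^sup>2) < (\<Sum>k\<in>S. (cmod (x k * y k))\<^sup>2)"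
        unfolding sum_distrib_left norm_mult power_mult_distrib mult.commute[of "(cmod (x _))\<^sup>2"]
      proof (rule sum_strict_mono_ex1[OF S(1)])
        show "\<forall>k\<in>S. \<delta>\<^sup>2 * (cmod (x k))\<^sup>2 \<le> (cmod (y k))\<^sup>2 * (cmod (x k))\<^sup>2"
          using d S by (auto intro!: mult_right_mono power_mono)
        show "\<exists>k\<in>S. \<delta>\<^sup>2 * (cmod (x k))\<^sup>2 < (cmod (y k))\<^sup>2 * (cmod (x k))\<^sup>2"
          using i d S by (intro bexI[OF _ i(1)] mult_strict_right_mono power_strict_mono) auto
      qed
      then have "(\<delta> * norm ?v)\<^sup>2 < (norm (diag_operator e y ?v))\<^sup>2"
        unfolding v power_mult_distrib norm_sum_orthonormal[OF onb_orthonormal[OF e] S(1)] .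
      then show "\<delta> * norm ?v < norm (diag_operator e y ?v)" by (rule power2_less_imp_less) simp
    qed
    \<comment> \<open>A uniform bound on the size of all finite subsets forces the set itself to be
      finite.\<close>
    have "finite {k. \<delta> < cmod (y k)} \<and> card {k. \<delta> < cmod (y k)} \<le> nat \<lfloor>L / \<delta>\<rfloor>"
    proof (rule finite_if_finite_subsets_card_bdd)
      fix G assume "G \<subseteq> {k. \<delta> < cmod (y k)}" "finite G"
      then show "card G \<le> nat \<lfloor>L / \<delta>\<rfloor>" using sub[of G] by (simp add: le_nat_floor)
    qed
    then show ?thesis using sub by blast
  qed
  then show ?thesis unfolding weak_l1_def by blast
qed

section \<open>Unitaries between orthonormal families\<close>

lemma onb_change_operator:
  fixes e f :: "nat \<Rightarrow> 'h"
  assumes e: "onb e" and f: "onb f"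
  obtains U where "U \<in> bounded_operators" "\<And>x n. cinner (U x) (e n) = cinner x (f n)"
proof -
  define U where "U x = (\<Sum>n. cinner x (f n) *\<^sub>C e n)" for x
  have s: "summable (\<lambda>n. (cmod (cinner x (f n)))\<^sup>2)" for x using onb_Parseval[OF f] sums_summable by blast
  have co: "cinner (U x) (e n) = cinner x (f n)" for x n
    unfolding U_def by (rule orthonormal_series(2)[OF onb_orthonormal[OF e, of UNIV] _ s]) auto
  have "U \<in> bounded_operators"
  proof (rule bounded_operatorsI[of _ 1])
    show "U (x + y) = U x + U y" for x y by (rule onb_eqI[OF e]) (simp add: co cinner_add_left)
    show "U (c *\<^sub>C x) = c *\<^sub>C U x" for c x by (rule onb_eqI[OF e]) (simp add: co cinner_scaleC_left)
    show "norm (U x) \<le> 1 * norm x" for x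
    proof -
      have "(norm (U x))\<^sup>2 = (norm x)\<^sup>2"
        using onb_Parseval[OF e, of "U x"] onb_Parseval[OF f, of x] unfolding co by (rule sums_unique2)
      then show ?thesis by (simp add: power2_eq_iff_nonneg)
    qed
  qed
  then show ?thesis using that co by blast
qed

lemma onb_change_unitary:
  fixes e f :: "nat \<Rightarrow> 'h"
  assumes e: "onb e" and f: "onb f"
  obtains U where "unitary U" "\<And>x n. cinner (U x) (e n) = cinner x (f n)" "\<And>n. cadjoint U (e n) = f n"
proof -
  obtain U where U: "U \<in> bounded_operators" "\<And>x n. cinner (U x) (e n) = cinner x (f n)"
    using onb_change_operator[OF e f] by blast
  obtain W where W: "W \<in> bounded_operators" "\<And>x n. cinner (W x) (f n) = cinner x (e n)"
    using onb_change_operator[OF f e] by blast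
  have adj: "cadjoint U = W"
  proof (rule adjoint_unique)
    fix x y
    have "(\<lambda>n. cinner (U x) (e n) * cinner (e n) y) sums cinner (U x) y" by (rule onb_cinner_sums[OF e])
    moreover have "(\<lambda>n. cinner x (f n) * cinner (f n) (W y)) sums cinner x (W y)" by (rule onb_cinner_sums[OF f])
    moreover have "cinner (f n) (W y) = cinner (e n) y" for n using W(2) by (metis cinner_commute)
    ultimately show "cinner (U x) y = cinner x (W y)" by (simp add: U(2) sums_unique2)
  qed
  have "W (U x) = x" for x by (rule onb_eqI[OF f]) (simp add: U W)
  moreover have "U (W x) = x" for x by (rule onb_eqI[OF e]) (simp add: U W)
  ultimately have "unitary U" unfolding unitary_def adj using U(1) by (auto simp: fun_eq_iff)
  moreover have "W (e n) = f n" for n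
    by (rule onb_eqI[OF f]) (simp add: W onb_cinner[OF e] onb_cinner[OF f])
  ultimately show ?thesis using that[of U] U(2) adj by simp
qed

lemma orthonormal_extend:
  fixes u :: "nat \<Rightarrow> 'h"
  assumes u: "orthonormal_on J u"
  obtains E where "u ` J \<subseteq> E" "orthonormal_on E (\<lambda>x. x)" "\<And>x. (\<And>e. e \<in> E \<Longrightarrow> cinner x e = 0) \<Longrightarrow> x = 0"
proof -
  have "orthonormal_on (u ` J) (\<lambda>x. x)"
    unfolding orthonormal_on_def
  proof (intro ballI)
    fix x y assume "x \<in> u ` J" "y \<in> u ` J"
    then obtain i j where ij: "i \<in> J" "x = u i" "j \<in> J" "y = u j" by blast
    show "cinner x y = (if x = y then 1 else 0)"
      using orthonormal_onD[OF u ij(1,1)] orthonormal_onD[OF u ij(1,3)] ij(2,4) by (cases "i = j") auto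
  qed
  then obtain E where E: "u ` J \<subseteq> E" "orthonormal_on E (\<lambda>x. x)"
    "\<And>x. norm x = 1 \<Longrightarrow> (\<And>e. e \<in> E \<Longrightarrow> cinner x e = 0) \<Longrightarrow> False"
    using maximal_orthonormal[of "u ` J" "\<lambda>_. True"] by auto
  have "x = 0" if "\<And>e. e \<in> E \<Longrightarrow> cinner x e = 0" for x
  proof (rule ccontr)
    assume "x \<noteq> 0"
    then show False
      using that by (intro E(3)[of "complex_of_real (1 / norm x) *\<^sub>C x"])
        (auto simp: norm_scaleC norm_divide cinner_scaleC_left)
  qed
  then show ?thesis using that E by blast
qed

lemma orthonormal_inj_on: "orthonormal_on I u \<Longrightarrow> inj_on u I"
  by (intro inj_onI) (metis orthonormal_onD zero_neq_one)

text \<open>The hypothesis on \<open>I\<close> makes both partial families leave a countably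
  infinite remainder in a basis. The remainders can be matched arbitrarily, and the partial map
  extends to a unitary.\<close>

lemma unitary_transport:
  fixes u v :: "nat \<Rightarrow> 'h"
  assumes u: "orthonormal_on J u" and v: "orthonormal_on J v" and I: "I \<subseteq> J" "finite I \<or> infinite (J - I)"
  obtains U where "unitary U" "\<And>i. i \<in> I \<Longrightarrow> cadjoint U (u i) = v i"
proof -
  have ext: "\<exists>E. w ` I \<subseteq> E \<and> orthonormal_on E (\<lambda>x. x) \<and> (\<forall>x. (\<forall>e\<in>E. cinner x e = 0) \<longrightarrow> x = 0) \<and>
      infinite (E - w ` I) \<and> countable E" if w: "orthonormal_on J w" for w :: "nat \<Rightarrow> 'h"
  proof -
    obtain E where E: "w ` J \<subseteq> E" "orthonormal_on E (\<lambda>x. x)" "\<And>x. (\<And>e. e \<in> E \<Longrightarrow> cinner x e = 0) \<Longrightarrow> x = 0"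
      using orthonormal_extend[OF w] by blast
    have "infinite (E - w ` I)" using I(2)
    proof
      assume "finite I"
      then show ?thesis using total_orthonormal_infinite[OF E(2,3)] by (simp add: Diff_infinite_finite)
    next
      assume inf: "infinite (J - I)"
      have inj: "inj_on w J" by (rule orthonormal_inj_on[OF w])
      then have "w ` (J - I) \<subseteq> E - w ` I" using E(1) I(1) by (auto simp: inj_on_def)
      moreover have "infinite (w ` (J - I))" using inf inj by (metis Diff_subset finite_imageD inj_on_subset)
      ultimately show ?thesis using finite_subset by blast
    qed
    moreover have "w ` I \<subseteq> E" using E(1) I(1) by (meson image_mono order_trans)
    ultimately show ?thesis using E(2,3) orthonormal_countable[OF E(2)] by (intro exI[of _ E]) simp
  qed
  from ext[OF u] obtain E where E': "u ` I \<subseteq> E" "orthonormal_on E (\<lambda>x. x)"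
    "\<forall>x. (\<forall>e\<in>E. cinner x e = 0) \<longrightarrow> x = 0" "infinite (E - u ` I)" "countable E"
    by (elim exE conjE)
  note E = E'(1,2) E'(3)[rule_format] E'(4,5)
  from ext[OF v] obtain F where F': "v ` I \<subseteq> F" "orthonormal_on F (\<lambda>x. x)"
    "\<forall>x. (\<forall>e\<in>F. cinner x e = 0) \<longrightarrow> x = 0" "infinite (F - v ` I)" "countable F"
    by (elim exE conjE)
  note F = F'(1,2) F'(3)[rule_format] F'(4,5)
  have iu: "inj_on u I" and iv: "inj_on v I"
    using orthonormal_inj_on[OF u] orthonormal_inj_on[OF v] I(1) inj_on_subset by blast+
  obtain g where g: "bij_betw g (F - v ` I) (E - u ` I)"
  proof -
    have "bij_betw (from_nat_into (E - u ` I)) UNIV (E - u ` I)" "bij_betw (from_nat_into (F - v ` I)) UNIV (F - v ` I)"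
      using E(4,5) F(4,5) by (intro bij_betw_from_nat_into; simp)+
    then show ?thesis using that bij_betw_trans[OF bij_betw_inv_into] by blast
  qed
  have "bij_betw (u \<circ> the_inv_into I v) (v ` I) (u ` I)"
    by (rule bij_betw_trans[OF bij_betw_the_inv_into[OF inj_on_imp_bij_betw[OF iv]] inj_on_imp_bij_betw[OF iu]])
  from bij_betw_disjoint_Un[OF this g]
  have H: "bij_betw (\<lambda>x. if x \<in> v ` I then (u \<circ> the_inv_into I v) x else g x) F E" (is "bij_betw ?H F E")
    using E(1) F(1) by (simp add: Un_absorb1)
  have Hv: "?H (v i) = u i" if "i \<in> I" for i using that iv by (simp add: the_inv_into_f_f)
  obtain f where f: "onb f" "bij_betw f (UNIV :: nat set) F" using onb_enumerate[OF F(2,3)] by blast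
  have Hf: "bij_betw (?H \<circ> f) UNIV E" by (rule bij_betw_trans[OF f(2) H])
  have e: "onb (?H \<circ> f)" by (rule onb_of_bij[OF E(2,3) Hf])
  obtain U where "unitary U" "\<And>x n. cinner (U x) ((?H \<circ> f) n) = cinner x (f n)" "\<And>n. cadjoint U ((?H \<circ> f) n) = f n"
    by (rule onb_change_unitary[OF e f(1)], rule that)
  note U = this(1,3)
  have "cadjoint U (u i) = v i" if i: "i \<in> I" for i
  proof -
    have "v i \<in> F" using F(1) i by (rule subsetD[OF _ imageI])
    then have "v i \<in> range f" by (simp only: bij_betw_imp_surj_on[OF f(2)])
    then obtain n where n: "f n = v i" by (elim rangeE) simp
    have "(?H \<circ> f) n = u i" using Hv[OF i] by (simp only: o_apply n)
    then show ?thesis using U(2)[of n] by (simp only: n)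
  qed
  then show ?thesis by (rule that[OF U(1)])
qed

end

section \<open>Traces\<close>

locale weak_trace = separable_hilbert b for b :: "nat \<Rightarrow> 'h::complex_hilbert" +
  fixes \<phi> :: "('h \<Rightarrow> 'h) \<Rightarrow> complex"
  assumes trace: "trace_on_weak_L1 \<phi>"
begin

lemma phi_add: "S \<in> weak_L1 \<Longrightarrow> T \<in> weak_L1 \<Longrightarrow> \<phi> (\<lambda>x. S x + T x) = \<phi> S + \<phi> T"
  using trace by (simp add: trace_on_weak_L1_def)

lemma phi_scale: "T \<in> weak_L1 \<Longrightarrow> \<phi> (\<lambda>x. c *\<^sub>C T x) = c * \<phi> T"
  using trace by (simp add: trace_on_weak_L1_def)

lemma phi_unitary: "T \<in> weak_L1 \<Longrightarrow> unitary U \<Longrightarrow> \<phi> (cadjoint U \<circ> T \<circ> U) = \<phi> T"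
  using trace by (simp add: trace_on_weak_L1_def)

lemma phi_diag_transport_aux:
  fixes u v :: "nat \<Rightarrow> 'h"
  assumes u: "orthonormal_on J u" and v: "orthonormal_on J v" and I: "I \<subseteq> J" "finite I \<or> infinite (J - I)"
    and y: "\<And>i. i \<notin> I \<Longrightarrow> y i = 0" and w: "weak_l1 y"
  shows "\<phi> (diag_operator u y) = \<phi> (diag_operator v y)"
proof -
  obtain U where U: "unitary U" "\<And>i. i \<in> I \<Longrightarrow> cadjoint U (u i) = v i"
    using unitary_transport[OF u v I] by blast
  obtain K where K: "\<And>k. cmod (y k) \<le> K" using weak_l1_bounded[OF w] by blast
  have uI: "orthonormal_on I u" and vI: "orthonormal_on I v"
    using u v I(1) orthonormal_on_subset by blast+
  have b: "U \<in> bounded_operators" using U(1) by (simp add: unitary_def)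
  have "cadjoint U \<circ> diag_operator u y \<circ> U = diag_operator v y"
  proof
    fix x
    have "(\<lambda>k. cadjoint U ((y k * cinner (U x) (u k)) *\<^sub>C u k)) sums cadjoint U (diag_operator u y (U x))"
      by (rule bounded_linear.sums[OF bop_linear[OF bop_adjoint[OF b]] diag_operator_sums[OF uI y K]])
    moreover have "cadjoint U ((y k * cinner (U x) (u k)) *\<^sub>C u k) = (y k * cinner x (v k)) *\<^sub>C v k" for k
    proof (cases "k \<in> I")
      case True
      then show ?thesis by (simp add: bop_scaleC[OF bop_adjoint[OF b]] cinner_adjoint[OF b] U(2))
    qed (simp add: y bop_scaleC[OF bop_adjoint[OF b]] bop_0[OF bop_adjoint[OF b]])
    ultimately have 1: "(\<lambda>k. (y k * cinner x (v k)) *\<^sub>C v k) sums cadjoint U (diag_operator u y (U x))" by simp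
    have 2: "(\<lambda>k. (y k * cinner x (v k)) *\<^sub>C v k) sums diag_operator v y x"
      by (rule diag_operator_sums[OF vI y K])
    from sums_unique2[OF 1 2] show "(cadjoint U \<circ> diag_operator u y \<circ> U) x = diag_operator v y x" by simp
  qed
  then show ?thesis using phi_unitary[OF diag_weak_L1[OF uI y w] U(1)] by simp
qed

lemma phi_diag_transport:
  fixes u v :: "nat \<Rightarrow> 'h"
  assumes u: "orthonormal_on I u" and v: "orthonormal_on I v"
    and y: "\<And>i. i \<notin> I \<Longrightarrow> y i = 0" and w: "weak_l1 y"
  shows "\<phi> (diag_operator u y) = \<phi> (diag_operator v y)"
proof (cases "finite I")
  case True
  then show ?thesis using phi_diag_transport_aux[OF u v order_refl _ y w] by blast
next
  case False
  \<comment> \<open>Halving the index set leaves each half with an infinite-dimensional complement, so that the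
    partial isometry between the two families extends to a unitary.\<close>
  define I1 where "I1 = enumerate I ` {n. even n}"
  define I2 where "I2 = enumerate I ` {n. odd n}"
  have en: "bij_betw (enumerate I) UNIV I" by (rule bij_enumerate[OF False])
  have inj: "inj_on (enumerate I) A" for A using en by (auto simp: bij_betw_def intro: inj_on_subset)
  have un: "I1 \<union> I2 = I" using en unfolding I1_def I2_def bij_betw_def by (auto simp: image_iff)
  have disj: "I1 \<inter> I2 = {}" using inj[of UNIV] unfolding I1_def I2_def by (auto simp: inj_eq)
  have "infinite {n::nat. even n}" "infinite {n::nat. odd n}"
    by (metis (mono_tags) infinite_nat_iff_unbounded_le mem_Collect_eq dvd_triv_left le_add1 mult_2)
      (metis (mono_tags) infinite_nat_iff_unbounded mem_Collect_eq even_Suc_div_two even_Suc lessI less_SucI)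
  then have inf: "infinite I1" "infinite I2" unfolding I1_def I2_def using finite_imageD[OF _ inj] by blast+
  define y1 where "y1 k = (if k \<in> I1 then y k else 0)" for k
  define y2 where "y2 k = (if k \<in> I2 then y k else 0)" for k
  have w12: "weak_l1 y1" "weak_l1 y2"
    by (rule weak_l1_dominated[OF w, of 1]; simp add: y1_def y2_def)+
  have yy: "y = (\<lambda>k. y1 k + y2 k)"
    unfolding y1_def y2_def using un disj y by (auto simp: fun_eq_iff)
  have z: "y1 k = 0" "y2 k = 0" if "k \<notin> I" for k using that un by (auto simp: y1_def y2_def)
  have split: "\<phi> (diag_operator t y) = \<phi> (diag_operator t y1) + \<phi> (diag_operator t y2)"
    if t: "orthonormal_on I t" for t :: "nat \<Rightarrow> 'h"
  proof -
    have "diag_operator t y = (\<lambda>x. diag_operator t y1 x + diag_operator t y2 x)"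
      unfolding yy by (rule diag_operator_add[OF t z w12])
    then show ?thesis by (simp only:) (rule phi_add[OF diag_weak_L1[where y = y1, OF t z(1) w12(1)] diag_weak_L1[where y = y2, OF t z(2) w12(2)]])
  qed
  have "I - I1 = I2" "I - I2 = I1" using un disj by auto
  then have "\<phi> (diag_operator u y1) = \<phi> (diag_operator v y1)" "\<phi> (diag_operator u y2) = \<phi> (diag_operator v y2)"
    using inf un by (intro phi_diag_transport_aux[OF u v, of I1] phi_diag_transport_aux[OF u v, of I2] w12;
        auto simp: y1_def y2_def)+
  then show ?thesis unfolding split[OF u] split[OF v] by simp
qed

text \<open>By \<open>phi_diag\<close> every orthonormal family gives the same value, so this is the
  symmetric functional on sequences attached to \<open>\<phi>\<close>.\<close>

definition tau :: "(nat \<Rightarrow> complex) \<Rightarrow> complex" where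
  "tau y = \<phi> (diag_operator b y)"

lemma phi_diag:
  fixes u :: "nat \<Rightarrow> 'h"
  assumes "orthonormal_on I u" "\<And>i. i \<notin> I \<Longrightarrow> y i = 0" "weak_l1 y"
  shows "\<phi> (diag_operator u y) = tau y"
  unfolding tau_def by (rule phi_diag_transport[OF assms(1) onb_orthonormal[OF onb_b] assms(2,3)])

lemma tau_add: "weak_l1 y \<Longrightarrow> weak_l1 z \<Longrightarrow> tau (\<lambda>k. y k + z k) = tau y + tau z"
  unfolding tau_def
  by (subst diag_operator_add[OF onb_orthonormal[OF onb_b, of UNIV]])
    (auto intro!: phi_add diag_weak_L1[OF onb_orthonormal[OF onb_b, of UNIV]])

lemma tau_scale: "weak_l1 y \<Longrightarrow> tau (\<lambda>k. c * y k) = c * tau y"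
  unfolding tau_def
  by (subst diag_operator_scale[OF onb_orthonormal[OF onb_b, of UNIV]])
    (auto intro!: phi_scale diag_weak_L1[OF onb_orthonormal[OF onb_b, of UNIV]])

text \<open>Both sequences describe the same operator, once along \<open>b\<close> and once along
  \<open>b \<circ> \<sigma>\<close>. As \<open>\<sigma>\<close> is only injective, this also covers
  the insertion and deletion of zeros.\<close>

lemma tau_reindex:
  assumes s: "inj \<sigma>" and p: "\<And>j. j \<notin> range \<sigma> \<Longrightarrow> p j = 0" and w: "weak_l1 p"
  shows "tau (\<lambda>k. p (\<sigma> k)) = tau p"
proof -
  have o: "orthonormal_on UNIV (b \<circ> \<sigma>)"
    unfolding orthonormal_on_def using onb_cinner[OF onb_b] s by (auto simp: inj_eq)
  have w': "weak_l1 (\<lambda>k. p (\<sigma> k))" by (rule weak_l1_reindex[OF w s])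
  obtain K where K: "\<And>k. cmod (p k) \<le> K" using weak_l1_bounded[OF w] by blast
  have "diag_operator (b \<circ> \<sigma>) (\<lambda>k. p (\<sigma> k)) = diag_operator b p"
  proof (intro ext onb_eqI[OF onb_b])
    fix x j
    have R: "cinner (diag_operator b p x) (b j) = p j * cinner x (b j)"
      by (rule onb_diag_coeff[where y = p, OF onb_b K])
    show "cinner (diag_operator (b \<circ> \<sigma>) (\<lambda>k. p (\<sigma> k)) x) (b j) = cinner (diag_operator b p x) (b j)"
    proof (cases "j \<in> range \<sigma>")
      case True
      then obtain k where k: "j = \<sigma> k" by blast
      have "cinner (diag_operator (b \<circ> \<sigma>) (\<lambda>k. p (\<sigma> k)) x) ((b \<circ> \<sigma>) k) = p (\<sigma> k) * cinner x ((b \<circ> \<sigma>) k)"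
        by (rule diag_operator_coeff[where y = "\<lambda>k. p (\<sigma> k)", OF o _ K]) auto
      then show ?thesis unfolding R by (simp add: k)
    next
      case False
      have "(\<lambda>k. p (\<sigma> k) * cinner x ((b \<circ> \<sigma>) k) * cinner ((b \<circ> \<sigma>) k) (b j)) sums
          cinner (diag_operator (b \<circ> \<sigma>) (\<lambda>k. p (\<sigma> k)) x) (b j)"
        by (rule diag_operator_adjoint_aux[where y = "\<lambda>k. p (\<sigma> k)", OF o _ K]) auto
      moreover have "cinner ((b \<circ> \<sigma>) k) (b j) = 0" for k using onb_cinner[OF onb_b] False by auto
      ultimately have "(\<lambda>k. 0) sums cinner (diag_operator (b \<circ> \<sigma>) (\<lambda>k. p (\<sigma> k)) x) (b j)" by simp
      then have "cinner (diag_operator (b \<circ> \<sigma>) (\<lambda>k. p (\<sigma> k)) x) (b j) = 0"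
        using sums_unique2 sums_zero by blast
      then show ?thesis unfolding R using p[OF False] by simp
    qed
  qed
  then show ?thesis using phi_diag[OF o _ w'] by (simp add: tau_def)
qed

text \<open>By the singular value decomposition both operators are diagonal with the same non-zero eigenvalues.\<close>

lemma phi_adjoint_comp_commute:
  fixes X :: "'h \<Rightarrow> 'h"
  assumes X: "X \<in> bounded_operators" and w: "(\<lambda>x. cadjoint X (X x)) \<in> weak_L1"
  shows "\<phi> (\<lambda>x. cadjoint X (X x)) = \<phi> (\<lambda>x. X (cadjoint X x))"
proof -
  have cp: "compact_operator (\<lambda>x. cadjoint X (X x))" using w by (simp add: weak_L1_def)
  obtain e l K where e: "onb e" and l: "\<And>k. 0 \<le> l k" "\<And>k. l k \<le> K"
    and ev: "\<And>k. cadjoint X (X (e k)) = complex_of_real (l k) *\<^sub>C e k"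
    and diag: "(\<lambda>x. cadjoint X (X x)) = diag_operator e (\<lambda>k. complex_of_real (l k))"
    and "\<And>\<delta>. \<delta> > 0 \<Longrightarrow> finite {k. l k > \<delta>}"
    by (rule spectral_theorem_positive_compact[OF positive_adjoint_comp[OF X] cp], rule that)
  have bd: "cmod (complex_of_real (l k)) \<le> K" for k using l by simp
  have wl: "weak_l1 (\<lambda>k. complex_of_real (l k))"
    by (rule weak_L1_diag_imp_weak_l1[OF e]) (use bd w diag in auto)
  define I where "I = {k. l k \<noteq> 0}"
  \<comment> \<open>The left singular vectors of \<open>X\<close>. For \<open>l k = 0\<close> the
    division by zero makes \<open>u k\<close> the zero vector, so orthonormality is claimed on
    \<open>I\<close> only.\<close>
  define u where "u k = complex_of_real (1 / sqrt (l k)) *\<^sub>C X (e k)" for k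
  have XX: "cinner (X (e i)) (X (e j)) = (if i = j then complex_of_real (l i) else 0)" for i j
    unfolding cinner_adjoint'[OF X, symmetric] ev cinner_scaleC_left onb_cinner[OF e] by simp
  have u: "orthonormal_on I u"
    unfolding orthonormal_on_def I_def
  proof (intro ballI)
    fix i j assume "i \<in> {k. l k \<noteq> 0}" "j \<in> {k. l k \<noteq> 0}"
    then have i: "l i > 0" using l(1)[of i] by simp
    then have "complex_of_real (1 / sqrt (l i)) * (complex_of_real (1 / sqrt (l i)) * complex_of_real (l i)) = 1"
      unfolding of_real_mult[symmetric] by (simp add: field_simps)
    then show "cinner (u i) (u j) = (if i = j then 1 else 0)"
      by (cases "i = j") (simp_all add: u_def cinner_scaleC_left cinner_scaleC_right XX del: of_real_divide)
  qed
  have z: "complex_of_real (l k) = 0" if "k \<notin> I" for k using that by (simp add: I_def)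
  have "X (cadjoint X x) = diag_operator u (\<lambda>k. complex_of_real (l k)) x" for x
  proof -
    have 1: "(\<lambda>k. X (cinner (cadjoint X x) (e k) *\<^sub>C e k)) sums X (cadjoint X x)"
      by (rule bounded_linear.sums[OF bop_linear[OF X] onb_sums[OF e]])
    have 2: "(\<lambda>k. (complex_of_real (l k) * cinner x (u k)) *\<^sub>C u k) sums diag_operator u (\<lambda>k. complex_of_real (l k)) x"
      by (rule diag_operator_sums[where y = "\<lambda>k. complex_of_real (l k)", OF u z bd])
    have 3: "X (cinner (cadjoint X x) (e k) *\<^sub>C e k) = (complex_of_real (l k) * cinner x (u k)) *\<^sub>C u k" for k
    proof (cases "l k = 0")
      case True
      then have "X (e k) = 0" using XX[of k k] by (simp add: cinner_self)
      then show ?thesis using True by (simp add: bop_scaleC[OF X])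
    next
      case False
      then have "l k > 0" using l(1)[of k] by simp
      then have "complex_of_real (l k) * complex_of_real (1 / sqrt (l k)) * complex_of_real (1 / sqrt (l k)) = 1"
        unfolding of_real_mult[symmetric] by (simp add: field_simps)
      moreover have "complex_of_real (l k) * cinner x (u k) * complex_of_real (1 / sqrt (l k))
        = (complex_of_real (l k) * complex_of_real (1 / sqrt (l k)) * complex_of_real (1 / sqrt (l k))) * cinner x (X (e k))"
        by (simp add: u_def cinner_scaleC_right mult_ac)
      ultimately show ?thesis
        by (simp add: bop_scaleC[OF X] cinner_adjoint'[OF X] u_def scaleC_scaleC del: of_real_divide)
    qed
    show ?thesis by (rule sums_unique2[OF 1 2[folded 3]])
  qed
  then have "(\<lambda>x. X (cadjoint X x)) = diag_operator u (\<lambda>k. complex_of_real (l k))" by blast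
  then show ?thesis unfolding diag
    using phi_diag[OF u z wl] phi_diag[OF onb_orthonormal[OF e, of UNIV] _ wl] by simp
qed

end

section \<open>Reduction to block diagonal operators\<close>

section \<open>Compression to dyadic blocks\<close>

text \<open>Entries above \<open>\<delta>\<close> occur only in blocks numbered below
  \<open>N\<close>, and the sizes of these blocks add up like a geometric series, to a multiple of
  \<open>2 ^ N\<close>. Only non-zero entries are counted, so zeros may be put into any
  block.\<close>

lemma block_weak_l1:
  fixes z :: "nat \<Rightarrow> complex" and m :: "nat \<Rightarrow> nat"
  assumes fin: "\<And>n. finite {k. m k = n \<and> z k \<noteq> 0}"
    and card: "\<And>n. real (card {k. m k = n \<and> z k \<noteq> 0}) \<le> C * 2 ^ n"
    and z: "\<And>k. cmod (z k) \<le> c * (1/2) ^ m k"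
  shows "weak_l1 z"
  unfolding weak_l1_def
proof (intro exI allI impI)
  fix \<delta> :: real assume d: "\<delta> > 0"
  have C0: "C \<ge> 0" using card[of 0] by simp
  have c0: "c \<ge> 0"
  proof -
    have "0 \<le> c * (1/2) ^ m 0" using z[of 0] norm_ge_zero order_trans by blast
    then show ?thesis using mult_neg_pos[of c "(1/2) ^ m 0"] by (meson not_less zero_less_power half_gt_zero zero_less_one)
  qed
  \<comment> \<open>Unless the least such \<open>N\<close> is 0, minimality gives 2^N < 2 * (c /
    \<delta>), which turns the geometric sum into a multiple of 1 / \<delta>.\<close>
  define N where "N = (LEAST n. c / \<delta> \<le> 2 ^ n)"
  have ex: "\<exists>n. c / \<delta> \<le> 2 ^ n" using real_arch_pow[of 2 "c/\<delta>"] by (auto intro: less_imp_le)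
  let ?A = "\<lambda>n. {k. m k = n \<and> z k \<noteq> 0}"
  have sub: "{k. \<delta> < cmod (z k)} \<subseteq> (\<Union>n<N. ?A n)"
  proof
    fix k assume "k \<in> {k. \<delta> < cmod (z k)}"
    then have k: "\<delta> < cmod (z k)" by simp
    then have "\<delta> < c * (1/2) ^ m k" using z[of k] by simp
    then have "2 ^ m k < c / \<delta>" using d by (simp add: field_simps power_divide)
    then have "m k < N" unfolding N_def
      using LeastI_ex[OF ex] by (metis (mono_tags, lifting) le_less_trans linorder_not_less not_less_iff_gr_or_eq
          one_le_numeral order_less_le_trans power_increasing less_irrefl)
    moreover have "z k \<noteq> 0" using k d by auto
    ultimately show "k \<in> (\<Union>n<N. ?A n)" by blast
  qed
  have finU: "finite (\<Union>n<N. ?A n)" using fin by blast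
  have "real (card {k. \<delta> < cmod (z k)}) \<le> real (card (\<Union>n<N. ?A n))"
    using card_mono[OF finU sub] by simp
  also have "\<dots> \<le> real (\<Sum>n<N. card (?A n))" unfolding of_nat_le_iff by (rule card_UN_le) simp
  also have "\<dots> \<le> (\<Sum>n<N. C * 2 ^ n)" using card by (simp add: sum_mono)
  also have "\<dots> = C * (2 ^ N - 1)" unfolding sum_distrib_left[symmetric] by (simp add: geometric_sum)
  also have "\<dots> \<le> (2 * C * c) / \<delta>"
  proof (cases N)
    case 0
    then show ?thesis using C0 c0 d by simp
  next
    case (Suc p)
    have "\<not> c / \<delta> \<le> 2 ^ p" using not_less_Least[of p "\<lambda>n. c / \<delta> \<le> 2 ^ n"] Suc unfolding N_def by simp
    then have "2 ^ N - 1 \<le> 2 * (c / \<delta>)" using Suc by simp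
    then have "C * (2 ^ N - 1) \<le> C * (2 * (c / \<delta>))" using C0 by (rule mult_left_mono)
    then show ?thesis by (simp add: mult_ac)
  qed
  finally show "finite {k. \<delta> < cmod (z k)} \<and> real (card {k. \<delta> < cmod (z k)}) \<le> (2 * C * c) / \<delta>"
    using finite_subset[OF sub finU] by blast
qed

text \<open>The growth bound on the blocks is exactly what makes the weights 2^(-n) weakly summable,
  and hence \<open>W\<close> an element of the ideal.\<close>

locale block_trace = weak_trace b \<phi> for b :: "nat \<Rightarrow> 'h::complex_hilbert" and \<phi> +
  fixes e :: "nat \<Rightarrow> 'h" and n :: "nat \<Rightarrow> nat" and C :: real
  assumes e: "onb e" and fin_block: "\<And>m. finite {j. n j = m}"
    and card_block: "\<And>m. real (card {j. n j = m}) \<le> C * 2 ^ m"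
begin

definition w :: "nat \<Rightarrow> real" where "w j = (1/2) ^ n j"
definition r :: "nat \<Rightarrow> real" where "r j = sqrt (w j)"
definition W :: "'h \<Rightarrow> 'h" where "W = diag_operator e (\<lambda>j. complex_of_real (w j))"
definition R :: "'h \<Rightarrow> 'h" where "R = diag_operator e (\<lambda>j. complex_of_real (r j))"

lemma w_pos: "w j > 0" and w_le: "w j \<le> 1"
  by (auto simp: w_def power_le_one)

lemma r_pos: "r j > 0" and r_le: "r j \<le> 1" and r2: "r j * r j = w j"
  using w_pos[of j] w_le[of j] by (auto simp: r_def)

lemma w_bd: "cmod (complex_of_real (w j)) \<le> 1" and r_bd: "cmod (complex_of_real (r j)) \<le> 1"
  using w_pos[of j] w_le[of j] r_pos[of j] r_le[of j] by auto

lemma W_coeff: "cinner (W x) (e j) = w j * cinner x (e j)"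
  unfolding W_def by (rule onb_diag_coeff[where y = "\<lambda>j. complex_of_real (w j)", OF e w_bd])

lemma R_coeff: "cinner (R x) (e j) = r j * cinner x (e j)"
  unfolding R_def by (rule onb_diag_coeff[where y = "\<lambda>j. complex_of_real (r j)", OF e r_bd])

lemma W_basis: "W (e j) = complex_of_real (w j) *\<^sub>C e j"
  unfolding W_def by (rule onb_diag_basis[where y = "\<lambda>j. complex_of_real (w j)", OF e w_bd])

lemma R_basis: "R (e j) = complex_of_real (r j) *\<^sub>C e j"
  unfolding R_def by (rule onb_diag_basis[where y = "\<lambda>j. complex_of_real (r j)", OF e r_bd])

lemma W_bop: "W \<in> bounded_operators"
  unfolding W_def by (rule onb_bop_diag[where y = "\<lambda>j. complex_of_real (w j)", OF e w_bd])

lemma R_bop: "R \<in> bounded_operators"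
  unfolding R_def by (rule onb_bop_diag[where y = "\<lambda>j. complex_of_real (r j)", OF e r_bd])

lemma RR: "R (R x) = W x"
  by (rule onb_eqI[OF e]) (simp add: W_coeff R_coeff r2[symmetric])

lemma R_adjoint: "cadjoint R = R"
  unfolding R_def using diag_cadjoint[where y = "\<lambda>j. complex_of_real (r j)", OF onb_orthonormal[OF e, of UNIV] _ r_bd]
  by simp

lemma weak_l1_w: "weak_l1 (\<lambda>j. complex_of_real (w j))"
proof (rule block_weak_l1[of n _ C 1])
  fix m
  have "{k. n k = m \<and> complex_of_real (w k) \<noteq> 0} = {k. n k = m}" using w_pos by (auto simp: less_imp_neq[symmetric])
  then show "finite {k. n k = m \<and> complex_of_real (w k) \<noteq> 0}"
    "real (card {k. n k = m \<and> complex_of_real (w k) \<noteq> 0}) \<le> C * 2 ^ m"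
    using fin_block card_block by simp_all
qed (simp add: w_def norm_power norm_divide)

lemma W_weak_L1: "W \<in> weak_L1"
  unfolding W_def by (rule diag_weak_L1[OF onb_orthonormal[OF e, of UNIV] _ weak_l1_w]) simp

text \<open>The ideal property gives nothing for a single factor, since \<open>R\<close> has only
  the square roots of the weights. Instead each of the two factors contributes sqrt \<delta> off the
  vectors \<open>e k\<close> with \<open>\<delta> < w k\<close>. The condition for the outer factor
  is pulled back through \<open>Z\<close> and \<open>R\<close>, whence the factor 2 in the
  constant.\<close>

lemma R_sandwich_weak_L1:
  assumes Z: "Z \<in> bounded_operators"
  shows "(\<lambda>x. R (Z (R x))) \<in> weak_L1"
proof -
  obtain \<beta> where \<beta>: "\<beta> > 0" "\<And>x. norm (Z x) \<le> \<beta> * norm x" using bop_bound[OF Z] by blast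
  obtain K where K: "\<And>\<delta>. \<delta> > 0 \<Longrightarrow> finite {k. \<delta> < cmod (complex_of_real (w k))} \<and>
      real (card {k. \<delta> < cmod (complex_of_real (w k))}) \<le> K / \<delta>"
    using weak_l1_w unfolding weak_l1_def by blast
  have wn: "cmod (complex_of_real (w k)) = w k" for k using w_pos[of k] by simp
  have Rx: "norm (R x) \<le> sqrt \<delta> * norm x" if d: "\<delta> > 0" and x: "\<forall>c\<in>e ` {k. \<delta> < w k}. cinner x c = 0" for x \<delta>
  proof (rule onb_norm_le[OF e])
    fix i
    show "cmod (cinner (R x) (e i)) \<le> sqrt \<delta> * cmod (cinner x (e i))"
    proof (cases "\<delta> < w i")
      case False
      then have "r i \<le> sqrt \<delta>" by (simp add: r_def)
      then show ?thesis using r_pos[of i] by (simp add: R_coeff norm_mult mult_right_mono)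
    qed (use x in \<open>simp add: R_coeff\<close>)
  qed (use d in auto)
  have "gelfand_weak (\<lambda>x. R (Z (R x))) (2 * \<beta> * K)"
    unfolding gelfand_weak_def
  proof (intro conjI allI impI)
    show "(\<lambda>x. R (Z (R x))) \<in> bounded_operators"
      by (rule bop_comp[OF R_bop bop_comp[OF Z R_bop]])
    fix \<delta>' :: real assume "\<delta>' > 0"
    define \<delta> where "\<delta> = \<delta>' / \<beta>"
    have d: "\<delta> > 0" using \<open>\<delta>' > 0\<close> \<beta> by (simp add: \<delta>_def)
    let ?S = "{k. \<delta> < w k}"
    have S: "finite ?S" "real (card ?S) \<le> K / \<delta>" using K[OF d] unfolding wn by blast+
    let ?D = "e ` ?S"
    let ?E = "(\<lambda>c. R (cadjoint Z c)) ` ?D"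
    show "\<exists>C. finite C \<and> real (card C) \<le> 2 * \<beta> * K / \<delta>' \<and>
        (\<forall>x. (\<forall>c\<in>C. cinner x c = 0) \<longrightarrow> norm (R (Z (R x))) \<le> \<delta>' * norm x)"
    proof (intro exI[of _ "?D \<union> ?E"] conjI allI impI)
      show "finite (?D \<union> ?E)" using S(1) by simp
      have "card (?D \<union> ?E) \<le> card ?D + card ?E" by (rule card_Un_le)
      also have "\<dots> \<le> card ?D + card ?D" using S(1) by (intro add_left_mono card_image_le) simp
      also have "\<dots> \<le> 2 * card ?S" using card_image_le[OF S(1), of e] by simp
      finally have "real (card (?D \<union> ?E)) \<le> 2 * (K / \<delta>)" using S(2) by linarith
      then show "real (card (?D \<union> ?E)) \<le> 2 * \<beta> * K / \<delta>'" by (simp add: \<delta>_def mult_ac)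
      fix x assume x: "\<forall>c\<in>?D \<union> ?E. cinner x c = 0"
      have "cinner (Z (R x)) c = 0" if "c \<in> ?D" for c
      proof -
        have "cinner (Z (R x)) c = cinner x (R (cadjoint Z c))"
          by (simp add: cinner_adjoint[OF Z] cinner_adjoint[OF R_bop] R_adjoint)
        moreover have "R (cadjoint Z c) \<in> ?E" using that by (rule imageI)
        ultimately show ?thesis using x by (metis UnI2)
      qed
      then have "norm (R (Z (R x))) \<le> sqrt \<delta> * norm (Z (R x))" by (intro Rx d ballI)
      also have "\<dots> \<le> sqrt \<delta> * (\<beta> * norm (R x))" using d by (intro mult_left_mono \<beta>) auto
      also have "\<dots> \<le> sqrt \<delta> * (\<beta> * (sqrt \<delta> * norm x))"
        using d \<beta> x by (intro mult_left_mono Rx) auto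
      also have "\<dots> = (sqrt \<delta> * sqrt \<delta>) * \<beta> * norm x" by (simp only: mult_ac)
      also have "\<dots> = \<delta>' * norm x" using d \<beta> \<open>\<delta>' > 0\<close> by (simp add: \<delta>_def)
      finally show "norm (R (Z (R x))) \<le> \<delta>' * norm x" .
    qed
  qed
  then show ?thesis unfolding weak_L1_iff_gelfand by blast
qed

text \<open>The commutation of an operator with its adjoint under \<open>\<phi>\<close>, applied to
  \<open>X = (B + u) R\<close> and multiplied out. The terms with \<open>cnj u * u\<close> are
  multiples of \<open>\<phi> W\<close> on both sides and cancel.\<close>

lemma phi_polarised:
  assumes B: "B \<in> bounded_operators"
  shows "\<phi> (\<lambda>x. R (cadjoint B (B (R x)))) + u * \<phi> (\<lambda>x. R (cadjoint B (R x))) + cnj u * \<phi> (\<lambda>x. R (B (R x)))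
       = \<phi> (\<lambda>x. B (W (cadjoint B x))) + u * \<phi> (\<lambda>x. W (cadjoint B x)) + cnj u * \<phi> (\<lambda>x. B (W x))"
proof -
  note A = bop_adjoint[OF B]
  define X where "X x = B (R x) + u *\<^sub>C R x" for x
  have Xb: "X \<in> bounded_operators"
    unfolding X_def by (intro bop_plus bop_comp[OF B R_bop] bop_scale R_bop)
  have Xa: "cadjoint X = (\<lambda>x. R (cadjoint B x) + cnj u *\<^sub>C R x)"
  proof (rule adjoint_unique)
    fix x y
    have "cinner (B (R x)) y = cinner x (R (cadjoint B y))" "cinner (R x) y = cinner x (R y)"
      by (simp_all add: cinner_adjoint[OF B] cinner_adjoint[OF R_bop] R_adjoint)
    then show "cinner (X x) y = cinner x (R (cadjoint B y) + cnj u *\<^sub>C R y)"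
      by (simp add: X_def cinner_add_left cinner_add_right cinner_scaleC_left cinner_scaleC_right)
  qed
  have 1: "(\<lambda>x. cadjoint X (X x)) = (\<lambda>x. R (cadjoint B (B (R x))) + (u *\<^sub>C R (cadjoint B (R x))
      + (cnj u *\<^sub>C R (B (R x)) + (cnj u * u) *\<^sub>C W x)))"
    by (simp add: fun_eq_iff Xa X_def bop_add[OF A] bop_add[OF R_bop] bop_scaleC[OF A] bop_scaleC[OF R_bop]
        scaleC_add_right scaleC_scaleC RR add_ac)
  have 2: "(\<lambda>x. X (cadjoint X x)) = (\<lambda>x. B (W (cadjoint B x)) + (u *\<^sub>C W (cadjoint B x)
      + (cnj u *\<^sub>C B (W x) + (cnj u * u) *\<^sub>C W x)))"
    by (simp add: fun_eq_iff Xa X_def bop_add[OF B] bop_add[OF R_bop] bop_scaleC[OF B] bop_scaleC[OF R_bop]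
        scaleC_add_right scaleC_scaleC RR add_ac mult.commute)
  have m1: "(\<lambda>x. R (cadjoint B (B (R x)))) \<in> weak_L1" by (rule R_sandwich_weak_L1[OF bop_comp[OF A B]])
  have m2: "(\<lambda>x. R (cadjoint B (R x))) \<in> weak_L1" by (rule R_sandwich_weak_L1[OF A])
  have m3: "(\<lambda>x. R (B (R x))) \<in> weak_L1" by (rule R_sandwich_weak_L1[OF B])
  have m4: "(\<lambda>x. W (cadjoint B x)) \<in> weak_L1" by (rule weak_L1_right[OF W_weak_L1 A])
  have m5: "(\<lambda>x. B (W (cadjoint B x))) \<in> weak_L1" by (rule weak_L1_left[OF m4 B])
  have m6: "(\<lambda>x. B (W x)) \<in> weak_L1" by (rule weak_L1_left[OF W_weak_L1 B])
  note s = weak_L1_scale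
  have phi1: "\<phi> (\<lambda>x. cadjoint X (X x)) = \<phi> (\<lambda>x. R (cadjoint B (B (R x)))) + (u * \<phi> (\<lambda>x. R (cadjoint B (R x)))
      + (cnj u * \<phi> (\<lambda>x. R (B (R x))) + (cnj u * u) * \<phi> W))"
    unfolding 1 phi_add[OF m1 weak_L1_add[OF s[OF m2] weak_L1_add[OF s[OF m3] s[OF W_weak_L1]]]]
      phi_add[OF s[OF m2] weak_L1_add[OF s[OF m3] s[OF W_weak_L1]]] phi_add[OF s[OF m3] s[OF W_weak_L1]]
      phi_scale[OF m2] phi_scale[OF m3] phi_scale[OF W_weak_L1] ..
  have phi2: "\<phi> (\<lambda>x. X (cadjoint X x)) = \<phi> (\<lambda>x. B (W (cadjoint B x))) + (u * \<phi> (\<lambda>x. W (cadjoint B x))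
      + (cnj u * \<phi> (\<lambda>x. B (W x)) + (cnj u * u) * \<phi> W))"
    unfolding 2 phi_add[OF m5 weak_L1_add[OF s[OF m4] weak_L1_add[OF s[OF m6] s[OF W_weak_L1]]]]
      phi_add[OF s[OF m4] weak_L1_add[OF s[OF m6] s[OF W_weak_L1]]] phi_add[OF s[OF m6] s[OF W_weak_L1]]
      phi_scale[OF m4] phi_scale[OF m6] phi_scale[OF W_weak_L1] ..
  have "(\<lambda>x. cadjoint X (X x)) \<in> weak_L1"
    unfolding 1 by (intro weak_L1_add s m1 m2 m3 W_weak_L1)
  from phi_adjoint_comp_commute[OF Xb this] show ?thesis unfolding phi1 phi2 by (simp add: add_ac)
qed

text \<open>Comparing the coefficients of the polarised identity at \<open>u = 0, 1, \<i>\<close>.\<close>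

lemma
  assumes B: "B \<in> bounded_operators"
  shows phi_right: "\<phi> (\<lambda>x. B (W x)) = \<phi> (\<lambda>x. R (B (R x)))"
    and phi_left: "\<phi> (\<lambda>x. W (B x)) = \<phi> (\<lambda>x. R (B (R x)))"
proof -
  have *: "\<phi> (\<lambda>x. B (W x)) = \<phi> (\<lambda>x. R (B (R x))) \<and> \<phi> (\<lambda>x. W (cadjoint B x)) = \<phi> (\<lambda>x. R (cadjoint B (R x)))"
    if B: "B \<in> bounded_operators" for B
  proof -
    define p where "p = \<phi> (\<lambda>x. R (cadjoint B (R x))) - \<phi> (\<lambda>x. W (cadjoint B x))"
    define q where "q = \<phi> (\<lambda>x. R (B (R x))) - \<phi> (\<lambda>x. B (W x))"
    have pq: "u * p + cnj u * q = 0" for u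
      using phi_polarised[OF B, of u] phi_polarised[OF B, of 0] unfolding p_def q_def
      by (simp add: algebra_simps)
    have "p + q = 0" using pq[of 1] by simp
    moreover have "p - q = 0" using pq[of \<i>] by (simp add: algebra_simps)
    ultimately have "p = 0" "q = 0" by (simp_all add: complex_eq_iff)
    then show ?thesis by (simp add: p_def q_def)
  qed
  show "\<phi> (\<lambda>x. B (W x)) = \<phi> (\<lambda>x. R (B (R x)))" using *[OF B] by blast
  show "\<phi> (\<lambda>x. W (B x)) = \<phi> (\<lambda>x. R (B (R x)))"
    using *[OF bop_adjoint[OF B]] by (simp add: adjoint_adjoint[OF B])
qed

subsection \<open>Block diagonals of a bounded operator\<close>

text \<open>The block number is an integer so that \<open>int (n i) - k\<close> may be negative; the
  projection is then 0.\<close>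

definition block_proj :: "int \<Rightarrow> 'h \<Rightarrow> 'h" where
  "block_proj m x = (\<Sum>j | int (n j) = m. cinner x (e j) *\<^sub>C e j)"

lemma fin_block_int: "finite {j. int (n j) = m}"
proof (cases "m \<ge> 0")
  case True
  then have "{j. int (n j) = m} = {j. n j = nat m}" by auto
  then show ?thesis using fin_block by simp
next
  case False
  then have "{j. int (n j) = m} = {}" by auto
  then show ?thesis by simp
qed

lemma block_proj_coeff: "cinner (block_proj m x) (e j) = (if int (n j) = m then cinner x (e j) else 0)"
  unfolding block_proj_def
  using cinner_sum_orthonormal[OF onb_orthonormal[OF e, of UNIV] fin_block_int[of m], where j = j and c = "\<lambda>j. cinner x (e j)"] by simp

lemma block_proj_norm: "(norm (block_proj m x))\<^sup>2 = (\<Sum>j | int (n j) = m. (cmod (cinner x (e j)))\<^sup>2)"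
  unfolding block_proj_def by (rule norm_sum_orthonormal[OF onb_orthonormal[OF e] fin_block_int])

lemma block_proj_basis: "block_proj m (e j) = (if int (n j) = m then e j else 0)"
  by (rule onb_eqI[OF e]) (auto simp: block_proj_coeff onb_cinner[OF e])

lemma block_proj_add: "block_proj m (x + y) = block_proj m x + block_proj m y"
  by (rule onb_eqI[OF e]) (simp add: block_proj_coeff cinner_add_left)

lemma block_proj_scale: "block_proj m (c *\<^sub>C x) = c *\<^sub>C block_proj m x"
  by (rule onb_eqI[OF e]) (simp add: block_proj_coeff cinner_scaleC_left)

text \<open>The index \<open>k\<close> is the target block minus the source block.\<close>

definition block_diagonal :: "('h \<Rightarrow> 'h) \<Rightarrow> int \<Rightarrow> 'h \<Rightarrow> 'h" where
  "block_diagonal B k x = (\<Sum>i. cinner (B (block_proj (int (n i) - k) x)) (e i) *\<^sub>C e i)"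

context
  fixes B :: "'h \<Rightarrow> 'h" and \<beta> :: real
  assumes B: "B \<in> bounded_operators" and \<beta>: "\<beta> > 0" "\<And>x. norm (B x) \<le> \<beta> * norm x"
begin

text \<open>For fixed \<open>k\<close>, different target blocks draw on different source blocks, so
  the estimates for single blocks add up without loss.\<close>

lemma block_diagonal_bound:
  "(\<Sum>i<N. (cmod (cinner (B (block_proj (int (n i) - k) x)) (e i)))\<^sup>2) \<le> (\<beta> * norm x)\<^sup>2"
proof -
  let ?c = "\<lambda>i. (cmod (cinner (B (block_proj (int (n i) - k) x)) (e i)))\<^sup>2"
  let ?M = "(\<lambda>i. int (n i)) ` {..<N}"
  have "(\<Sum>i<N. ?c i) = (\<Sum>m\<in>?M. \<Sum>i | i \<in> {..<N} \<and> int (n i) = m. ?c i)"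
    by (rule sum.image_gen) simp
  also have "\<dots> \<le> (\<Sum>m\<in>?M. \<beta>\<^sup>2 * (norm (block_proj (m - k) x))\<^sup>2)"
  proof (rule sum_mono)
    fix m
    have "(\<Sum>i | i \<in> {..<N} \<and> int (n i) = m. ?c i)
        = (\<Sum>i | i \<in> {..<N} \<and> int (n i) = m. (cmod (cinner (B (block_proj (m - k) x)) (e i)))\<^sup>2)"
      by (intro sum.cong) auto
    also have "\<dots> \<le> (norm (B (block_proj (m - k) x)))\<^sup>2"
      by (rule Bessel_finite[OF onb_orthonormal[OF e]]) simp
    also have "\<dots> \<le> (\<beta> * norm (block_proj (m - k) x))\<^sup>2"
      by (intro power_mono \<beta>) simp
    finally show "(\<Sum>i | i \<in> {..<N} \<and> int (n i) = m. ?c i) \<le> \<beta>\<^sup>2 * (norm (block_proj (m - k) x))\<^sup>2"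
      by (simp add: power_mult_distrib)
  qed
  also have "\<dots> = \<beta>\<^sup>2 * (\<Sum>m\<in>?M. \<Sum>j | int (n j) = m - k. (cmod (cinner x (e j)))\<^sup>2)"
    by (simp add: sum_distrib_left block_proj_norm)
  also have "(\<Sum>m\<in>?M. \<Sum>j | int (n j) = m - k. (cmod (cinner x (e j)))\<^sup>2)
      = (\<Sum>j\<in>(\<Union>m\<in>?M. {j. int (n j) = m - k}). (cmod (cinner x (e j)))\<^sup>2)"
    by (rule sum.UNION_disjoint[symmetric]) (auto simp: fin_block_int)
  also have "\<dots> \<le> (norm x)\<^sup>2"
    by (rule Bessel_finite[OF onb_orthonormal[OF e]]) (auto simp: fin_block_int)
  finally show ?thesis by (simp add: power_mult_distrib mult_left_mono)
qed

lemma block_diagonal_summable: "summable (\<lambda>i. (cmod (cinner (B (block_proj (int (n i) - k) x)) (e i)))\<^sup>2)"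
  by (rule summableI_nonneg_bounded[OF _ block_diagonal_bound]) simp

lemma block_diagonal_coeff:
  "cinner (block_diagonal B k x) (e i) = cinner (B (block_proj (int (n i) - k) x)) (e i)"
  unfolding block_diagonal_def
  by (rule orthonormal_series(2)[where c = "\<lambda>i. cinner (B (block_proj (int (n i) - k) x)) (e i)",
      OF onb_orthonormal[OF e, of UNIV] _ block_diagonal_summable]) auto

lemma block_diagonal_norm: "norm (block_diagonal B k x) \<le> \<beta> * norm x"
proof (rule power2_le_imp_le)
  have "(norm (block_diagonal B k x))\<^sup>2 = (\<Sum>i. (cmod (cinner (B (block_proj (int (n i) - k) x)) (e i)))\<^sup>2)"
    unfolding block_diagonal_def
    by (rule orthonormal_series(3)[where c = "\<lambda>i. cinner (B (block_proj (int (n i) - k) x)) (e i)",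
        OF onb_orthonormal[OF e, of UNIV] _ block_diagonal_summable]) auto
  also have "\<dots> \<le> (\<beta> * norm x)\<^sup>2" by (rule suminf_le_const[OF block_diagonal_summable block_diagonal_bound])
  finally show "(norm (block_diagonal B k x))\<^sup>2 \<le> (\<beta> * norm x)\<^sup>2" .
qed (use \<beta> in auto)

lemma block_diagonal_bop: "block_diagonal B k \<in> bounded_operators"
proof (rule bounded_operatorsI[OF _ _ block_diagonal_norm])
  show "block_diagonal B k (x + y) = block_diagonal B k x + block_diagonal B k y" for x y
    by (rule onb_eqI[OF e]) (simp add: block_diagonal_coeff cinner_add_left block_proj_add bop_add[OF B])
  show "block_diagonal B k (c *\<^sub>C x) = c *\<^sub>C block_diagonal B k x" for c x
    by (rule onb_eqI[OF e]) (simp add: block_diagonal_coeff cinner_scaleC_left block_proj_scale bop_scaleC[OF B])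
qed

lemma block_diagonal_entry:
  "cinner (block_diagonal B k (e j)) (e i) = (if int (n i) = int (n j) + k then cinner (B (e j)) (e i) else 0)"
  by (auto simp: block_diagonal_coeff block_proj_basis bop_0[OF B])

text \<open>The argument \<open>l\<close> stands for the distance \<open>Suc l\<close> between two
  different blocks.\<close>

definition offdiag_coeff :: "nat \<Rightarrow> real" where
  "offdiag_coeff l = 1 / (sqrt 2 ^ Suc l - (1 / sqrt 2) ^ Suc l)"

text \<open>For exponents at least 1 the subtracted power is at most half of the other one. The
  resulting geometric decay makes the series of \<open>commutator_solution\<close> converge
  absolutely.\<close>

lemma offdiag_coeff_bounds: "0 \<le> offdiag_coeff l" "offdiag_coeff l \<le> 2 * (1 / sqrt 2) ^ Suc l"
  "sqrt 2 ^ Suc l - (1 / sqrt 2) ^ Suc l > 0"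
proof -
  let ?q = "sqrt 2 ^ Suc l"
  have q: "?q > 0" by simp
  have qq: "?q * ?q = 2 ^ Suc l" by (simp only: power_mult_distrib[symmetric] real_sqrt_mult_self abs_numeral)
  have "2 ^ Suc l \<ge> (2::real)" by simp
  then have "1 / ?q \<le> ?q / 2" using q qq by (simp add: field_simps)
  then have *: "?q / 2 \<le> ?q - (1 / sqrt 2) ^ Suc l" by (simp add: power_divide)
  then show pos: "sqrt 2 ^ Suc l - (1 / sqrt 2) ^ Suc l > 0" using q by linarith
  then show "0 \<le> offdiag_coeff l" by (simp add: offdiag_coeff_def)
  have "offdiag_coeff l \<le> 1 / (?q / 2)"
    unfolding offdiag_coeff_def using * q pos by (intro divide_left_mono) auto
  then show "offdiag_coeff l \<le> 2 * (1 / sqrt 2) ^ Suc l" by (simp add: power_divide)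
qed

lemma offdiag_coeff_summable: "summable offdiag_coeff"
proof (rule summable_comparison_test')
  show "summable (\<lambda>l. 2 * (1 / sqrt 2) ^ Suc l)"
    by (intro summable_mult summable_Suc_iff[THEN iffD2] summable_geometric) simp
  show "norm (offdiag_coeff l) \<le> 2 * (1 / sqrt 2) ^ Suc l" if "l \<ge> 0" for l
    using offdiag_coeff_bounds[of l] by simp
qed

text \<open>A bounded solution \<open>Y\<close> of the commutator equation \<open>Y W - W Y = R (B - B\<^sub>0) R\<close>, where \<open>B\<^sub>0\<close> is the
  block diagonal part of \<open>B\<close>: on the \<open>k\<close>-th block diagonal the equation reads
  \<open>Y\<^sub>k = B\<^sub>k / (2\<^sup>k\<^sup>/\<^sup>2 - 2\<^sup>-\<^sup>k\<^sup>/\<^sup>2)\<close>, and these coefficients are summable.\<close>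

definition commutator_solution :: "'h \<Rightarrow> 'h" where
  "commutator_solution x = (\<Sum>l. complex_of_real (offdiag_coeff l) *\<^sub>C
      (block_diagonal B (int (Suc l)) x - block_diagonal B (- int (Suc l)) x))"

lemma commutator_term_norm:
  "norm (complex_of_real (offdiag_coeff l) *\<^sub>C (block_diagonal B (int (Suc l)) x - block_diagonal B (- int (Suc l)) x))
    \<le> offdiag_coeff l * (2 * \<beta> * norm x)"
proof -
  have "norm (block_diagonal B (int (Suc l)) x - block_diagonal B (- int (Suc l)) x) \<le> 2 * \<beta> * norm x"
    using norm_triangle_ineq4[of "block_diagonal B (int (Suc l)) x" "block_diagonal B (- int (Suc l)) x"]
      block_diagonal_norm[of "int (Suc l)" x] block_diagonal_norm[of "- int (Suc l)" x] by linarith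
  then show ?thesis using offdiag_coeff_bounds(1)[of l] by (simp add: norm_scaleC mult_left_mono)
qed

lemma commutator_solution_sums:
  "(\<lambda>l. complex_of_real (offdiag_coeff l) *\<^sub>C (block_diagonal B (int (Suc l)) x - block_diagonal B (- int (Suc l)) x))
     sums commutator_solution x"
  unfolding commutator_solution_def
  by (rule summable_sums, rule summable_comparison_test'[OF summable_mult2[OF offdiag_coeff_summable]])
    (rule commutator_term_norm)

lemma commutator_solution_bop: "commutator_solution \<in> bounded_operators"
proof (rule bounded_operatorsI)
  let ?D = "\<lambda>l x. block_diagonal B (int (Suc l)) x - block_diagonal B (- int (Suc l)) x"
  have D: "(\<lambda>x. complex_of_real (offdiag_coeff l) *\<^sub>C ?D l x) \<in> bounded_operators" for l
    by (intro bop_scale bop_minus block_diagonal_bop)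
  show "commutator_solution (x + y) = commutator_solution x + commutator_solution y" for x y
  proof -
    have "(\<lambda>l. complex_of_real (offdiag_coeff l) *\<^sub>C ?D l (x + y)) sums (commutator_solution x + commutator_solution y)"
      unfolding bop_add[OF D] by (rule sums_add[OF commutator_solution_sums commutator_solution_sums])
    from sums_unique2[OF commutator_solution_sums this] show ?thesis .
  qed
  show "commutator_solution (c *\<^sub>C x) = c *\<^sub>C commutator_solution x" for c x
  proof -
    have "(\<lambda>l. complex_of_real (offdiag_coeff l) *\<^sub>C ?D l (c *\<^sub>C x)) sums (c *\<^sub>C commutator_solution x)"
      unfolding bop_scaleC[OF D] by (rule bounded_linear.sums[OF bounded_linear_scaleC commutator_solution_sums])
    from sums_unique2[OF commutator_solution_sums this] show ?thesis .
  qed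
  show "norm (commutator_solution x) \<le> ((\<Sum>l. offdiag_coeff l) * (2 * \<beta>)) * norm x" for x
  proof -
    have s: "summable (\<lambda>l. offdiag_coeff l * (2 * \<beta> * norm x))" by (rule summable_mult2[OF offdiag_coeff_summable])
    have "norm (commutator_solution x) \<le> (\<Sum>l. offdiag_coeff l * (2 * \<beta> * norm x))"
      unfolding commutator_solution_def by (rule norm_suminf_le[OF commutator_term_norm s])
    also have "\<dots> = (\<Sum>l. offdiag_coeff l) * (2 * \<beta> * norm x)"
      by (rule suminf_mult2[OF offdiag_coeff_summable, symmetric])
    finally show ?thesis by (simp add: mult.assoc)
  qed
qed

text \<open>Writing \<open>w j - w i\<close> as \<open>r i * r j * (r j / r i - r i / r j)\<close>
  leaves a bracket that depends only on the signed distance of the two blocks; for different blocks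
  its reciprocal is \<open>offdiag_coeff\<close> up to sign.\<close>

lemma commutator_solution_entry:
  "complex_of_real (w j - w i) * cinner (commutator_solution (e j)) (e i)
    = complex_of_real (r i * r j) * (if n i = n j then 0 else cinner (B (e j)) (e i))"
proof -
  have ent: "(\<lambda>l. complex_of_real (offdiag_coeff l) *
      ((if int (n i) = int (n j) + int (Suc l) then cinner (B (e j)) (e i) else 0)
       - (if int (n i) = int (n j) - int (Suc l) then cinner (B (e j)) (e i) else 0)))
      sums cinner (commutator_solution (e j)) (e i)"
    using bounded_linear.sums[OF bounded_linear_cinner_left commutator_solution_sums, of "e j" "e i"]
    by (simp only: cinner_scaleC_left cinner_diff_left block_diagonal_entry add_uminus_conv_diff)
  define q where "q = 1 / sqrt 2"
  have rq: "r k = q ^ n k" for k by (simp add: r_def w_def q_def real_sqrt_power real_sqrt_divide)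
  have wq: "w k = q ^ n k * q ^ n k" for k using r2[of k] by (simp add: rq)
  have q: "q > 0" "q * sqrt 2 = 1" by (simp_all add: q_def)
  consider "n i = n j" | p where "n i = n j + Suc p" | p where "n j = n i + Suc p"
    by (metis less_iff_Suc_add linorder_neqE_nat add_Suc_right)
  then show ?thesis
  proof cases
    case 1
    then show ?thesis by (simp add: w_def)
  next
    case (2 p)
    have "(\<lambda>l. if l = p then complex_of_real (offdiag_coeff l) * cinner (B (e j)) (e i) else 0)
        sums cinner (commutator_solution (e j)) (e i)"
      using ent by (rule sums_cong[THEN iffD1, rotated]) (auto simp: 2)
    then have "cinner (commutator_solution (e j)) (e i) = complex_of_real (offdiag_coeff p) * cinner (B (e j)) (e i)"
      using sums_single[of p "\<lambda>l. complex_of_real (offdiag_coeff l) * cinner (B (e j)) (e i)"] by (rule sums_unique2)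
    moreover have "(w j - w i) * offdiag_coeff p = r i * r j"
    proof -
      have "w j - w i = q ^ n j * q ^ n j * (1 - q ^ Suc p * q ^ Suc p)"
        unfolding wq 2 power_add by (simp add: algebra_simps)
      also have "1 - q ^ Suc p * q ^ Suc p = q ^ Suc p * (sqrt 2 ^ Suc p - q ^ Suc p)"
        unfolding right_diff_distrib power_mult_distrib[symmetric] q(2) by simp
      finally have "w j - w i = r i * r j * (sqrt 2 ^ Suc p - q ^ Suc p)"
        unfolding rq 2 power_add by (simp only: mult_ac)
      then show ?thesis using offdiag_coeff_bounds(3)[of p] unfolding offdiag_coeff_def q_def by simp
    qed
    ultimately show ?thesis using 2 by (simp add: mult.assoc[symmetric] of_real_mult[symmetric] del: of_real_mult of_real_diff)
  next
    case (3 p)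
    have "(\<lambda>l. if l = p then - (complex_of_real (offdiag_coeff l) * cinner (B (e j)) (e i)) else 0)
        sums cinner (commutator_solution (e j)) (e i)"
      using ent by (rule sums_cong[THEN iffD1, rotated]) (auto simp: 3)
    then have "cinner (commutator_solution (e j)) (e i) = - (complex_of_real (offdiag_coeff p) * cinner (B (e j)) (e i))"
      using sums_single[of p "\<lambda>l. - (complex_of_real (offdiag_coeff l) * cinner (B (e j)) (e i))"] by (rule sums_unique2)
    moreover have "(w j - w i) * (- offdiag_coeff p) = r i * r j"
    proof -
      have "w i - w j = q ^ n i * q ^ n i * (1 - q ^ Suc p * q ^ Suc p)"
        unfolding wq 3 power_add by (simp add: algebra_simps)
      also have "1 - q ^ Suc p * q ^ Suc p = q ^ Suc p * (sqrt 2 ^ Suc p - q ^ Suc p)"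
        unfolding right_diff_distrib power_mult_distrib[symmetric] q(2) by simp
      finally have "w i - w j = r i * r j * (sqrt 2 ^ Suc p - q ^ Suc p)"
        unfolding rq 3 power_add by (simp only: mult_ac)
      then have "(w i - w j) * offdiag_coeff p = r i * r j"
        using offdiag_coeff_bounds(3)[of p] unfolding offdiag_coeff_def q_def by simp
      then show ?thesis by (simp add: algebra_simps)
    qed
    then have "complex_of_real (w j - w i) * (- complex_of_real (offdiag_coeff p)) = complex_of_real (r i * r j)"
      by (metis of_real_mult of_real_minus)
    moreover have "complex_of_real (w j - w i) * (- (complex_of_real (offdiag_coeff p) * cinner (B (e j)) (e i)))
      = (complex_of_real (w j - w i) * (- complex_of_real (offdiag_coeff p))) * cinner (B (e j)) (e i)"
      by simp
    ultimately show ?thesis using 3 by (simp only:) simp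
  qed
qed

text \<open>By \<open>phi_left\<close> and \<open>phi_right\<close> both orders of \<open>Y\<close>
  and \<open>W\<close> have the trace of \<open>Y\<close> sandwiched between two factors
  \<open>R\<close>. The commutator thus contributes nothing, and the off-diagonal blocks that it
  represents drop out.\<close>

lemma phi_block_diagonal: "\<phi> (\<lambda>x. B (W x)) = \<phi> (\<lambda>x. block_diagonal B 0 (W x))"
proof -
  define B0 where "B0 = block_diagonal B 0"
  define Y where "Y = commutator_solution"
  have B0: "B0 \<in> bounded_operators" and Y: "Y \<in> bounded_operators"
    unfolding B0_def Y_def by (rule block_diagonal_bop commutator_solution_bop)+
  have YW: "(\<lambda>x. Y (W x)) = (\<lambda>x. W (Y x) + (R (B (R x)) + (-1) *\<^sub>C R (B0 (R x))))"
  proof (rule bop_eqI[OF e])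
    show "(\<lambda>x. Y (W x)) \<in> bounded_operators" by (rule bop_comp[OF Y W_bop])
    show "(\<lambda>x. W (Y x) + (R (B (R x)) + (-1) *\<^sub>C R (B0 (R x)))) \<in> bounded_operators"
      by (intro bop_plus bop_scale bop_comp[OF W_bop Y] bop_comp[OF R_bop bop_comp[OF B R_bop]]
          bop_comp[OF R_bop bop_comp[OF B0 R_bop]])
    fix i j
    have "complex_of_real (w j) * cinner (Y (e j)) (e i) - complex_of_real (w i) * cinner (Y (e j)) (e i)
      = complex_of_real (r i) * complex_of_real (r j) * cinner (B (e j)) (e i)
        - complex_of_real (r i) * complex_of_real (r j) * cinner (B0 (e j)) (e i)"
      using commutator_solution_entry[of j i]
      by (simp add: Y_def B0_def block_diagonal_entry left_diff_distrib split: if_splits)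
    then show "cinner (Y (W (e j))) (e i) = cinner (W (Y (e j)) + (R (B (R (e j))) + (-1) *\<^sub>C R (B0 (R (e j))))) (e i)"
      by (simp add: W_basis R_basis bop_scaleC[OF Y] bop_scaleC[OF B] bop_scaleC[OF B0] bop_scaleC[OF R_bop]
          cinner_scaleC_left cinner_add_left cinner_diff_left W_coeff R_coeff algebra_simps)
  qed
  have m: "(\<lambda>x. W (Y x)) \<in> weak_L1" "(\<lambda>x. R (B (R x))) \<in> weak_L1" "(\<lambda>x. R (B0 (R x))) \<in> weak_L1"
    by (rule weak_L1_right[OF W_weak_L1 Y] R_sandwich_weak_L1[OF B] R_sandwich_weak_L1[OF B0])+
  have "\<phi> (\<lambda>x. Y (W x)) = \<phi> (\<lambda>x. W (Y x)) + (\<phi> (\<lambda>x. R (B (R x))) + (-1) * \<phi> (\<lambda>x. R (B0 (R x))))"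
    unfolding YW phi_add[OF m(1) weak_L1_add[OF m(2) weak_L1_scale[OF m(3)]]]
      phi_add[OF m(2) weak_L1_scale[OF m(3)]] phi_scale[OF m(3)] ..
  then have "\<phi> (\<lambda>x. R (B (R x))) = \<phi> (\<lambda>x. R (B0 (R x)))"
    by (simp add: phi_left[OF Y] phi_right[OF Y])
  then show ?thesis by (simp add: phi_right[OF B] phi_right[OF B0] B0_def[symmetric])
qed

end

end

section \<open>Block sums determine the trace\<close>

section \<open>Traces of block sequences\<close>

text \<open>The elements of \<open>S\<close> can be ordered so that the partial sums of \<open>f\<close>, started at \<open>a\<close>, stay bounded by \<open>c\<close>;
  \<open>p\<close> and \<open>q\<close> are the partial sums after and before each element.\<close>

lemma bounded_rearrangement_aux:
  fixes f :: "'a \<Rightarrow> real"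
  assumes "finite S" "\<And>k. k \<in> S \<Longrightarrow> \<bar>f k\<bar> \<le> c" "\<bar>a\<bar> \<le> c" "a + sum f S = 0"
  shows "\<exists>p q. (\<forall>k\<in>S. f k = p k - q k \<and> \<bar>p k\<bar> \<le> c) \<and>
    add_mset a (image_mset p (mset_set S)) = add_mset 0 (image_mset q (mset_set S))"
  using assms
proof (induction "card S" arbitrary: S a)
  case 0
  then show ?case by auto
next
  case (Suc m)
  have ne: "S \<noteq> {}" using Suc.hyps by auto
  \<comment> \<open>A term of sign opposite to the running sum \<open>a\<close> keeps that sum
    within \<open>c\<close>; one exists because the remaining terms add up to
    \<open>- a\<close>.\<close>
  obtain i where i: "i \<in> S" "\<bar>a + f i\<bar> \<le> c"
  proof (cases "a \<ge> 0")
    case True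
    have "\<exists>i\<in>S. f i \<le> 0"
    proof (rule ccontr)
      assume "\<not> (\<exists>i\<in>S. f i \<le> 0)"
      then have "sum f S > 0" using Suc.prems(1) ne by (intro sum_pos) auto
      then show False using Suc.prems(4) True by simp
    qed
    then obtain i where i: "i \<in> S" "f i \<le> 0" by blast
    then have "\<bar>a + f i\<bar> \<le> c" using Suc.prems(2)[OF i(1)] Suc.prems(3) True by linarith
    then show ?thesis using that i by blast
  next
    case False
    have "\<exists>i\<in>S. f i \<ge> 0"
    proof (rule ccontr)
      assume "\<not> (\<exists>i\<in>S. f i \<ge> 0)"
      then have "sum (\<lambda>i. - f i) S > 0" using Suc.prems(1) ne by (intro sum_pos) auto
      then show False using Suc.prems(4) False by (simp add: sum_negf)
    qed
    then obtain i where i: "i \<in> S" "f i \<ge> 0" by blast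
    then have "\<bar>a + f i\<bar> \<le> c" using Suc.prems(2)[OF i(1)] Suc.prems(3) False by linarith
    then show ?thesis using that i by blast
  qed
  have "m = card (S - {i})" using Suc.hyps(2) Suc.prems(1) i(1) by simp
  moreover have "(a + f i) + sum f (S - {i}) = 0"
    using Suc.prems(4) sum.remove[OF Suc.prems(1) i(1), of f] by simp
  ultimately obtain p q where pq: "\<forall>k\<in>S - {i}. f k = p k - q k \<and> \<bar>p k\<bar> \<le> c"
    "add_mset (a + f i) (image_mset p (mset_set (S - {i}))) = add_mset 0 (image_mset q (mset_set (S - {i})))"
    using Suc.hyps(1)[of "S - {i}" "a + f i"] Suc.prems(1,2) i(2) by auto
  define p' where "p' = p(i := a + f i)"
  define q' where "q' = q(i := a)"
  have mS: "mset_set S = add_mset i (mset_set (S - {i}))"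
    using mset_set.remove[OF Suc.prems(1) i(1)] .
  have img: "image_mset p' (mset_set (S - {i})) = image_mset p (mset_set (S - {i}))"
    "image_mset q' (mset_set (S - {i})) = image_mset q (mset_set (S - {i}))"
    using Suc.prems(1) by (auto intro!: image_mset_cong simp: p'_def q'_def)
  have "add_mset a (image_mset p' (mset_set S)) = add_mset 0 (image_mset q' (mset_set S))"
    unfolding mS image_mset_add_mset img using pq(2) by (simp add: p'_def q'_def add_mset_commute)
  moreover have "\<forall>k\<in>S. f k = p' k - q' k \<and> \<bar>p' k\<bar> \<le> c"
    using pq(1) i(2) by (auto simp: p'_def q'_def)
  ultimately show ?case by blast
qed

text \<open>The running sum starts and ends at 0, so the sums before and after the individual terms
  form the same multiset. Matching equal values gives the permutation.\<close>

lemma bounded_rearrangement: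
  fixes f :: "'a \<Rightarrow> real"
  assumes S: "finite S" and f: "\<And>k. k \<in> S \<Longrightarrow> \<bar>f k\<bar> \<le> c" and c: "0 \<le> c" and z: "sum f S = 0"
  obtains p \<sigma> where "\<sigma> permutes S" "\<And>k. k \<in> S \<Longrightarrow> f k = p k - p (\<sigma> k)" "\<And>k. k \<in> S \<Longrightarrow> \<bar>p k\<bar> \<le> c"
proof -
  obtain p q where pq: "\<forall>k\<in>S. f k = p k - q k \<and> \<bar>p k\<bar> \<le> c"
    "add_mset 0 (image_mset p (mset_set S)) = add_mset 0 (image_mset q (mset_set S))"
    using bounded_rearrangement_aux[of S f c 0] assms by auto
  then have "image_mset q (mset_set S) = image_mset p (mset_set S)" by simp
  then obtain \<sigma> where s: "\<sigma> permutes S" "\<forall>x\<in>S. q x = p (\<sigma> x)"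
    using image_mset_eq_implies_permutes[OF S] by blast
  show ?thesis by (rule that[OF s(1)]) (use pq(1) s(2) in auto)
qed

text \<open>A direct sum of two sequences within one index set: the supports stay disjoint, so block
  sizes and block sums simply add.\<close>

definition interleave :: "(nat \<Rightarrow> 'a) \<Rightarrow> (nat \<Rightarrow> 'a) \<Rightarrow> nat \<Rightarrow> 'a" where
  "interleave x y k = (if even k then x (k div 2) else y (k div 2))"

lemma interleave_simps [simp]: "interleave x y (2 * k) = x k" "interleave x y (Suc (2 * k)) = y k"
  by (auto simp: interleave_def)

lemma Collect_interleave: "{k. P (interleave x y k) (interleave x' y' k)}
    = (\<lambda>k. 2 * k) ` {k. P (x k) (x' k)} \<union> (\<lambda>k. Suc (2 * k)) ` {k. P (y k) (y' k)}"
proof (intro set_eqI iffI)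
  fix k assume "k \<in> {k. P (interleave x y k) (interleave x' y' k)}"
  then show "k \<in> (\<lambda>k. 2 * k) ` {k. P (x k) (x' k)} \<union> (\<lambda>k. Suc (2 * k)) ` {k. P (y k) (y' k)}"
    by (cases "even k") (auto elim!: evenE oddE)
qed auto

text \<open>The block map \<open>m\<close> is arbitrary where \<open>z\<close> vanishes. The values
  are real because the rearrangement selects terms by their sign.\<close>

definition block_seq :: "real \<Rightarrow> (nat \<Rightarrow> real) \<Rightarrow> (nat \<Rightarrow> nat) \<Rightarrow> bool" where
  "block_seq C z m \<longleftrightarrow> (\<forall>k. \<bar>z k\<bar> \<le> C * (1/2) ^ m k) \<and>
    (\<forall>n. finite {k. m k = n \<and> z k \<noteq> 0} \<and> real (card {k. m k = n \<and> z k \<noteq> 0}) \<le> C * 2 ^ n)"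

definition block_sum :: "(nat \<Rightarrow> real) \<Rightarrow> (nat \<Rightarrow> nat) \<Rightarrow> nat \<Rightarrow> real" where
  "block_sum z m n = (\<Sum>k | m k = n \<and> z k \<noteq> 0. z k)"

lemma block_seq_nonneg: "block_seq C z m \<Longrightarrow> 0 \<le> C"
proof -
  assume "block_seq C z m"
  then have "real (card {k. m k = 0 \<and> z k \<noteq> 0}) \<le> C * 2 ^ 0" unfolding block_seq_def by blast
  then show ?thesis by simp
qed

lemma block_seq_weak_l1: "block_seq C z m \<Longrightarrow> weak_l1 (\<lambda>k. complex_of_real (z k))"
  by (rule block_weak_l1[of m _ C C]) (auto simp: block_seq_def)

lemma block_seq_scale: "block_seq C z m \<Longrightarrow> block_seq ((\<bar>a\<bar> + 1) * C) (\<lambda>k. a * z k) m"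
  unfolding block_seq_def
proof (intro conjI allI)
  assume *: "(\<forall>k. \<bar>z k\<bar> \<le> C * (1/2) ^ m k) \<and>
    (\<forall>n. finite {k. m k = n \<and> z k \<noteq> 0} \<and> real (card {k. m k = n \<and> z k \<noteq> 0}) \<le> C * 2 ^ n)"
  then have C: "0 \<le> C" using block_seq_nonneg unfolding block_seq_def by blast
  fix k
  have "\<bar>a * z k\<bar> \<le> (\<bar>a\<bar> + 1) * (C * (1/2) ^ m k)"
    unfolding abs_mult using * by (intro mult_mono) auto
  then show "\<bar>a * z k\<bar> \<le> (\<bar>a\<bar> + 1) * C * (1/2) ^ m k" by (simp add: mult.assoc)
next
  assume *: "(\<forall>k. \<bar>z k\<bar> \<le> C * (1/2) ^ m k) \<and>
    (\<forall>n. finite {k. m k = n \<and> z k \<noteq> 0} \<and> real (card {k. m k = n \<and> z k \<noteq> 0}) \<le> C * 2 ^ n)"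
  then have C: "0 \<le> C" using block_seq_nonneg unfolding block_seq_def by blast
  fix n
  have sub: "{k. m k = n \<and> a * z k \<noteq> 0} \<subseteq> {k. m k = n \<and> z k \<noteq> 0}" by auto
  have fin: "finite {k. m k = n \<and> z k \<noteq> 0}" using * by blast
  show "finite {k. m k = n \<and> a * z k \<noteq> 0}" by (rule finite_subset[OF sub fin])
  have "real (card {k. m k = n \<and> a * z k \<noteq> 0}) \<le> C * 2 ^ n"
    using card_mono[OF fin sub] * by (meson of_nat_le_iff order_trans)
  also have "\<dots> \<le> (\<bar>a\<bar> + 1) * (C * 2 ^ n)"
  proof -
    have "0 \<le> \<bar>a\<bar> * (C * 2 ^ n)" using C by simp
    then show ?thesis by (simp add: distrib_right)
  qed
  finally show "real (card {k. m k = n \<and> a * z k \<noteq> 0}) \<le> (\<bar>a\<bar> + 1) * C * 2 ^ n" by (simp add: mult.assoc)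
qed

lemma block_sum_scale: "block_sum (\<lambda>k. a * z k) m n = a * block_sum z m n"
  unfolding block_sum_def by (cases "a = 0") (simp_all add: sum_distrib_left)

lemma block_seq_interleave:
  assumes "block_seq C z m" "block_seq C' z' m'"
  shows "block_seq (C + C') (interleave z z') (interleave m m')"
    and "block_sum (interleave z z') (interleave m m') n = block_sum z m n + block_sum z' m' n"
proof -
  have C: "0 \<le> C" "0 \<le> C'" using assms block_seq_nonneg by blast+
  let ?A = "\<lambda>n. {k. m k = n \<and> z k \<noteq> 0}" and ?B = "\<lambda>n. {k. m' k = n \<and> z' k \<noteq> 0}"
  have fin: "finite (?A n)" "finite (?B n)" for n using assms unfolding block_seq_def by blast+
  have set: "{k. interleave m m' k = n \<and> interleave z z' k \<noteq> 0}
      = (\<lambda>k. 2 * k) ` ?A n \<union> (\<lambda>k. Suc (2 * k)) ` ?B n" for n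
    using Collect_interleave[of "\<lambda>a b. a = n \<and> b \<noteq> 0" m m' z z'] .
  have disj: "(\<lambda>k. 2 * k) ` ?A n \<inter> (\<lambda>k. Suc (2 * k)) ` ?B n = {}" for n by (auto dest: arg_cong[of _ _ even])
  have card: "card {k. interleave m m' k = n \<and> interleave z z' k \<noteq> 0} = card (?A n) + card (?B n)" for n
    unfolding set by (subst card_Un_disjoint[OF _ _ disj]) (auto simp: fin card_image inj_on_def)
  show "block_seq (C + C') (interleave z z') (interleave m m')"
    unfolding block_seq_def
  proof (intro conjI allI)
    fix k
    have p: "0 \<le> (1/2 :: real) ^ j" for j by simp
    have "\<bar>z (k div 2)\<bar> \<le> C * (1/2) ^ m (k div 2)" "\<bar>z' (k div 2)\<bar> \<le> C' * (1/2) ^ m' (k div 2)"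
      using assms unfolding block_seq_def by blast+
    then show "\<bar>interleave z z' k\<bar> \<le> (C + C') * (1/2) ^ interleave m m' k"
      unfolding interleave_def distrib_right
      using mult_nonneg_nonneg[OF C(1) p] mult_nonneg_nonneg[OF C(2) p] by (auto intro: add_increasing add_increasing2)
  next
    fix n
    show "finite {k. interleave m m' k = n \<and> interleave z z' k \<noteq> 0}" unfolding set using fin by simp
    have "real (card (?A n)) \<le> C * 2 ^ n" "real (card (?B n)) \<le> C' * 2 ^ n"
      using assms unfolding block_seq_def by blast+
    then show "real (card {k. interleave m m' k = n \<and> interleave z z' k \<noteq> 0}) \<le> (C + C') * 2 ^ n"
      unfolding card by (simp add: distrib_right)
  qed
  show "block_sum (interleave z z') (interleave m m') n = block_sum z m n + block_sum z' m' n"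
    unfolding block_sum_def set
    by (subst sum.union_disjoint[OF _ _ disj]) (auto simp: fin sum.reindex inj_on_def)
qed

text \<open>Renumbering each block as the next one leaves the sequence, and hence its trace,
  unchanged and costs only a constant factor.\<close>

lemma block_seq_shift: "block_seq C z m \<Longrightarrow> block_seq (2 * C) z (\<lambda>k. Suc (m k))"
  unfolding block_seq_def
proof (intro conjI allI)
  assume *: "(\<forall>k. \<bar>z k\<bar> \<le> C * (1/2) ^ m k) \<and>
    (\<forall>n. finite {k. m k = n \<and> z k \<noteq> 0} \<and> real (card {k. m k = n \<and> z k \<noteq> 0}) \<le> C * 2 ^ n)"
  fix k
  show "\<bar>z k\<bar> \<le> 2 * C * (1/2) ^ Suc (m k)" using * by simp
next
  assume *: "(\<forall>k. \<bar>z k\<bar> \<le> C * (1/2) ^ m k) \<and>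
    (\<forall>n. finite {k. m k = n \<and> z k \<noteq> 0} \<and> real (card {k. m k = n \<and> z k \<noteq> 0}) \<le> C * 2 ^ n)"
  then have C: "0 \<le> C" using block_seq_nonneg unfolding block_seq_def by blast
  fix n
  show "finite {k. Suc (m k) = n \<and> z k \<noteq> 0}" using * by (cases n) auto
  show "real (card {k. Suc (m k) = n \<and> z k \<noteq> 0}) \<le> 2 * C * 2 ^ n"
  proof (cases n)
    case (Suc p)
    have "real (card {k. m k = p \<and> z k \<noteq> 0}) \<le> C * 2 ^ p" using * by blast
    also have "\<dots> \<le> 4 * (C * 2 ^ p)" using C by simp
    finally show ?thesis by (simp add: Suc)
  qed (use C in simp)
qed

lemma block_sum_shift: "block_sum z (\<lambda>k. Suc (m k)) n = (case n of 0 \<Rightarrow> 0 | Suc p \<Rightarrow> block_sum z m p)"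
  unfolding block_sum_def by (cases n) auto

section \<open>The standard dyadic blocks of indices\<close>

lemma dyadic_block: "{k. floor_log (Suc k) = n} = {2 ^ n - 1..<2 ^ Suc n - 1}"
proof (intro set_eqI iffI)
  fix k assume "k \<in> {k. floor_log (Suc k) = n}"
  then show "k \<in> {2 ^ n - 1..<2 ^ Suc n - 1}"
    using floor_log_exp2_le[of "Suc k"] floor_log_exp2_gt[of "Suc k"] by auto
next
  fix k :: nat assume "k \<in> {2 ^ n - 1..<2 ^ Suc n - 1}"
  then have "2 ^ n \<le> Suc k" "Suc k < 2 * 2 ^ n" by auto
  then show "k \<in> {k. floor_log (Suc k) = n}" using floor_log_eqI[of "Suc k" n] by simp
qed

lemma dyadic_block_card: "finite {k. floor_log (Suc k) = n}" "card {k. floor_log (Suc k) = n} = 2 ^ n"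
  unfolding dyadic_block by simp_all

lemma dyadic_block_seq:
  assumes z: "\<And>k. \<bar>z k\<bar> \<le> C * (1/2) ^ floor_log (Suc k)" and C: "1 \<le> C"
  shows "block_seq C z (\<lambda>k. floor_log (Suc k))"
  unfolding block_seq_def
proof (intro conjI allI z)
  fix n
  have sub: "{k. floor_log (Suc k) = n \<and> z k \<noteq> 0} \<subseteq> {k. floor_log (Suc k) = n}" by auto
  show "finite {k. floor_log (Suc k) = n \<and> z k \<noteq> 0}" by (rule finite_subset[OF sub dyadic_block_card(1)])
  have "real (card {k. floor_log (Suc k) = n \<and> z k \<noteq> 0}) \<le> real (2 ^ n)"
    using card_mono[OF dyadic_block_card(1) sub] unfolding dyadic_block_card(2) by (rule of_nat_mono)
  then have "real (card {k. floor_log (Suc k) = n \<and> z k \<noteq> 0}) \<le> 2 ^ n"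
    by (simp only: of_nat_power of_nat_numeral)
  also have "\<dots> \<le> C * 2 ^ n" using C by simp
  finally show "real (card {k. floor_log (Suc k) = n \<and> z k \<noteq> 0}) \<le> C * 2 ^ n" .
qed

lemma block_sum_superset:
  assumes "finite A" "{k. m k = n \<and> z k \<noteq> 0} \<subseteq> A" "\<And>k. k \<in> A \<Longrightarrow> m k = n"
  shows "block_sum z m n = sum z A"
  unfolding block_sum_def by (rule sum.mono_neutral_left) (use assms in auto)

context weak_trace
begin

text \<open>A relation rather than a function, because it is not yet known that the block sums
  determine the trace; this follows from linearity together with
  \<open>block_trace_rel_zero\<close>.\<close>

definition block_trace_rel :: "(nat \<Rightarrow> real) \<Rightarrow> complex \<Rightarrow> bool" where
  "block_trace_rel S v \<longleftrightarrow> (\<exists>C z m. block_seq C z m \<and> block_sum z m = S \<and> tau (\<lambda>k. complex_of_real (z k)) = v)"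

lemma block_trace_relI:
  "block_seq C z m \<Longrightarrow> (\<And>n. block_sum z m n = S n) \<Longrightarrow> tau (\<lambda>k. complex_of_real (z k)) = v \<Longrightarrow> block_trace_rel S v"
  unfolding block_trace_rel_def by (intro exI[of _ C] exI[of _ z] exI[of _ m]) auto

lemma block_trace_rel_scale:
  assumes "block_trace_rel S v"
  shows "block_trace_rel (\<lambda>n. a * S n) (complex_of_real a * v)"
proof -
  obtain C z m where z: "block_seq C z m" "block_sum z m = S" "tau (\<lambda>k. complex_of_real (z k)) = v"
    using assms unfolding block_trace_rel_def by blast
  show ?thesis
    by (rule block_trace_relI[OF block_seq_scale[OF z(1), of a]])
      (use tau_scale[OF block_seq_weak_l1[OF z(1)], of "complex_of_real a"] z in \<open>simp_all add: block_sum_scale\<close>)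
qed

lemma tau_interleave:
  assumes "weak_l1 (interleave y y')"
  shows "tau (interleave y y') = tau y + tau y'"
proof -
  define p where "p k = (if even k then y (k div 2) else 0)" for k
  define p' where "p' k = (if even k then 0 else y' (k div 2))" for k
  have w: "weak_l1 p" "weak_l1 p'"
    by (rule weak_l1_dominated[OF assms, of 1]; simp add: p_def p'_def interleave_def)+
  have "interleave y y' = (\<lambda>k. p k + p' k)" by (auto simp: fun_eq_iff p_def p'_def interleave_def)
  then have "tau (interleave y y') = tau p + tau p'" using tau_add[OF w] by simp
  moreover have "tau (\<lambda>k. p (2 * k)) = tau p"
    by (rule tau_reindex[OF _ _ w(1)]) (auto simp: inj_on_def p_def elim!: evenE)
  moreover have "tau (\<lambda>k. p' (Suc (2 * k))) = tau p'"
    by (rule tau_reindex[OF _ _ w(2)]) (auto simp: inj_on_def p'_def elim!: oddE)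
  ultimately show ?thesis by (simp add: p_def p'_def)
qed

lemma block_trace_rel_add:
  assumes "block_trace_rel S v" "block_trace_rel S' v'"
  shows "block_trace_rel (\<lambda>n. S n + S' n) (v + v')"
proof -
  obtain C z m where z: "block_seq C z m" "block_sum z m = S" "tau (\<lambda>k. complex_of_real (z k)) = v"
    using assms(1) unfolding block_trace_rel_def by blast
  obtain C' z' m' where z': "block_seq C' z' m'" "block_sum z' m' = S'" "tau (\<lambda>k. complex_of_real (z' k)) = v'"
    using assms(2) unfolding block_trace_rel_def by blast
  note i = block_seq_interleave[OF z(1) z'(1)]
  have eq: "(\<lambda>k. complex_of_real (interleave z z' k))
      = interleave (\<lambda>k. complex_of_real (z k)) (\<lambda>k. complex_of_real (z' k))"
    by (auto simp: fun_eq_iff interleave_def)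
  have "tau (\<lambda>k. complex_of_real (interleave z z' k)) = v + v'"
    unfolding eq using tau_interleave[OF block_seq_weak_l1[OF i(1), unfolded eq]] z(3) z'(3) by simp
  then show ?thesis by (intro block_trace_relI[OF i(1)]) (simp_all add: i(2) z(2) z'(2))
qed

text \<open>In each block \<open>z\<close> is the difference of \<open>P\<close> and a rearrangement
  of \<open>P\<close>, where \<open>P\<close> obeys the same size bound as \<open>z\<close>. Hence
  \<open>P\<close> is weakly summable, and a rearrangement-invariant functional does not see the
  difference.\<close>

lemma block_trace_rel_zero:
  assumes "block_trace_rel (\<lambda>_. 0) v"
  shows "v = 0"
proof -
  obtain C z m where z: "block_seq C z m" "block_sum z m = (\<lambda>_. 0)" "tau (\<lambda>k. complex_of_real (z k)) = v"
    using assms unfolding block_trace_rel_def by blast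
  define A where "A n = {k. m k = n \<and> z k \<noteq> 0}" for n
  have C: "0 \<le> C" by (rule block_seq_nonneg[OF z(1)])
  have A: "finite (A n)" "real (card (A n)) \<le> C * 2 ^ n" for n
    using z(1) unfolding block_seq_def A_def by blast+
  have zb: "\<bar>z k\<bar> \<le> C * (1/2) ^ m k" for k using z(1) unfolding block_seq_def by blast
  have s0: "sum z (A n) = 0" for n using z(2) unfolding block_sum_def A_def by metis
  have "\<exists>p \<sigma>. \<sigma> permutes (A n) \<and> (\<forall>k\<in>A n. z k = p k - p (\<sigma> k) \<and> \<bar>p k\<bar> \<le> C * (1/2) ^ n)" for n
  proof -
    obtain p \<sigma> where "\<sigma> permutes (A n)" "\<And>k. k \<in> A n \<Longrightarrow> z k = p k - p (\<sigma> k)" "\<And>k. k \<in> A n \<Longrightarrow> \<bar>p k\<bar> \<le> C * (1/2) ^ n"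
    proof (rule bounded_rearrangement[OF A(1) _ _ s0])
      show "\<bar>z k\<bar> \<le> C * (1/2) ^ n" if "k \<in> A n" for k using zb[of k] that by (simp add: A_def)
      show "0 \<le> C * (1/2) ^ n" using C by simp
    qed (rule that)
    then show ?thesis by (intro exI[of _ p] exI[of _ \<sigma>]) simp
  qed
  then have "\<forall>n. \<exists>p \<sigma>. \<sigma> permutes (A n) \<and> (\<forall>k\<in>A n. z k = p k - p (\<sigma> k) \<and> \<bar>p k\<bar> \<le> C * (1/2) ^ n)" by blast
  then obtain p \<sigma> where ps: "\<And>n. \<sigma> n permutes (A n)"
    "\<And>n k. k \<in> A n \<Longrightarrow> z k = p n k - p n (\<sigma> n k) \<and> \<bar>p n k\<bar> \<le> C * (1/2) ^ n"
    unfolding choice_iff by blast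
  \<comment> \<open>The data of the single blocks are glued; the permutation \<open>\<pi>\<close>
    preserves every block and fixes the indices where \<open>z\<close> vanishes.\<close>
  define P where "P k = (if z k \<noteq> 0 then p (m k) k else 0)" for k
  define \<pi> where "\<pi> k = (if z k \<noteq> 0 then \<sigma> (m k) k else k)" for k
  have pi: "\<pi> k \<in> A (m k)" if "z k \<noteq> 0" for k
    using permutes_in_image[OF ps(1)[of "m k"], of k] that by (simp add: \<pi>_def A_def)
  have pi0: "z (\<pi> k) = 0 \<longleftrightarrow> z k = 0" for k
    using pi[of k] by (cases "z k = 0") (auto simp: \<pi>_def A_def)
  have pim: "m (\<pi> k) = m k" for k
    using pi[of k] by (cases "z k = 0") (auto simp: \<pi>_def A_def)
  have dec: "z k = P k - P (\<pi> k)" for k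
  proof (cases "z k = 0")
    case True
    then show ?thesis by (simp add: P_def \<pi>_def)
  next
    case False
    then have "k \<in> A (m k)" by (simp add: A_def)
    then have "z k = p (m k) k - p (m k) (\<sigma> (m k) k)" using ps(2) by blast
    moreover have "P (\<pi> k) = p (m k) (\<pi> k)" using pi0[of k] pim[of k] False by (simp add: P_def)
    ultimately show ?thesis using False by (simp add: P_def \<pi>_def)
  qed
  have "inj \<pi>"
  proof (rule injI)
    fix k l assume kl: "\<pi> k = \<pi> l"
    then have zz: "z k = 0 \<longleftrightarrow> z l = 0" and mm: "m k = m l" using pi0 pim by metis+
    show "k = l"
    proof (cases "z k = 0")
      case False
      then have "\<sigma> (m k) k = \<sigma> (m k) l" using kl zz mm by (simp add: \<pi>_def)
      then show ?thesis using permutes_inj[OF ps(1)[of "m k"]] by (simp add: inj_eq)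
    qed (use kl zz in \<open>simp add: \<pi>_def\<close>)
  qed
  have "surj \<pi>"
  proof (rule surjI[where f = "\<lambda>k. if z k \<noteq> 0 then inv (\<sigma> (m k)) k else k"])
    fix k
    show "\<pi> (if z k \<noteq> 0 then inv (\<sigma> (m k)) k else k) = k"
    proof (cases "z k = 0")
      case False
      then have "inv (\<sigma> (m k)) k \<in> A (m k)"
        using permutes_in_image[OF permutes_inv[OF ps(1)[of "m k"]], of k] by (simp add: A_def)
      then have "z (inv (\<sigma> (m k)) k) \<noteq> 0" "m (inv (\<sigma> (m k)) k) = m k" by (simp_all add: A_def)
      then show ?thesis using False permutes_inverses(1)[OF ps(1)[of "m k"]] by (simp add: \<pi>_def)
    qed (simp add: \<pi>_def)
  qed
  have Pw: "weak_l1 (\<lambda>k. complex_of_real (P k))"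
  proof (rule block_weak_l1[of m _ C C])
    fix n
    have sub: "{k. m k = n \<and> complex_of_real (P k) \<noteq> 0} \<subseteq> A n" by (auto simp: P_def A_def split: if_splits)
    show "finite {k. m k = n \<and> complex_of_real (P k) \<noteq> 0}" by (rule finite_subset[OF sub A(1)])
    show "real (card {k. m k = n \<and> complex_of_real (P k) \<noteq> 0}) \<le> C * 2 ^ n"
      using card_mono[OF A(1) sub] A(2)[of n] by linarith
  next
    fix k
    show "cmod (complex_of_real (P k)) \<le> C * (1/2) ^ m k"
      using ps(2)[of k "m k"] C by (cases "z k = 0") (auto simp: P_def A_def)
  qed
  have Pw': "weak_l1 (\<lambda>k. (-1) * complex_of_real (P (\<pi> k)))"
    by (rule weak_l1_scale[OF weak_l1_reindex[OF Pw \<open>inj \<pi>\<close>]])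
  have "(\<lambda>k. complex_of_real (z k)) = (\<lambda>k. complex_of_real (P k) + (-1) * complex_of_real (P (\<pi> k)))"
    by (simp add: fun_eq_iff dec)
  then have "v = tau (\<lambda>k. complex_of_real (P k)) + (-1) * tau (\<lambda>k. complex_of_real (P (\<pi> k)))"
    using tau_add[OF Pw Pw'] tau_scale[OF weak_l1_reindex[OF Pw \<open>inj \<pi>\<close>], of "-1"] z(3) by simp
  moreover have "tau (\<lambda>k. complex_of_real (P (\<pi> k))) = tau (\<lambda>k. complex_of_real (P k))"
    by (rule tau_reindex[OF \<open>inj \<pi>\<close> _ Pw]) (use \<open>surj \<pi>\<close> in auto)
  ultimately show ?thesis by simp
qed

text \<open>\<open>T n\<close> is spread evenly over the 2^n indices of the n-th standard block, so
  each entry there has modulus at most K * 2^(-n).\<close>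

lemma block_trace_rel_exists:
  assumes T: "\<And>n. \<bar>T n\<bar> \<le> K"
  obtains v where "block_trace_rel T v"
proof -
  define z where "z k = T (floor_log (Suc k)) * (1/2) ^ floor_log (Suc k)" for k
  have K: "0 \<le> K" using T[of 0] by simp
  have "block_seq (K + 1) z (\<lambda>k. floor_log (Suc k))"
  proof (rule dyadic_block_seq)
    fix k
    show "\<bar>z k\<bar> \<le> (K + 1) * (1/2) ^ floor_log (Suc k)"
      using T[of "floor_log (Suc k)"] unfolding z_def abs_mult by (intro mult_mono) auto
  qed (use K in simp)
  moreover have "block_sum z (\<lambda>k. floor_log (Suc k)) n = T n" for n
  proof -
    have "block_sum z (\<lambda>k. floor_log (Suc k)) n = (\<Sum>k | floor_log (Suc k) = n. z k)"
      by (rule block_sum_superset[OF dyadic_block_card(1)]) auto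
    also have "\<dots> = (\<Sum>k | floor_log (Suc k) = n. T n * (1/2) ^ n)"
      by (intro sum.cong) (auto simp: z_def)
    also have "\<dots> = T n" by (simp add: dyadic_block_card power_divide)
    finally show ?thesis .
  qed
  ultimately show ?thesis using block_trace_relI that by blast
qed

text \<open>If \<open>T\<close> lists the partial sums of \<open>S\<close>, then \<open>S n = T n - T (n - 1)\<close>. A sequence with block sums
  \<open>T\<close> also has, after moving each block to the next one, the block sums \<open>T (n - 1)\<close>.\<close>

theorem block_trace_rel_bounded:
  assumes S: "block_trace_rel S v" and K: "\<And>N. \<bar>\<Sum>n\<le>N. S n\<bar> \<le> K"
  shows "v = 0"
proof -
  define T where "T N = (\<Sum>n\<le>N. S n)" for N
  obtain t where t: "block_trace_rel T t"
    using block_trace_rel_exists[of T K] K unfolding T_def by blast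
  obtain C z m where z: "block_seq C z m" "block_sum z m = T" "tau (\<lambda>k. complex_of_real (z k)) = t"
    using t unfolding block_trace_rel_def by blast
  have t': "block_trace_rel (\<lambda>n. case n of 0 \<Rightarrow> 0 | Suc p \<Rightarrow> T p) t"
    by (rule block_trace_relI[OF block_seq_shift[OF z(1)] _ z(3)]) (simp add: block_sum_shift z(2) split: nat.split)
  have "block_trace_rel (\<lambda>n. S n + ((-1) * T n + (case n of 0 \<Rightarrow> 0 | Suc p \<Rightarrow> T p))) (v + (complex_of_real (-1) * t + t))"
    by (rule block_trace_rel_add[OF S block_trace_rel_add[OF block_trace_rel_scale[OF t] t']])
  moreover have "(\<lambda>n. S n + ((-1) * T n + (case n of 0 \<Rightarrow> 0 | Suc p \<Rightarrow> T p))) = (\<lambda>_. 0)"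
    by (auto simp: fun_eq_iff T_def split: nat.splits)
  ultimately have "block_trace_rel (\<lambda>_. 0) v" by simp
  then show ?thesis by (rule block_trace_rel_zero)
qed

lemma block_trace_rel_harmonic:
  assumes "\<phi> (diag_operator b (\<lambda>k. 1 / (of_nat k + 1))) = 1"
  shows "block_trace_rel (\<lambda>n. \<Sum>k | floor_log (Suc k) = n. 1 / real (Suc k)) 1"
proof (rule block_trace_relI[where z = "\<lambda>k. 1 / real (Suc k)"])
  show "block_seq 1 (\<lambda>k. 1 / real (Suc k)) (\<lambda>k. floor_log (Suc k))"
  proof (rule dyadic_block_seq)
    fix k
    have "(2::real) ^ floor_log (Suc k) \<le> real (Suc k)"
      using floor_log_exp2_le[of "Suc k"] by (metis of_nat_le_iff of_nat_numeral of_nat_power zero_less_Suc)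
    then have "1 / real (Suc k) \<le> 1 / 2 ^ floor_log (Suc k)" by (intro divide_left_mono) auto
    then show "\<bar>1 / real (Suc k)\<bar> \<le> 1 * (1/2) ^ floor_log (Suc k)" by (simp add: power_divide)
  qed simp
  show "block_sum (\<lambda>k. 1 / real (Suc k)) (\<lambda>k. floor_log (Suc k)) n = (\<Sum>k | floor_log (Suc k) = n. 1 / real (Suc k))" for n
    by (rule block_sum_superset[OF dyadic_block_card(1)]) auto
  have "(\<lambda>k. complex_of_real (1 / real (Suc k))) = (\<lambda>k. 1 / (of_nat k + 1))"
    by (simp add: fun_eq_iff add.commute)
  then show "tau (\<lambda>k. complex_of_real (1 / real (Suc k))) = 1"
    using assms by (simp add: tau_def)
qed

end

section \<open>Block sums compute the trace\<close>

context block_trace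
begin

context
  fixes B :: "'h \<Rightarrow> 'h" and \<beta> :: real
  assumes B: "B \<in> bounded_operators" and \<beta>: "\<beta> > 0" "\<And>x. norm (B x) \<le> \<beta> * norm x"
    and sym: "\<And>x y. cinner (B x) y = cinner x (B y)"
begin

definition "B0 = block_diagonal B 0"

lemma B0_bop: "B0 \<in> bounded_operators"
  unfolding B0_def by (rule block_diagonal_bop[OF B \<beta>])

lemma B0_norm: "norm (B0 x) \<le> \<beta> * norm x"
  unfolding B0_def by (rule block_diagonal_norm[OF B \<beta>])

lemma B0_entry: "cinner (B0 (e j)) (e i) = (if n i = n j then cinner (B (e j)) (e i) else 0)"
  unfolding B0_def block_diagonal_entry[OF B \<beta>] by simp

lemma B0_adjoint: "cadjoint B0 = B0"
proof (rule bop_eqI[OF e bop_adjoint[OF B0_bop] B0_bop])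
  fix i j
  have "cinner (cadjoint B0 (e j)) (e i) = cnj (cinner (B0 (e i)) (e j))"
    by (simp add: cinner_adjoint'[OF B0_bop] cinner_cnj)
  also have "\<dots> = cinner (B0 (e j)) (e i)"
    using sym[of "e j" "e i"] by (simp add: B0_entry cinner_cnj)
  finally show "cinner (cadjoint B0 (e j)) (e i) = cinner (B0 (e j)) (e i)" .
qed

lemma B0_sym: "cinner (B0 x) y = cinner x (B0 y)"
  using cinner_adjoint[OF B0_bop] B0_adjoint by simp

lemma block_proj_bop: "block_proj m \<in> bounded_operators"
proof (rule bounded_operatorsI[of _ 1])
  show "norm (block_proj m x) \<le> 1 * norm x" for x
    by (rule onb_norm_le[OF e]) (auto simp: block_proj_coeff)
qed (rule block_proj_add block_proj_scale)+

lemma B0_commutes_R: "B0 (R x) = R (B0 x)"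
proof -
  have "(\<lambda>x. B0 (R x)) = (\<lambda>x. R (B0 x))"
    by (rule bop_eqI[OF e bop_comp[OF B0_bop R_bop] bop_comp[OF R_bop B0_bop]])
      (simp add: R_basis bop_scaleC[OF B0_bop] cinner_scaleC_left R_coeff B0_entry r_def w_def)
  then show ?thesis by (rule fun_cong)
qed

lemma B0_commutes_proj: "B0 (block_proj m x) = block_proj m (B0 x)"
proof -
  have "(\<lambda>x. B0 (block_proj m x)) = (\<lambda>x. block_proj m (B0 x))"
    by (rule bop_eqI[OF e bop_comp[OF B0_bop block_proj_bop] bop_comp[OF block_proj_bop B0_bop]])
      (auto simp: block_proj_basis block_proj_coeff B0_entry bop_0[OF B0_bop])
  then show ?thesis by (rule fun_cong)
qed

lemma W_proj: "W (block_proj (int m) x) = complex_of_real ((1/2) ^ m) *\<^sub>C block_proj (int m) x"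
  by (rule onb_eqI[OF e]) (simp add: W_coeff block_proj_coeff cinner_scaleC_left w_def)

lemma W_commutes_proj: "W (block_proj m x) = block_proj m (W x)"
  by (rule onb_eqI[OF e]) (simp add: W_coeff block_proj_coeff)

text \<open>For small \<open>\<eta>\<close> the operator \<open>W + \<eta> B\<^sub>0 W\<close> is positive and its spectra on different blocks lie in the
  disjoint intervals \<open>[3/4 2\<^sup>-\<^sup>m, 5/4 2\<^sup>-\<^sup>m]\<close>, so every eigenvector belongs to a single block.\<close>

definition "\<eta> = 1 / (4 * \<beta>)"
definition "pert x = W x + complex_of_real \<eta> *\<^sub>C B0 (W x)"
definition "form x = Re (cinner (x + complex_of_real \<eta> *\<^sub>C B0 x) x)"

lemma eta_pos: "\<eta> > 0" using \<beta> by (simp add: \<eta>_def)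

text \<open>The choice of \<open>\<eta>\<close> keeps the perturbation below a quarter of the
  squared norm. A quarter is enough for separation, as 5/4 * 2^(-m-1) is less than 3/4 *
  2^(-m).\<close>

lemma form_bounds: "3/4 * (norm x)\<^sup>2 \<le> form x" "form x \<le> 5/4 * (norm x)\<^sup>2"
proof -
  have "\<bar>Re (cinner (B0 x) x)\<bar> \<le> norm (B0 x) * norm x"
    using abs_Re_le_cmod[of "cinner (B0 x) x"] cinner_Cauchy_Schwarz[of "B0 x" x] by linarith
  also have "\<dots> \<le> \<beta> * norm x * norm x" by (intro mult_right_mono B0_norm) simp
  finally have "\<eta> * \<bar>Re (cinner (B0 x) x)\<bar> \<le> \<eta> * (\<beta> * norm x * norm x)"
    using eta_pos by (intro mult_left_mono) auto
  also have "\<dots> = (norm x)\<^sup>2 / 4" using \<beta> by (simp add: \<eta>_def power2_eq_square)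
  finally have "\<bar>\<eta> * Re (cinner (B0 x) x)\<bar> \<le> (norm x)\<^sup>2 / 4" using eta_pos by (simp add: abs_mult)
  moreover have "form x = (norm x)\<^sup>2 + \<eta> * Re (cinner (B0 x) x)"
    by (simp add: form_def cinner_add_left cinner_scaleC_left cinner_self)
  ultimately show "3/4 * (norm x)\<^sup>2 \<le> form x" "form x \<le> 5/4 * (norm x)\<^sup>2" by linarith+
qed

lemma pert_bop: "pert \<in> bounded_operators"
  unfolding pert_def by (intro bop_plus W_bop bop_scale bop_comp[OF B0_bop W_bop])

lemma pert_weak_L1: "pert \<in> weak_L1"
  unfolding pert_def by (intro weak_L1_add W_weak_L1 weak_L1_scale weak_L1_left[OF W_weak_L1 B0_bop])

text \<open>Because \<open>B0\<close> commutes with \<open>R\<close>, the quadratic form of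
  \<open>pert\<close> at \<open>x\<close> is that of 1 + \<eta> \<open>B0\<close> at
  \<open>R x\<close>, which is bounded below.\<close>

lemma pert_positive: "positive_operator pert"
  unfolding positive_operator_def
proof (intro conjI allI pert_bop)
  fix x
  have *: "cinner (pert x) x = cinner (R x + complex_of_real \<eta> *\<^sub>C B0 (R x)) (R x)"
  proof -
    have "cinner (W x) x = cinner (R x) (R x)"
      unfolding RR[symmetric] by (simp add: cinner_adjoint[OF R_bop] R_adjoint)
    moreover have "cinner (B0 (W x)) x = cinner (B0 (R x)) (R x)"
      unfolding RR[symmetric] B0_commutes_R by (simp add: cinner_adjoint[OF R_bop] R_adjoint)
    ultimately show ?thesis by (simp add: pert_def cinner_add_left cinner_scaleC_left)
  qed
  have "Im (cinner (B0 (R x)) (R x)) = 0"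
  proof -
    have "cinner (B0 (R x)) (R x) = cnj (cinner (B0 (R x)) (R x))"
      using B0_sym[of "R x" "R x"] by (simp only: cinner_cnj)
    from arg_cong[OF this, of Im] show ?thesis by simp
  qed
  then have "Im (cinner (pert x) x) = 0"
    unfolding * by (simp add: cinner_add_left cinner_scaleC_left cinner_self)
  moreover have "Re (cinner (pert x) x) \<ge> 0"
  proof -
    have "Re (cinner (pert x) x) = form (R x)" unfolding * form_def ..
    moreover have "0 \<le> 3/4 * (norm (R x))\<^sup>2" by simp
    ultimately show ?thesis using form_bounds(1)[of "R x"] by linarith
  qed
  ultimately show "cinner (pert x) x \<in> \<real>\<^sub>\<ge>\<^sub>0" by (simp add: complex_nonneg_Reals_iff)
qed

text \<open>The projection of an eigenvector to a block that it meets is again an eigenvector. On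
  the block \<open>W\<close> is a scalar, so the bounds on \<open>form\<close> locate the
  eigenvalue.\<close>

lemma pert_eigen_bounds:
  assumes ev: "pert f = complex_of_real z *\<^sub>C f" and j: "cinner f (e j) \<noteq> 0"
  shows "3/4 * (1/2) ^ n j \<le> z" "z \<le> 5/4 * (1/2) ^ n j"
proof -
  define g where "g = block_proj (int (n j)) f"
  have "cinner g (e j) \<noteq> 0" using j by (simp add: g_def block_proj_coeff)
  then have g: "(norm g)\<^sup>2 > 0" by auto
  have "pert g = block_proj (int (n j)) (pert f)"
    unfolding g_def pert_def W_commutes_proj B0_commutes_proj block_proj_add block_proj_scale ..
  also have "\<dots> = complex_of_real z *\<^sub>C g" unfolding ev block_proj_scale g_def ..
  finally have 1: "pert g = complex_of_real z *\<^sub>C g" .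
  have "pert g = complex_of_real ((1/2) ^ n j) *\<^sub>C (g + complex_of_real \<eta> *\<^sub>C B0 g)"
    unfolding pert_def g_def W_proj bop_scaleC[OF B0_bop] by (simp add: scaleC_add_right scaleC_scaleC mult.commute)
  then have "complex_of_real z * cinner g g = complex_of_real ((1/2) ^ n j) * cinner (g + complex_of_real \<eta> *\<^sub>C B0 g) g"
    using 1 by (metis cinner_scaleC_left)
  then have "Re (complex_of_real z * cinner g g) = Re (complex_of_real ((1/2) ^ n j) * cinner (g + complex_of_real \<eta> *\<^sub>C B0 g) g)"
    by simp
  then have eq: "z * (norm g)\<^sup>2 = (1/2) ^ n j * form g"
    unfolding form_def by (simp add: cinner_self)
  have "(1/2) ^ n j * (3/4 * (norm g)\<^sup>2) \<le> z * (norm g)\<^sup>2" "z * (norm g)\<^sup>2 \<le> (1/2) ^ n j * (5/4 * (norm g)\<^sup>2)"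
    unfolding eq using form_bounds[of g] by (intro mult_left_mono; simp)+
  then have "3/4 * (1/2) ^ n j * (norm g)\<^sup>2 \<le> z * (norm g)\<^sup>2" "z * (norm g)\<^sup>2 \<le> 5/4 * (1/2) ^ n j * (norm g)\<^sup>2"
    by (simp_all add: mult_ac)
  then show "3/4 * (1/2) ^ n j \<le> z" "z \<le> 5/4 * (1/2) ^ n j" using g by (simp_all only: mult_le_cancel_right_pos)
qed

text \<open>Within a block the eigenvalues and the diagonal entries along \<open>e\<close> have the
  same sum: both are iterated sums of \<open>z k\<close> times the squared moduli of the
  coefficients of \<open>f k\<close>, taken in the two orders.\<close>

lemma pert_trace_rel: "block_trace_rel (\<lambda>m. \<Sum>j | n j = m. (1/2) ^ m * (1 + \<eta> * Re (cinner (B (e j)) (e j)))) (\<phi> pert)"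
proof -
  have cp: "compact_operator pert" using pert_weak_L1 by (simp add: weak_L1_def)
  obtain f z K where f: "onb f" and z: "\<And>k. 0 \<le> z k" "\<And>k. z k \<le> K"
    and ev: "\<And>k. pert (f k) = complex_of_real (z k) *\<^sub>C f k"
    and diag: "pert = diag_operator f (\<lambda>k. complex_of_real (z k))"
    and "\<And>\<delta>. \<delta> > 0 \<Longrightarrow> finite {k. z k > \<delta>}"
    by (rule spectral_theorem_positive_compact[OF pert_positive cp], rule that)
  have bd: "cmod (complex_of_real (z k)) \<le> K" for k using z by simp
  have "\<exists>j. cinner (f k) (e j) \<noteq> 0" for k
  proof (rule ccontr)
    assume "\<not> (\<exists>j. cinner (f k) (e j) \<noteq> 0)"
    then have "f k = 0" using e unfolding onb_def by blast
    then show False using onb_norm[OF f, of k] by simp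
  qed
  then obtain J where J: "\<And>k. cinner (f k) (e (J k)) \<noteq> 0" by metis
  define m where "m k = n (J k)" for k
  have zb: "3/4 * (1/2) ^ m k \<le> z k" "z k \<le> 5/4 * (1/2) ^ m k" for k
    using pert_eigen_bounds[OF ev J] unfolding m_def by blast+
  \<comment> \<open>An eigenvector meeting two blocks would have its eigenvalue in two disjoint
    intervals.\<close>
  have block: "n j = m k" if j: "cinner (f k) (e j) \<noteq> 0" for k j
  proof (rule ccontr)
    have half: "(1/2::real) ^ q \<le> (1/2) * (1/2) ^ p" if "p < q" for p q
      using power_decreasing[of "Suc p" q "1/2::real"] that by simp
    have pos: "(1/2::real) ^ p > 0" for p by simp
    note zj = pert_eigen_bounds[OF ev j]
    assume "n j \<noteq> m k"
    then consider "n j < m k" | "m k < n j" by linarith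
    then show False
    proof cases
      case 1
      then show False using half[OF 1] zj zb[of k] pos[of "n j"] by linarith
    next
      case 2
      then show False using half[OF 2] zj zb[of k] pos[of "m k"] by linarith
    qed
  qed
  have zpos: "z k > 0" for k
  proof -
    have "0 < 3/4 * (1/2::real) ^ m k" by simp
    then show ?thesis using zb(1)[of k] by linarith
  qed
  have nf: "(\<Sum>j | n j = m k. (cmod (cinner (f k) (e j)))\<^sup>2) = 1" for k
  proof -
    have "(\<lambda>j. (cmod (cinner (f k) (e j)))\<^sup>2) sums 1"
      using onb_Parseval[OF e, of "f k"] onb_norm[OF f, of k] by simp
    moreover have "(\<lambda>j. (cmod (cinner (f k) (e j)))\<^sup>2) sums (\<Sum>j | n j = m k. (cmod (cinner (f k) (e j)))\<^sup>2)"
      by (rule sums_finite[OF fin_block]) (use block in auto)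
    ultimately show ?thesis by (rule sums_unique2[symmetric])
  qed
  \<comment> \<open>Double counting: each \<open>f k\<close> of the block has total mass 1 on the
    vectors \<open>e j\<close> of the same block, and each \<open>e j\<close> receives at most 1 by
    Bessel's inequality.\<close>
  have card_le: "card G \<le> card {j. n j = p}" if G: "G \<subseteq> {k. m k = p}" "finite G" for G p
  proof -
    have "real (card G) = (\<Sum>k\<in>G. \<Sum>j | n j = p. (cmod (cinner (f k) (e j)))\<^sup>2)"
    proof -
      have "(\<Sum>j | n j = p. (cmod (cinner (f k) (e j)))\<^sup>2) = 1" if "k \<in> G" for k
        using nf[of k] G that by auto
      then show ?thesis by simp
    qed
    also have "\<dots> = (\<Sum>j | n j = p. \<Sum>k\<in>G. (cmod (cinner (e j) (f k)))\<^sup>2)"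
      unfolding cmod_cinner_commute[of "f _"] by (rule sum.swap)
    also have "\<dots> \<le> (\<Sum>j | n j = p. 1)"
    proof (rule sum_mono)
      fix j
      show "(\<Sum>k\<in>G. (cmod (cinner (e j) (f k)))\<^sup>2) \<le> 1"
        using Bessel_finite[OF onb_orthonormal[OF f] G(2), of "e j"] onb_norm[OF e, of j] by simp
    qed
    finally show ?thesis by simp
  qed
  have fin: "finite {k. m k = p} \<and> card {k. m k = p} \<le> card {j. n j = p}" for p
    by (rule finite_if_finite_subsets_card_bdd) (rule card_le)
  have sup: "{k. m k = p \<and> z k \<noteq> 0} = {k. m k = p}" for p
    using zpos by (auto simp: less_imp_neq[symmetric])
  have seq: "block_seq (C + 2) z m"
    unfolding block_seq_def sup
  proof (intro conjI allI)
    fix k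
    have C: "0 \<le> C" using card_block[of 0] by simp
    have "z k \<le> 5/4 * (1/2) ^ m k" by (rule zb)
    also have "\<dots> \<le> (C + 2) * (1/2) ^ m k" using C by (intro mult_right_mono) auto
    finally show "\<bar>z k\<bar> \<le> (C + 2) * (1/2) ^ m k" using zpos[of k] by simp
  next
    fix p
    show "finite {k. m k = p}" using fin by blast
    have "real (card {k. m k = p}) \<le> C * 2 ^ p" using fin[of p] card_block[of p] by linarith
    also have "\<dots> \<le> (C + 2) * 2 ^ p" by (intro mult_right_mono) auto
    finally show "real (card {k. m k = p}) \<le> (C + 2) * 2 ^ p" .
  qed
  have bs: "block_sum z m p = (\<Sum>j | n j = p. (1/2) ^ p * (1 + \<eta> * Re (cinner (B (e j)) (e j))))" for p
  proof -
    have diag_form: "Re (cinner (pert (e j)) (e j)) = (\<Sum>k | m k = p. z k * (cmod (cinner (f k) (e j)))\<^sup>2)" if j: "n j = p" for j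
    proof -
      have "(\<lambda>k. complex_of_real (z k) * cinner (e j) (f k) * cinner (f k) (e j)) sums cinner (pert (e j)) (e j)"
        unfolding diag
        by (rule diag_operator_adjoint_aux[where y = "\<lambda>k. complex_of_real (z k)", OF onb_orthonormal[OF f, of UNIV] _ bd]) auto
      moreover have "complex_of_real (z k) * cinner (e j) (f k) * cinner (f k) (e j)
          = complex_of_real (z k * (cmod (cinner (f k) (e j)))\<^sup>2)" for k
      proof -
        have "cinner (e j) (f k) * cinner (f k) (e j) = complex_of_real ((cmod (cinner (f k) (e j)))\<^sup>2)"
          by (simp only: complex_norm_square cinner_cnj mult.commute)
        then show ?thesis by (simp only: of_real_mult mult.assoc)
      qed
      ultimately have "(\<lambda>k. complex_of_real (z k * (cmod (cinner (f k) (e j)))\<^sup>2)) sums cinner (pert (e j)) (e j)"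
        by (simp only:)
      from sums_Re[OF this]
      have "(\<lambda>k. z k * (cmod (cinner (f k) (e j)))\<^sup>2) sums Re (cinner (pert (e j)) (e j))"
        by (simp only: Re_complex_of_real)
      moreover have "(\<lambda>k. z k * (cmod (cinner (f k) (e j)))\<^sup>2) sums (\<Sum>k | m k = p. z k * (cmod (cinner (f k) (e j)))\<^sup>2)"
        by (rule sums_finite) (use fin block j in auto)
      ultimately show ?thesis by (rule sums_unique2)
    qed
    have "block_sum z m p = (\<Sum>k | m k = p. z k * (\<Sum>j | n j = p. (cmod (cinner (f k) (e j)))\<^sup>2))"
      unfolding block_sum_def sup
    proof (rule sum.cong[OF refl])
      fix k assume "k \<in> {k. m k = p}"
      then show "z k = z k * (\<Sum>j | n j = p. (cmod (cinner (f k) (e j)))\<^sup>2)" using nf[of k] by auto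
    qed
    also have "\<dots> = (\<Sum>k | m k = p. \<Sum>j | n j = p. z k * (cmod (cinner (f k) (e j)))\<^sup>2)"
      by (simp only: sum_distrib_left)
    also have "\<dots> = (\<Sum>j | n j = p. \<Sum>k | m k = p. z k * (cmod (cinner (f k) (e j)))\<^sup>2)"
      by (rule sum.swap)
    also have "\<dots> = (\<Sum>j | n j = p. (1/2) ^ p * (1 + \<eta> * Re (cinner (B (e j)) (e j))))"
    proof (rule sum.cong[OF refl])
      fix j assume "j \<in> {j. n j = p}"
      then have j: "n j = p" by simp
      have "cinner (pert (e j)) (e j) = complex_of_real ((1/2) ^ p) * (1 + complex_of_real \<eta> * cinner (B (e j)) (e j))"
        by (simp add: pert_def W_basis bop_scaleC[OF B0_bop] cinner_add_left cinner_scaleC_left onb_cinner[OF e]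
            B0_entry w_def j algebra_simps)
      moreover have "Re (complex_of_real a * (1 + complex_of_real \<eta> * x)) = a * (1 + \<eta> * Re x)" for a x
        by simp
      ultimately have "Re (cinner (pert (e j)) (e j)) = (1/2) ^ p * (1 + \<eta> * Re (cinner (B (e j)) (e j)))"
        by (simp only:)
      then show "(\<Sum>k | m k = p. z k * (cmod (cinner (f k) (e j)))\<^sup>2) = (1/2) ^ p * (1 + \<eta> * Re (cinner (B (e j)) (e j)))"
        using diag_form[OF j] by simp
    qed
    finally show ?thesis .
  qed
  have "\<phi> pert = tau (\<lambda>k. complex_of_real (z k))"
    unfolding diag
    by (rule phi_diag[where y = "\<lambda>k. complex_of_real (z k)", OF onb_orthonormal[OF f, of UNIV] _ block_seq_weak_l1[OF seq]]) auto
  then show ?thesis by (intro block_trace_relI[OF seq bs]) simp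
qed

lemma W_trace_rel: "block_trace_rel (\<lambda>m. \<Sum>j | n j = m. (1/2) ^ m) (\<phi> W)"
proof (rule block_trace_relI[where z = w and m = n])
  have sup: "{j. n j = m \<and> w j \<noteq> 0} = {j. n j = m}" for m using w_pos by (auto simp: less_imp_neq[symmetric])
  have C: "0 \<le> C" using card_block[of 0] by simp
  show "block_seq (C + 1) w n"
    unfolding block_seq_def sup
  proof (intro conjI allI fin_block)
    show "\<bar>w k\<bar> \<le> (C + 1) * (1/2) ^ n k" for k using C by (simp add: w_def distrib_right)
    show "real (card {j. n j = m}) \<le> (C + 1) * 2 ^ m" for m
      using card_block[of m] by (simp add: distrib_right) (smt (verit) zero_le_power)
  qed
  show "block_sum w n m = (\<Sum>j | n j = m. (1/2) ^ m)" for m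
    unfolding block_sum_def sup by (intro sum.cong) (auto simp: w_def)
  show "tau (\<lambda>k. complex_of_real (w k)) = \<phi> W"
    unfolding W_def by (rule phi_diag[OF onb_orthonormal[OF e, of UNIV] _ weak_l1_w, symmetric]) auto
qed

text \<open>Subtracting the relation for \<open>W\<close> from that for \<open>pert\<close> and
  dividing by \<open>\<eta>\<close> isolates the contribution of \<open>B\<close>; block sums and
  traces are both linear.\<close>

theorem symmetric_trace_rel:
  "block_trace_rel (\<lambda>m. \<Sum>j | n j = m. (1/2) ^ m * Re (cinner (B (e j)) (e j))) (\<phi> (\<lambda>x. B (W x)))"
proof -
  have "\<phi> pert = \<phi> W + complex_of_real \<eta> * \<phi> (\<lambda>x. B0 (W x))"
  proof -
    have m: "(\<lambda>x. B0 (W x)) \<in> weak_L1" by (rule weak_L1_left[OF W_weak_L1 B0_bop])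
    have "pert = (\<lambda>x. W x + complex_of_real \<eta> *\<^sub>C B0 (W x))" by (simp add: fun_eq_iff pert_def)
    then show ?thesis using phi_add[OF W_weak_L1 weak_L1_scale[OF m]] phi_scale[OF m] by simp
  qed
  then have "complex_of_real (1 / \<eta>) * (\<phi> pert + complex_of_real (-1) * \<phi> W) = \<phi> (\<lambda>x. B0 (W x))"
    using eta_pos by simp
  then have v: "complex_of_real (1 / \<eta>) * (\<phi> pert + complex_of_real (-1) * \<phi> W) = \<phi> (\<lambda>x. B (W x))"
    unfolding phi_block_diagonal[OF B \<beta>] B0_def .
  have "(\<lambda>m. (1 / \<eta>) * ((\<Sum>j | n j = m. (1/2) ^ m * (1 + \<eta> * Re (cinner (B (e j)) (e j)))) + (-1) * (\<Sum>j | n j = m. (1/2) ^ m)))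
    = (\<lambda>m. \<Sum>j | n j = m. (1/2) ^ m * Re (cinner (B (e j)) (e j)))"
  proof
    fix m
    have "(\<Sum>j | n j = m. (1/2) ^ m * (1 + \<eta> * Re (cinner (B (e j)) (e j))))
      = (\<Sum>j | n j = m. (1/2) ^ m) + \<eta> * (\<Sum>j | n j = m. (1/2) ^ m * Re (cinner (B (e j)) (e j)))"
      unfolding sum_distrib_left sum.distrib[symmetric] by (intro sum.cong) (auto simp: algebra_simps)
    then show "(1 / \<eta>) * ((\<Sum>j | n j = m. (1/2) ^ m * (1 + \<eta> * Re (cinner (B (e j)) (e j)))) + (-1) * (\<Sum>j | n j = m. (1/2) ^ m))
      = (\<Sum>j | n j = m. (1/2) ^ m * Re (cinner (B (e j)) (e j)))" using eta_pos by simp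
  qed
  then show ?thesis
    using block_trace_rel_scale[OF block_trace_rel_add[OF pert_trace_rel block_trace_rel_scale[OF W_trace_rel, of "-1"]], of "1 / \<eta>"]
    unfolding v by simp
qed

end

end

section \<open>The analytic part: partial sums and the zeta function\<close>

section \<open>A Tauberian theorem for dyadic Dirichlet series\<close>

lemma two_powr_diff_ge: "(2 :: real) powr x - 1 \<ge> x * ln 2"
proof -
  have "1 + x * ln 2 \<le> 2 powr x" using exp_ge_add_one_self[of "x * ln 2"] by (simp add: powr_def)
  then show ?thesis by linarith
qed

text \<open>Newman's contour argument in the form of M. Riesz: on the circle of radius \<open>R\<close> the factor
  \<open>1 + z\<^sup>2 / R\<^sup>2\<close> has modulus \<open>2 |Re z| / R\<close>, which compensates the bounds \<open>1 / |Re z|\<close> for the tail of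
  the series (on the right) and for its partial sums (on the left).\<close>

theorem Riesz_Newman_bounded_partial_sums:
  fixes H :: "nat \<Rightarrow> complex \<Rightarrow> complex"
  assumes R: "0 < R" and K: "0 \<le> K"
    and hol: "\<And>n. H n holomorphic_on UNIV"
    and bound: "\<And>n z. cmod z \<le> R \<Longrightarrow> cmod (H n z) \<le> K * (2 powr (- Re z)) ^ n"
    and G: "G holomorphic_on S" "open S" "cball 0 R \<subseteq> S"
    and sums: "\<And>z. cmod z \<le> R \<Longrightarrow> 0 < Re z \<Longrightarrow> (\<lambda>n. H n z) sums G z"
  obtains B where "\<And>N. cmod (\<Sum>n\<le>N. H n 0) \<le> B"
proof -
  have contG: "continuous_on (cball 0 R) G"
    using G by (meson holomorphic_on_imp_continuous_on holomorphic_on_subset)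
  obtain M where M: "\<And>z. cmod z \<le> R \<Longrightarrow> cmod (G z) \<le> M"
  proof -
    have "compact (G ` cball 0 R)" by (rule compact_continuous_image[OF contG compact_cball])
    then have "bounded (G ` cball 0 R)" by (rule compact_imp_bounded)
    then obtain M where "\<forall>y\<in>G ` cball 0 R. cmod y \<le> M" unfolding bounded_iff by blast
    then have "cmod (G z) \<le> M" if "cmod z \<le> R" for z
      by (rule bspec) (use that in \<open>simp add: dist_norm\<close>)
    then show ?thesis by (rule that)
  qed
  have M0: "0 \<le> M" using order_trans[OF norm_ge_zero M[of 0]] R by simp
  define F where "F N z = (\<Sum>n\<le>N. H n z)" for N z
  \<comment> \<open>The first summand covers the tail of the series on the right half of the circle
    and its partial sums on the left half, the second covers \<open>G\<close> on the left
    half.\<close>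
  define B where "B = 2 * K * 2 powr R / (R * ln 2) + 2 * M"
  have main: "cmod (G 0 - F N 0) \<le> B" for N
  proof -
    \<comment> \<open>The exponential is 2^(N z). It compensates the decay of the tail to the right
      and the growth of the partial sums to the left, and equals 1 at the centre.\<close>
    define h where "h z = (G z - F N z) * exp (of_real (real N * ln 2) * z) * (1 + z\<^sup>2 / of_real (R\<^sup>2))" for z
    have Fhol: "F N holomorphic_on A" for A
      unfolding F_def using hol by (intro holomorphic_intros) (auto intro: holomorphic_on_subset)
    have hhol: "h holomorphic_on S"
      unfolding h_def using R by (intro holomorphic_intros G Fhol) auto
    \<comment> \<open>Since \<open>h\<close> is holomorphic near the whole closed disc and takes the
      value \<open>G 0 - F N 0\<close> at the centre, the maximum principle needs only a bound on
      the circle.\<close>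
    have "cmod (h 0) \<le> B"
    proof (rule maximum_modulus_frontier[of h "cball 0 R"])
      show "h holomorphic_on interior (cball 0 R)"
        by (rule holomorphic_on_subset[OF hhol]) (use G(3) in auto)
      show "continuous_on (closure (cball 0 R)) h"
        using holomorphic_on_imp_continuous_on[OF holomorphic_on_subset[OF hhol G(3)]] by simp
      fix z :: complex assume "z \<in> frontier (cball 0 R)"
      then have z: "cmod z = R" by (simp add: frontier_cball dist_norm)
      define x where "x = Re z"
      define E where "E = 2 powr (real N * x)"
      have E: "cmod (exp (of_real (real N * ln 2) * z)) = E"
        by (simp add: E_def x_def powr_def mult_ac)
      have xR: "\<bar>x\<bar> \<le> R" using abs_Re_le_cmod[of z] z by (simp add: x_def)
      \<comment> \<open>On the circle \<open>z * cnj z\<close> is the squared radius, so the weight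
        is z (z + cnj z) divided by it.\<close>
      have wt: "cmod (1 + z\<^sup>2 / of_real (R\<^sup>2)) = 2 * \<bar>x\<bar> / R"
      proof -
        have "z * cnj z = of_real (R\<^sup>2)" using complex_norm_square[of z] z by simp
        then have "1 + z\<^sup>2 / of_real (R\<^sup>2) = z * (z + cnj z) / of_real (R\<^sup>2)"
          using R by (simp add: field_simps power2_eq_square del: of_real_power)
        also have "z + cnj z = of_real (2 * x)" by (simp add: complex_add_cnj x_def)
        finally show ?thesis using R z by (simp add: norm_mult norm_divide power2_eq_square)
      qed
      have hz: "cmod (h z) = cmod (G z - F N z) * E * (2 * \<bar>x\<bar> / R)"
        unfolding h_def norm_mult E wt ..
      consider "x = 0" | "x > 0" | "x < 0" by linarith
      then show "cmod (h z) \<le> B"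
      proof cases
        case 1
        then show ?thesis unfolding hz B_def using K M0 R by simp
      next
        case 2
        define u where "u = 2 powr (- x)"
        have u: "0 < u" "u < 1" using 2 by (auto simp: u_def powr_less_one)
        have Eu: "E * u ^ N = 1"
          by (simp add: E_def u_def powr_power powr_add[symmetric])
        have ux: "u * (2 powr x) = 1" by (simp add: u_def powr_add[symmetric])
        have bH: "cmod (H n z) \<le> K * u ^ n" for n using bound[of z n] z by (simp add: u_def x_def)
        have tail: "(\<lambda>n. H (n + Suc N) z) sums (G z - F N z)"
          unfolding F_def lessThan_Suc_atMost[symmetric]
          by (rule sums_split_initial_segment[OF sums]) (use z 2 in \<open>auto simp: x_def\<close>)
        have gs: "(\<lambda>n. K * u ^ Suc N * u ^ n) sums (K * u ^ Suc N * (1 / (1 - u)))"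
          by (intro sums_mult geometric_sums) (use u in auto)
        have "cmod (G z - F N z) \<le> K * u ^ Suc N * (1 / (1 - u))"
          unfolding sums_unique[OF tail] sums_unique[OF gs]
        proof (rule norm_suminf_le)
          show "cmod (H (n + Suc N) z) \<le> K * u ^ Suc N * u ^ n" for n
            using bH[of "n + Suc N"] by (simp add: power_add mult_ac)
        qed (rule sums_summable[OF gs])
        then have "cmod (G z - F N z) * E \<le> K * u ^ Suc N * (1 / (1 - u)) * E"
          by (rule mult_right_mono) (simp add: E_def)
        also have "\<dots> = K * (u / (1 - u)) * (E * u ^ N)" by (simp add: mult_ac)
        also have "u / (1 - u) = 1 / (2 powr x - 1)"
        proof -
          have *: "1 - u = u * (2 powr x - 1)" using ux by (simp add: algebra_simps)
          show ?thesis unfolding * using u by simp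
        qed
        also have "K * (1 / (2 powr x - 1)) * (E * u ^ N) \<le> K * (1 / (x * ln 2))"
          unfolding Eu using two_powr_diff_ge[of x] 2 K by (auto intro!: mult_left_mono divide_left_mono mult_pos_pos)
        finally have "cmod (G z - F N z) * E * (2 * x / R) \<le> K * (1 / (x * ln 2)) * (2 * x / R)"
          by (rule mult_right_mono) (use 2 R in simp)
        also have "\<dots> = 2 * K / (R * ln 2)" using 2 R by (simp add: field_simps)
        also have "\<dots> \<le> 2 * K * 2 powr R / (R * ln 2)"
        proof -
          have "1 \<le> 2 powr R" using R by (simp add: ge_one_powr_ge_zero)
          then have "2 * K * 1 \<le> 2 * K * 2 powr R" using K by (intro mult_left_mono) auto
          then show ?thesis using R by (intro divide_right_mono) auto
        qed
        finally show ?thesis unfolding hz B_def using 2 M0 by simp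
      next
        \<comment> \<open>To the left no convergence of the series is known, so \<open>G\<close> and
          the partial sum are estimated separately.\<close>
        case 3
        have wpos: "0 \<le> 2 * - x / R" using 3 R by (intro divide_nonneg_pos) auto
        define v where "v = 2 powr (- x)"
        have v: "1 < v" using 3 by (simp add: v_def)
        have Ev: "E * v ^ N = 1" by (simp add: E_def v_def powr_power powr_add[symmetric])
        have E1: "0 < E" "E \<le> 1"
        proof -
          show "0 < E" by (simp add: E_def)
          have "real N * x \<le> 0" using 3 by (simp add: mult_nonneg_nonpos)
          then show "E \<le> 1" unfolding E_def using powr_mono[of "real N * x" 0 2] by simp
        qed
        have "cmod (F N z) \<le> (\<Sum>n\<le>N. K * v ^ n)"
          unfolding F_def by (rule sum_norm_le) (use bound[of z] z in \<open>simp add: v_def x_def\<close>)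
        also have "\<dots> = K * ((v ^ Suc N - 1) / (v - 1))"
          using v geometric_sum[of v "Suc N"] by (simp add: sum_distrib_left[symmetric] lessThan_Suc_atMost)
        also have "\<dots> \<le> K * (v ^ Suc N / (v - 1))"
          using v K by (intro mult_left_mono divide_right_mono) auto
        finally have "cmod (F N z) * E \<le> K * (v ^ Suc N / (v - 1)) * E"
          by (rule mult_right_mono) (use E1 in simp)
        also have "\<dots> = K * (v / (v - 1)) * (E * v ^ N)" by (simp add: mult_ac)
        also have "\<dots> \<le> K * (2 powr R / (- x * ln 2))"
        proof -
          have "v \<le> 2 powr R" unfolding v_def using xR 3 by (intro powr_mono) auto
          moreover have "- x * ln 2 \<le> v - 1" unfolding v_def by (rule two_powr_diff_ge)
          moreover have "0 < - x * ln 2" using 3 by (simp add: mult_neg_pos)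
          ultimately have "v / (v - 1) \<le> 2 powr R / (- x * ln 2)" using v by (intro frac_le) auto
          from mult_left_mono[OF this K] show ?thesis unfolding Ev by (simp only: mult_1_right)
        qed
        finally have "cmod (F N z) * E * (2 * - x / R) \<le> K * (2 powr R / (- x * ln 2)) * (2 * - x / R)"
          by (rule mult_right_mono) (rule wpos)
        also have "\<dots> = 2 * K * 2 powr R / (R * ln 2)" using 3 R by (simp add: field_simps)
        finally have 1: "cmod (F N z) * E * (2 * - x / R) \<le> 2 * K * 2 powr R / (R * ln 2)" .
        have "cmod (G z) * E * (2 * - x / R) \<le> M * 1 * 2"
        proof (intro mult_mono)
          show "2 * - x / R \<le> 2" using 3 xR R by (simp add: field_simps)
        qed (use M[of z] z E1 M0 wpos in auto)
        then have "(cmod (G z) + cmod (F N z)) * E * (2 * - x / R) \<le> B"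
          using 1 unfolding B_def distrib_right by linarith
        moreover have "cmod (G z - F N z) * E * (2 * - x / R) \<le> (cmod (G z) + cmod (F N z)) * E * (2 * - x / R)"
          using E1 by (intro mult_right_mono norm_triangle_ineq4 wpos) simp
        ultimately show ?thesis unfolding hz using 3 by simp
      qed
    qed (use R in auto)
    then show ?thesis by (simp add: h_def)
  qed
  show ?thesis
  proof (rule that[of "M + B"])
    fix N
    have "F N 0 = G 0 - (G 0 - F N 0)" by simp
    then have "cmod (F N 0) \<le> cmod (G 0) + cmod (G 0 - F N 0)" by (metis norm_triangle_ineq4)
    then show "cmod (\<Sum>n\<le>N. H n 0) \<le> M + B" using main[of N] M[of 0] R unfolding F_def by simp
  qed
qed

section \<open>The zeta function of a diagonal operator\<close>

lemma onb_square_has_sum: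
  assumes "onb f" shows "((\<lambda>i. (cmod (cinner x (f i)))\<^sup>2) has_sum (norm x)\<^sup>2) UNIV"
  by (rule sums_nonneg_imp_has_sum[OF onb_Parseval[OF assms]]) simp

lemma onb_product_abs_summable:
  fixes x y :: "'h::complex_hilbert"
  assumes f: "onb f"
  shows "(\<lambda>i. cmod (cinner x (f i)) * cmod (cinner (f i) y)) summable_on UNIV"
    and "(\<Sum>\<^sub>\<infinity>i. cmod (cinner x (f i)) * cmod (cinner (f i) y)) \<le> ((norm x)\<^sup>2 + (norm y)\<^sup>2) / 2"
proof -
  let ?g = "\<lambda>i. ((cmod (cinner x (f i)))\<^sup>2 + (cmod (cinner y (f i)))\<^sup>2) * (1/2)"
  have g: "(?g has_sum ((norm x)\<^sup>2 + (norm y)\<^sup>2) * (1/2)) UNIV"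
    by (intro has_sum_cmult_left has_sum_add onb_square_has_sum f)
  have le: "cmod (cinner x (f i)) * cmod (cinner (f i) y) \<le> ?g i" for i
    using sum_squares_bound[of "cmod (cinner x (f i))" "cmod (cinner (f i) y)"]
    by (simp add: cmod_cinner_commute[of y] field_simps)
  show s: "(\<lambda>i. cmod (cinner x (f i)) * cmod (cinner (f i) y)) summable_on UNIV"
    by (rule summable_on_comparison_test[OF has_sum_imp_summable[OF g]]) (use le in auto)
  have "(\<Sum>\<^sub>\<infinity>i. cmod (cinner x (f i)) * cmod (cinner (f i) y)) \<le> (\<Sum>\<^sub>\<infinity>i. ?g i)"
    by (rule infsum_mono[OF s has_sum_imp_summable[OF g] le])
  then show "(\<Sum>\<^sub>\<infinity>i. cmod (cinner x (f i)) * cmod (cinner (f i) y)) \<le> ((norm x)\<^sup>2 + (norm y)\<^sup>2) / 2"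
    using infsumI[OF g] by simp
qed

lemma onb_product_has_sum:
  assumes f: "onb f"
  shows "((\<lambda>i. cinner x (f i) * cinner (f i) y) has_sum cinner x y) UNIV"
proof -
  have "(\<lambda>i. cinner x (f i) * cinner (f i) y) summable_on UNIV"
    by (rule Infinite_Sum.abs_summable_summable) (use onb_product_abs_summable(1)[OF f] in \<open>simp add: norm_mult\<close>)
  then obtain s where s: "((\<lambda>i. cinner x (f i) * cinner (f i) y) has_sum s) UNIV"
    using summable_on_def by blast
  from sums_unique2[OF has_sum_imp_sums[OF s] onb_cinner_sums[OF f]] s show ?thesis by simp
qed

context separable_hilbert
begin

text \<open>The diagonal sum along \<open>f\<close> and the sum over the eigenbasis \<open>e\<close>
  are the two iterated sums of one double series. It converges absolutely, because for fixed
  \<open>k\<close> the sum of the moduli over \<open>i\<close> is at most \<open>l k\<close> times a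
  constant.\<close>

lemma trace_diag_has_sum:
  fixes e f :: "nat \<Rightarrow> 'h"
  assumes A: "A \<in> bounded_operators" and e: "onb e" and f: "onb f"
    and l: "l summable_on UNIV" "\<And>k. l k \<ge> 0" and y: "\<And>k. cmod (y k) = l k"
  shows "((\<lambda>i. cinner (A (diag_operator e y (f i))) (f i)) has_sum (\<Sum>\<^sub>\<infinity>k. y k * cinner (A (e k)) (e k))) UNIV"
proof -
  obtain \<alpha> where \<alpha>: "\<alpha> > 0" "\<And>x. norm (A x) \<le> \<alpha> * norm x" using bop_bound[OF A] by blast
  obtain L where L: "\<And>k. l k \<le> L"
  proof -
    have "l k \<le> infsum l UNIV" for k
      using finite_sum_le_infsum[OF l(1), of "{k}"] l(2) by simp
    then show ?thesis using that by blast
  qed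
  have yL: "cmod (y k) \<le> L" for k using y L by simp
  let ?T = "\<lambda>(k, i). y k * (cinner (A (e k)) (f i) * cinner (f i) (e k))"
  have ns: "norm (?T (k, i)) = l k * (cmod (cinner (A (e k)) (f i)) * cmod (cinner (f i) (e k)))" for k i
    by (simp add: norm_mult y)
  have abs: "(\<lambda>p. norm (?T p)) summable_on (UNIV \<times> UNIV)"
  proof (rule Infinite_Sum.abs_summable_on_Sigma_iff[THEN iffD2], intro conjI ballI)
    fix k :: nat
    show "(\<lambda>i. norm (?T (k, i))) summable_on UNIV"
      unfolding ns by (rule summable_on_cmult_right[OF onb_product_abs_summable(1)[OF f]])
  next
    have nn: "0 \<le> (\<Sum>\<^sub>\<infinity>i. norm (?T (k, i)))" for k by (rule infsum_nonneg) simp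
    have "(\<Sum>\<^sub>\<infinity>i. norm (?T (k, i))) \<le> l k * ((\<alpha>\<^sup>2 + 1) / 2)" for k
    proof -
      have "(\<Sum>\<^sub>\<infinity>i. norm (?T (k, i))) = l k * (\<Sum>\<^sub>\<infinity>i. cmod (cinner (A (e k)) (f i)) * cmod (cinner (f i) (e k)))"
        unfolding ns by (rule infsum_cmult_right) (simp add: onb_product_abs_summable(1)[OF f])
      also have "\<dots> \<le> l k * (((norm (A (e k)))\<^sup>2 + (norm (e k))\<^sup>2) / 2)"
        by (intro mult_left_mono onb_product_abs_summable(2)[OF f] l)
      also have "\<dots> \<le> l k * ((\<alpha>\<^sup>2 + 1) / 2)"
        using \<alpha>(2)[of "e k"] onb_norm[OF e, of k] by (intro mult_left_mono l(2) divide_right_mono add_mono power_mono) auto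
      finally show ?thesis .
    qed
    then have "(\<lambda>k. \<Sum>\<^sub>\<infinity>i. norm (?T (k, i))) summable_on UNIV"
      by (intro summable_on_comparison_test[OF summable_on_cmult_left[OF l(1)]] nn)
    then show "(\<lambda>k. norm (\<Sum>\<^sub>\<infinity>i. norm (?T (k, i)))) summable_on UNIV"
      using nn by (simp only: real_norm_def abs_of_nonneg)
  qed
  then obtain t where t: "(?T has_sum t) (UNIV \<times> UNIV)"
    using Infinite_Sum.abs_summable_summable summable_on_def by blast
  have rows: "((\<lambda>i. ?T (k, i)) has_sum y k * cinner (A (e k)) (e k)) UNIV" for k
    unfolding prod.case by (rule has_sum_cmult_right[OF onb_product_has_sum[OF f]])
  have tk: "((\<lambda>k. y k * cinner (A (e k)) (e k)) has_sum t) UNIV"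
    by (rule has_sum_SigmaD[OF t rows])
  have t': "((\<lambda>(i, k). ?T (k, i)) has_sum t) (UNIV \<times> UNIV)"
    using t by (rule has_sum_swap[THEN iffD1])
  have cols: "((\<lambda>k. ?T (k, i)) has_sum cinner (A (diag_operator e y (f i))) (f i)) UNIV" for i
  proof -
    have "(\<lambda>k. ?T (k, i)) summable_on UNIV"
      using summable_on_SigmaD1[of "\<lambda>i k. ?T (k, i)" UNIV "\<lambda>_. UNIV" i] has_sum_imp_summable[OF t'] by simp
    then obtain s where s: "((\<lambda>k. ?T (k, i)) has_sum s) UNIV" using summable_on_def by blast
    have "(\<lambda>k. (y k * cinner (f i) (e k)) *\<^sub>C e k) sums diag_operator e y (f i)"
      by (rule diag_operator_sums[where y = y, OF onb_orthonormal[OF e, of UNIV] _ yL]) auto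
    from bounded_linear.sums[OF bounded_linear_cinner_left bounded_linear.sums[OF bop_linear[OF A] this], of "f i"]
    have "(\<lambda>k. ?T (k, i)) sums cinner (A (diag_operator e y (f i))) (f i)"
      by (simp add: bop_scaleC[OF A] cinner_scaleC_left mult_ac)
    from sums_unique2[OF has_sum_imp_sums[OF s] this] s show ?thesis by simp
  qed
  have "((\<lambda>i. cinner (A (diag_operator e y (f i))) (f i)) has_sum t) UNIV"
    by (rule has_sum_SigmaD[OF t']) (use cols in simp)
  then show ?thesis using infsumI[OF tk] by simp
qed

lemma orthonormal_basisD:
  fixes B :: "'h set"
  assumes "orthonormal_basis B"
  shows "orthonormal_on B (\<lambda>x. x)" "\<And>x. (\<And>e. e \<in> B \<Longrightarrow> cinner x e = 0) \<Longrightarrow> x = 0"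
  using assms dense_span_total unfolding orthonormal_basis_def orthonormal_on_def by blast+

text \<open>Independence of the basis makes the sum a candidate for the definite description. The
  existing basis \<open>B0\<close> makes it the only one, since without any basis the condition
  would be vacuous.\<close>

lemma classical_trace_diag:
  fixes e :: "nat \<Rightarrow> 'h"
  assumes A: "A \<in> bounded_operators" and e: "onb e"
    and l: "l summable_on UNIV" "\<And>k. l k \<ge> 0" and y: "\<And>k. cmod (y k) = l k"
    and ex: "orthonormal_basis (B0 :: 'h set)"
  shows "classical_trace (A \<circ> diag_operator e y) = (\<Sum>\<^sub>\<infinity>k. y k * cinner (A (e k)) (e k))"
proof -
  let ?t = "\<Sum>\<^sub>\<infinity>k. y k * cinner (A (e k)) (e k)"
  have all: "((\<lambda>x. cinner ((A \<circ> diag_operator e y) x) x) has_sum ?t) B" if B: "orthonormal_basis B" for B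
  proof -
    obtain f where f: "onb f" "bij_betw f (UNIV :: nat set) B"
      using onb_enumerate[OF orthonormal_basisD[OF B]] by blast
    from has_sum_reindex_bij_betw[OF f(2), of "\<lambda>x. cinner ((A \<circ> diag_operator e y) x) x" ?t]
    show ?thesis using trace_diag_has_sum[OF A e f(1) l y] by simp
  qed
  show ?thesis
    unfolding classical_trace_def
  proof (rule the_equality)
    show "\<forall>B. orthonormal_basis B \<longrightarrow> ((\<lambda>x. cinner ((A \<circ> diag_operator e y) x) x) has_sum ?t) B"
      using all by blast
    fix t assume "\<forall>B. orthonormal_basis B \<longrightarrow> ((\<lambda>x. cinner ((A \<circ> diag_operator e y) x) x) has_sum t) B"
    then show "t = ?t" using has_sum_unique[OF _ all[OF ex]] ex by blast
  qed
qed

text \<open>An eigenvector for \<open>t\<close> has coefficients only at indices with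
  \<open>\<mu> k = t\<close>, so the diagonal operator acts on it as required. The required action
  on the \<open>e k\<close> alone already determines the operator.\<close>

lemma operator_powr_diag:
  fixes e :: "nat \<Rightarrow> 'h"
  assumes e: "onb e" and mu: "\<And>k. 0 \<le> \<mu> k" "\<And>k. \<mu> k \<le> K"
    and bd: "\<And>k. cmod (complex_of_real (\<mu> k) powr s) \<le> L"
  shows "operator_powr (diag_operator e (\<lambda>k. complex_of_real (\<mu> k))) s = diag_operator e (\<lambda>k. complex_of_real (\<mu> k) powr s)"
proof -
  let ?V = "diag_operator e (\<lambda>k. complex_of_real (\<mu> k))"
  let ?S = "diag_operator e (\<lambda>k. complex_of_real (\<mu> k) powr s)"
  have muK: "cmod (complex_of_real (\<mu> k)) \<le> K" for k using mu by simp
  note Vb = onb_diag_basis[where y = "\<lambda>k. complex_of_real (\<mu> k)", OF e muK]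
  note Vc = onb_diag_coeff[where y = "\<lambda>k. complex_of_real (\<mu> k)", OF e muK]
  note Sb = onb_diag_basis[where y = "\<lambda>k. complex_of_real (\<mu> k) powr s", OF e bd]
  note Sc = onb_diag_coeff[where y = "\<lambda>k. complex_of_real (\<mu> k) powr s", OF e bd]
  note Sbop = onb_bop_diag[where y = "\<lambda>k. complex_of_real (\<mu> k) powr s", OF e bd]
  show ?thesis
    unfolding operator_powr_def
  proof (rule the_equality)
    have "?S x = (complex_of_real t powr s) *\<^sub>C x" if x: "?V x = complex_of_real t *\<^sub>C x" for t x
    proof (rule onb_eqI[OF e])
      fix k
      have "complex_of_real (\<mu> k) * cinner x (e k) = complex_of_real t * cinner x (e k)"
        unfolding Vc[symmetric] x by (rule cinner_scaleC_left)
      then have "\<mu> k = t \<or> cinner x (e k) = 0" by (auto simp: mult_cancel_right)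
      then show "cinner (?S x) (e k) = cinner ((complex_of_real t powr s) *\<^sub>C x) (e k)"
        unfolding Sc cinner_scaleC_left by auto
    qed
    then show "?S \<in> bounded_operators \<and>
        (\<forall>t\<ge>0. \<forall>x. ?V x = complex_of_real t *\<^sub>C x \<longrightarrow> ?S x = (complex_of_real t powr s) *\<^sub>C x)"
      using Sbop by blast
    fix T assume T: "T \<in> bounded_operators \<and>
        (\<forall>t\<ge>0. \<forall>x. ?V x = complex_of_real t *\<^sub>C x \<longrightarrow> T x = (complex_of_real t powr s) *\<^sub>C x)"
    show "T = ?S"
    proof (rule bop_eqI[OF e _ Sbop])
      show "T \<in> bounded_operators" using T by blast
      fix i j
      have "T (e j) = (complex_of_real (\<mu> j) powr s) *\<^sub>C e j" using T mu(1) Vb by blast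
      then show "cinner (T (e j)) (e i) = cinner (?S (e j)) (e i)" by (simp only: Sb)
    qed
  qed
qed

lemma zeta_diag:
  fixes e :: "nat \<Rightarrow> 'h"
  assumes A: "A \<in> bounded_operators" and e: "onb e" and mu: "\<And>k. 0 \<le> \<mu> k" "\<And>k. \<mu> k \<le> K"
    and s: "(\<lambda>k. cmod (complex_of_real (\<mu> k) powr (1 + z))) summable_on UNIV"
    and ex: "orthonormal_basis (B0 :: 'h set)"
  shows "zeta A (diag_operator e (\<lambda>k. complex_of_real (\<mu> k))) z
    = (\<Sum>\<^sub>\<infinity>k. complex_of_real (\<mu> k) powr (1 + z) * cinner (A (e k)) (e k))"
proof -
  have bd: "cmod (complex_of_real (\<mu> k) powr (1 + z)) \<le> (\<Sum>\<^sub>\<infinity>k. cmod (complex_of_real (\<mu> k) powr (1 + z)))" for k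
    using finite_sum_le_infsum[OF s, of "{k}"] by simp
  show ?thesis
    unfolding zeta_def operator_powr_diag[OF e mu bd]
    by (rule classical_trace_diag[OF A e s _ refl ex]) simp
qed

end

section \<open>From bounded partial sums to the residue\<close>

section \<open>The residue formula\<close>

lemma dyadic_level_exists:
  fixes x :: real
  assumes "0 < x" "x \<le> 1"
  shows "\<exists>n. (1/2) ^ Suc n < x \<and> x \<le> (1/2) ^ n"
proof -
  define m where "m = (LEAST n. (1/2) ^ n < x)"
  have ex: "\<exists>n. (1/2) ^ n < x" using real_arch_pow_inv[of x "1/2"] assms by simp
  have m: "(1/2) ^ m < x" unfolding m_def by (rule LeastI_ex[OF ex])
  then have "m \<noteq> 0" using assms(2) by (metis not_less power_0)
  then obtain n where n: "m = Suc n" using not0_implies_Suc by blast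
  then have "\<not> (1/2) ^ n < x" unfolding m_def by (metis lessI not_less_Least)
  then show ?thesis using m n by (intro exI[of _ n]) simp
qed

lemma harm_le_ln: "harm (Suc n) \<le> 1 + ln (real (Suc n))"
proof (induction n)
  case 0
  then show ?case by (simp add: harm_expand)
next
  case (Suc n)
  let ?a = "real (Suc n)" and ?b = "real (Suc (Suc n))"
  have "ln (?a / ?b) \<le> ?a / ?b - 1" by (rule ln_le_minus_one) simp
  then have "inverse ?b \<le> ln ?b - ln ?a" by (simp add: ln_div field_simps)
  then show ?case using Suc by (simp add: harm_Suc[of "Suc n"])
qed

definition harmonic_block :: "nat \<Rightarrow> real" where
  "harmonic_block n = (\<Sum>k | floor_log (Suc k) = n. 1 / real (Suc k))"

text \<open>The blocks up to \<open>N\<close> add up to the harmonic number with index 2^(N+1) - 1,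
  which lies between ln (2^(N+1)) and 1 more than that.\<close>

lemma harmonic_block_sums: "\<bar>(\<Sum>n\<le>N. harmonic_block n) - (\<Sum>n\<le>N. ln 2)\<bar> \<le> 1"
proof -
  have "(\<Sum>n\<le>N. harmonic_block n) = harm (2 ^ Suc N - 1)"
  proof (induction N)
    case 0
    show ?case by (simp add: harmonic_block_def dyadic_block harm_altdef atLeast0LessThan)
  next
    case (Suc N)
    have "harm (2 ^ Suc N - 1) + harmonic_block (Suc N)
      = (\<Sum>k\<in>{0..<2 ^ Suc N - 1}. 1 / real (Suc k)) + (\<Sum>k\<in>{2 ^ Suc N - 1..<2 ^ Suc (Suc N) - 1}. 1 / real (Suc k))"
      by (simp only: harmonic_block_def dyadic_block harm_altdef atLeast0LessThan inverse_eq_divide)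
    also have "\<dots> = (\<Sum>k\<in>{0..<2 ^ Suc (Suc N) - 1}. 1 / real (Suc k))"
      by (rule sum.atLeastLessThan_concat) (auto intro: diff_le_mono)
    also have "\<dots> = harm (2 ^ Suc (Suc N) - 1)"
      by (simp only: harm_altdef atLeast0LessThan inverse_eq_divide)
    finally show ?case using Suc by simp
  qed
  moreover have "(\<Sum>n\<le>N. ln 2) = ln (2 ^ Suc N :: real)" by (simp add: ln_realpow del: power_Suc)
  moreover have "ln (2 ^ Suc N) \<le> (harm (2 ^ Suc N - 1) :: real)"
    using ln_le_harm[of "2 ^ Suc N - 1"] by (simp add: of_nat_diff del: power_Suc)
  moreover have "harm (2 ^ Suc N - 1) \<le> 1 + ln (2 ^ Suc N :: real)"
  proof -
    have "1 < (2::nat) ^ Suc N" by (rule one_less_power) auto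
    then have "(2::nat) ^ Suc N - 1 \<noteq> 0" by linarith
    then obtain p where p: "2 ^ Suc N - 1 = Suc p" using not0_implies_Suc by blast
    have "harm (Suc p) \<le> 1 + ln (real (Suc p))" by (rule harm_le_ln)
    also have "real (Suc p) = 2 ^ Suc N - 1" unfolding p[symmetric] by (simp add: of_nat_diff)
    also have "1 + ln (2 ^ Suc N - 1) \<le> 1 + ln (2 ^ Suc N :: real)"
    proof -
      have "(2 ^ Suc N - 1 :: real) > 0" using one_less_power[of "2::real" "Suc N"] by simp
      then show ?thesis by (simp del: power_Suc)
    qed
    finally show ?thesis unfolding p .
  qed
  ultimately show ?thesis by linarith
qed

lemma simple_pole_limit:
  assumes F: "F holomorphic_on S - {0}" "open S" "0 \<in> S" and pole: "is_pole F 0" "zorder F 0 = -1"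
  shows "((\<lambda>z. z * F z) \<longlongrightarrow> residue F 0) (at 0)"
proof -
  define g where "g = zor_poly F 0"
  obtain r where r: "r > 0" "g holomorphic_on cball 0 r" "\<And>w. w \<in> cball 0 r - {0} \<Longrightarrow> F w = g w / w"
    using zorder_exist_pole[OF F pole(1)] unfolding pole(2) g_def by auto
  have res: "residue F 0 = g 0"
    unfolding g_def by (rule residue_simple_pole[OF isolated_singularity_at_holomorphic[OF F] pole])
  have lim: "(g \<longlongrightarrow> g 0) (at 0)"
  proof -
    have "continuous_on (ball 0 r) g"
      using r(2) by (meson ball_subset_cball continuous_on_subset holomorphic_on_imp_continuous_on)
    then have "isCont g 0" using r(1) by (simp add: continuous_on_eq_continuous_at)
    then show ?thesis by (simp add: isCont_def)
  qed
  have ev: "eventually (\<lambda>z. g z = z * F z) (at 0)"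
    unfolding eventually_at using r by (intro exI[of _ r]) (auto simp: dist_norm)
  show ?thesis unfolding res by (rule Lim_transform_eventually[OF lim ev])
qed

text \<open>The non-zero solutions of the equation are integer multiples of 2 pi i / ln 2 and lie
  outside the unit disc. This is the origin of the radius \<open>min \<epsilon> 1\<close> in
  \<open>regularised_extension\<close>.\<close>

lemma exp_minus_ln2_ne_1:
  assumes "cmod z < 1" "z \<noteq> 0"
  shows "exp (- (of_real (ln 2) * z)) \<noteq> 1"
proof
  assume "exp (- (of_real (ln 2) * z)) = 1"
  then obtain k :: int where k: "- (of_real (ln 2) * z) = of_int (2 * k) * complex_of_real pi * \<i>"
    unfolding exp_eq_1 by (auto simp: complex_eq_iff)
  have "cmod (- (of_real (ln 2) * z)) < 1"
  proof -
    have "ln 2 \<le> (1::real)" using ln_le_minus_one[of "2::real"] by simp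
    then have "ln 2 * cmod z \<le> 1 * cmod z" by (intro mult_right_mono) auto
    then show ?thesis using assms(1) by (simp add: norm_mult)
  qed
  moreover have "cmod (of_int (2 * k) * complex_of_real pi * \<i>) = 2 * \<bar>real_of_int k\<bar> * pi"
    by (simp add: norm_mult)
  moreover have "k \<noteq> 0" using k assms(2) by auto
  then have "1 \<le> \<bar>real_of_int k\<bar>" by linarith
  then have "2 * \<bar>real_of_int k\<bar> * pi \<ge> 2 * 1 * pi" by (intro mult_mono) auto
  ultimately show False using k pi_gt3 by simp
qed

text \<open>The subtracted function sums, for Re z > 0, the geometric series of constant block sums
  and has a simple pole at 0 with the same residue as \<open>F\<close>, so the singularity of the
  difference is removable. The factor with \<open>t\<close> equals 1 at 0 and will account for a
  rescaling of \<open>V\<close>.\<close>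

lemma regularised_extension:
  assumes F: "F holomorphic_on ({z. Re z > - \<epsilon>} - {0})" and eps: "\<epsilon> > 0"
    and pole: "is_pole F 0" "zorder F 0 = -1"
  obtains G where "G holomorphic_on ball 0 (min \<epsilon> 1)"
    "\<And>z. z \<in> ball 0 (min \<epsilon> 1) - {0} \<Longrightarrow>
      G z = F z * exp (- (of_real t * z)) - residue F 0 * of_real (ln 2) / (1 - exp (- (of_real (ln 2) * z)))"
proof -
  let ?S = "ball (0::complex) (min \<epsilon> 1)"
  let ?c = "residue F 0"
  define f where "f z = F z * exp (- (of_real t * z)) - ?c * of_real (ln 2) / (1 - exp (- (of_real (ln 2) * z)))" for z
  have op: "open {z. Re z > - \<epsilon>}" by (simp add: open_halfspace_Re_gt)
  have sub: "?S \<subseteq> {z. Re z > - \<epsilon>}"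
  proof
    fix z assume "z \<in> ?S"
    then have "cmod z < \<epsilon>" by (simp add: dist_norm)
    then show "z \<in> {z. Re z > - \<epsilon>}" using abs_Re_le_cmod[of z] by simp
  qed
  have fhol: "f holomorphic_on ?S - {0}"
    unfolding f_def
  proof (intro holomorphic_intros)
    show "F holomorphic_on ?S - {0}" by (rule holomorphic_on_subset[OF F]) (use sub in blast)
    show "1 - exp (- (of_real (ln 2) * z)) \<noteq> 0" if "z \<in> ?S - {0}" for z :: complex
      using exp_minus_ln2_ne_1[of z] that by (auto simp: dist_norm)
  qed
  have lim: "((\<lambda>z. (z - 0) * f z) \<longlongrightarrow> 0) (at 0)"
  proof -
    have l1: "((\<lambda>z. z * F z) \<longlongrightarrow> ?c) (at 0)"
      by (rule simple_pole_limit[OF F op _ pole]) (use eps in simp)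
    have l2: "((\<lambda>z. exp (- (of_real t * z))) \<longlongrightarrow> exp (- (of_real t * 0))) (at (0::complex))"
      by (intro tendsto_intros)
    have "((\<lambda>z. 1 - exp (- (of_real (ln 2) * z))) has_field_derivative of_real (ln 2)) (at (0::complex))"
      by (auto intro!: derivative_eq_intros)
    then have "((\<lambda>z. (1 - exp (- (of_real (ln 2) * z))) / z) \<longlongrightarrow> of_real (ln 2)) (at (0::complex))"
      unfolding has_field_derivative_iff by simp
    then have "((\<lambda>z. inverse ((1 - exp (- (of_real (ln 2) * z))) / z)) \<longlongrightarrow> inverse (of_real (ln 2))) (at (0::complex))"
      by (rule tendsto_inverse) simp
    then have l3: "((\<lambda>z. z / (1 - exp (- (of_real (ln 2) * z)))) \<longlongrightarrow> inverse (of_real (ln 2))) (at (0::complex))"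
      by (simp only: inverse_divide)
    have "((\<lambda>z. (z * F z) * exp (- (of_real t * z)) - ?c * of_real (ln 2) * (z / (1 - exp (- (of_real (ln 2) * z)))))
        \<longlongrightarrow> ?c * exp (- (of_real t * 0)) - ?c * of_real (ln 2) * inverse (of_real (ln 2))) (at 0)"
      by (intro tendsto_diff tendsto_mult tendsto_const l1 l2 l3)
    moreover have "?c * exp (- (of_real t * 0)) - ?c * of_real (ln 2) * inverse (of_real (ln 2)) = 0" by simp
    moreover have "(\<lambda>z. (z * F z) * exp (- (of_real t * z)) - ?c * of_real (ln 2) * (z / (1 - exp (- (of_real (ln 2) * z)))))
      = (\<lambda>z. (z - 0) * f z)"
      by (simp add: fun_eq_iff f_def right_diff_distrib divide_inverse mult_ac)
    ultimately show ?thesis by (simp only:)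
  qed
  have "0 \<in> interior ?S" using eps by (simp add: interior_open)
  then have "\<exists>g. g holomorphic_on ?S \<and> (\<forall>z\<in>?S - {0}. g z = f z)"
    using holomorphic_on_extend_lim[OF fhol] lim by blast
  then show ?thesis using that unfolding f_def by blast
qed

context weak_trace
begin

theorem trace_eq_residue:
  fixes A V :: "'h \<Rightarrow> 'h"
  assumes norm1: "\<phi> (diag_operator b (\<lambda>k. 1 / (of_nat k + 1))) = 1"
    and V: "V \<in> weak_L1" "positive_operator V" and A: "A \<in> bounded_operators" and eps: "\<epsilon> > 0"
    and F: "F holomorphic_on ({z. Re z > - \<epsilon>} - {0})" "\<And>z. Re z > 0 \<Longrightarrow> F z = zeta A V z"
    and pole: "is_pole F 0" "zorder F 0 = -1"
    and basis: "orthonormal_basis (range b)"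
  shows "\<phi> (A \<circ> V) = residue F 0"
proof -
  have cp: "compact_operator V" using V by (simp add: weak_L1_def)
  obtain e \<mu> K0 where e: "onb e" and mu: "\<And>k. 0 \<le> \<mu> k" "\<And>k. \<mu> k \<le> K0"
    and ev: "\<And>k. V (e k) = complex_of_real (\<mu> k) *\<^sub>C e k"
    and diag: "V = diag_operator e (\<lambda>k. complex_of_real (\<mu> k))"
    and "\<And>\<delta>. \<delta> > 0 \<Longrightarrow> finite {k. \<mu> k > \<delta>}"
    by (rule spectral_theorem_positive_compact[OF V(2) cp], rule that)
  have bd: "cmod (complex_of_real (\<mu> k)) \<le> K0" for k using mu by simp
  have wl: "weak_l1 (\<lambda>k. complex_of_real (\<mu> k))"
    by (rule weak_L1_diag_imp_weak_l1[OF e]) (use bd V diag in auto)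
  obtain K where "\<And>\<delta>. \<delta> > 0 \<Longrightarrow> finite {k. \<delta> < cmod (complex_of_real (\<mu> k))} \<and>
      real (card {k. \<delta> < cmod (complex_of_real (\<mu> k))}) \<le> K / \<delta>"
    using wl unfolding weak_l1_def by blast
  then have K: "finite {k. \<delta> < \<mu> k}" "real (card {k. \<delta> < \<mu> k}) \<le> K / \<delta>" if "\<delta> > 0" for \<delta>
    using that mu(1) by simp_all
  have K_nonneg: "0 \<le> K" using K(2)[of 1] by simp
  \<comment> \<open>The scale brings all eigenvalues into the unit interval; the added 1 keeps it
    positive even if they all vanish.\<close>
  define M where "M = K0 + 1"
  have M: "M > 0" using mu[of 0] by (simp add: M_def)
  define \<nu> where "\<nu> k = \<mu> k / M" for k
  have nu1: "\<nu> k \<le> 1" for k using mu(2)[of k] M by (simp add: \<nu>_def M_def)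
  have "\<exists>n. \<mu> k > 0 \<longrightarrow> (1/2) ^ Suc n < \<nu> k \<and> \<nu> k \<le> (1/2) ^ n" for k
    using dyadic_level_exists[of "\<nu> k"] nu1[of k] M by (cases "\<mu> k > 0") (auto simp: \<nu>_def)
  then obtain lev where lev: "\<And>k. \<mu> k > 0 \<Longrightarrow> (1/2) ^ Suc (lev k) < \<nu> k \<and> \<nu> k \<le> (1/2) ^ lev k"
    by metis
  \<comment> \<open>Kernel vectors have no dyadic level. Distributing them over the standard blocks
    keeps every block finite and adds at most \<open>2 ^ m\<close> indices to block
    \<open>m\<close>.\<close>
  define n where "n k = (if \<mu> k > 0 then lev k else floor_log (Suc k))" for k
  \<comment> \<open>The first term counts the eigenvalues greater than
    \<open>M * (1/2) ^ Suc m\<close>, the 1 accounts for the kernel vectors.\<close>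
  define C where "C = 2 * K / M + 1"
  have blocks: "finite {j. n j = m}" "real (card {j. n j = m}) \<le> C * 2 ^ m" for m
  proof -
    define \<delta> where "\<delta> = M * (1/2) ^ Suc m"
    have d: "\<delta> > 0" using M by (simp add: \<delta>_def)
    have sub: "{j. n j = m} \<subseteq> {j. \<delta> < \<mu> j} \<union> {j. floor_log (Suc j) = m}"
    proof
      fix j assume "j \<in> {j. n j = m}"
      then have j: "n j = m" by simp
      show "j \<in> {j. \<delta> < \<mu> j} \<union> {j. floor_log (Suc j) = m}"
      proof (cases "\<mu> j > 0")
        case True
        then have "(1/2) ^ Suc m < \<mu> j / M" using lev[OF True] j by (simp add: n_def \<nu>_def)
        then have "\<delta> < \<mu> j" unfolding \<delta>_def pos_less_divide_eq[OF M] by (simp only: mult.commute)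
        then show ?thesis by simp
      qed (use j in \<open>simp add: n_def\<close>)
    qed
    have fin: "finite ({j. \<delta> < \<mu> j} \<union> {j. floor_log (Suc j) = m})" using K(1)[OF d] dyadic_block_card(1) by simp
    show "finite {j. n j = m}" by (rule finite_subset[OF sub fin])
    have "card {j. n j = m} \<le> card {j. \<delta> < \<mu> j} + card {j. floor_log (Suc j) = m}"
      using card_mono[OF fin sub] card_Un_le order_trans by blast
    then have "real (card {j. n j = m}) \<le> K / \<delta> + 2 ^ m"
      using K(2)[OF d] unfolding dyadic_block_card(2) by (simp add: of_nat_le_iff[where 'a = real, symmetric] del: of_nat_le_iff)
    also have "K / \<delta> = 2 * K / M * 2 ^ m" using M by (simp add: \<delta>_def power_divide field_simps)
    finally show "real (card {j. n j = m}) \<le> C * 2 ^ m" by (simp add: C_def distrib_right)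
  qed
  have C_nonneg: "0 \<le> C" using K_nonneg M by (simp add: C_def)
  interpret bt: block_trace b \<phi> e n C
    by unfold_locales (use e blocks in auto)
  have mu_le: "\<mu> j \<le> M * (1/2) ^ n j" for j
  proof (cases "\<mu> j > 0")
    case True
    then have "\<mu> j / M \<le> (1/2) ^ n j" using lev[OF True] by (simp add: n_def \<nu>_def)
    then show ?thesis using M by (simp add: field_simps)
  next
    case False
    then have "\<mu> j \<le> 0" by simp
    also have "0 \<le> M * (1/2) ^ n j" using M by simp
    finally show ?thesis .
  qed
  define a where "a k = cinner (A (e k)) (e k)" for k
  obtain \<alpha> where \<alpha>: "\<alpha> > 0" "\<And>x. norm (A x) \<le> \<alpha> * norm x" using bop_bound[OF A] by blast
  have a: "cmod (a k) \<le> \<alpha>" for k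
    using cinner_Cauchy_Schwarz[of "A (e k)" "e k"] \<alpha>(2)[of "e k"] onb_norm[OF e, of k] by (simp add: a_def)
  define c where "c = residue F 0"
  \<comment> \<open>For a positive eigenvalue this is its power with exponent 1 + z, divided by M^z.
    For \<open>\<mu> k = 0\<close> the first factor makes it 0, whatever the value of the
    logarithm.\<close>
  define q where "q z k = complex_of_real (\<mu> k) * exp (of_real (ln (\<nu> k)) * z)" for z k
  \<comment> \<open>In block \<open>m\<close> the logarithm of \<open>\<nu> k\<close> differs from -
    m ln 2 by at most ln 2, so for \<bar>Re z\<bar> \<le> 1 replacing it by - m ln 2 costs at most
    the factor 2.\<close>
  have q_bound: "cmod (q z k) \<le> 2 * M * (1/2) ^ m * (2 powr (- Re z)) ^ m" if k: "n k = m" and z: "\<bar>Re z\<bar> \<le> 1" for z k m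
  proof (cases "\<mu> k > 0")
    case True
    define x where "x = Re z"
    define L where "L = ln (\<nu> k)"
    have nu0: "\<nu> k > 0" using True M by (simp add: \<nu>_def)
    have lev': "(1/2) ^ Suc m < \<nu> k" "\<nu> k \<le> (1/2) ^ m" using lev[OF True] k True by (simp_all add: n_def)
    have L1: "L \<le> - (real m * ln 2)"
    proof -
      have "L \<le> ln ((1/2) ^ m)" unfolding L_def using lev'(2) nu0 by simp
      then show ?thesis by (simp add: ln_realpow ln_div)
    qed
    have L2: "- (real m * ln 2) - ln 2 \<le> L"
    proof -
      have "ln ((1/2) ^ Suc m) \<le> L" unfolding L_def using lev'(1) nu0 by (intro ln_mono) auto
      then show ?thesis by (simp add: ln_realpow ln_div ln_mult algebra_simps)
    qed
    have xL: "L * x \<le> - (real m * ln 2) * x + ln 2"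
    proof (cases "x \<ge> 0")
      case True
      then have "L * x \<le> - (real m * ln 2) * x" by (intro mult_right_mono L1)
      then show ?thesis by (smt (verit) ln_ge_zero)
    next
      case False
      then have "L * x \<le> (- (real m * ln 2) - ln 2) * x" by (intro mult_right_mono_neg L2) simp
      moreover have "- (ln 2 * x) \<le> ln 2 * 1"
        unfolding mult_minus_right[symmetric] using z by (intro mult_left_mono) (auto simp: x_def)
      ultimately show ?thesis by (simp add: left_diff_distrib)
    qed
    have "cmod (exp (of_real L * z)) = exp (L * x)" by (simp add: x_def)
    also have "\<dots> \<le> exp (- (real m * ln 2) * x + ln 2)" using xL by simp
    also have "\<dots> = 2 * exp (- (real m * ln 2) * x)" unfolding exp_add by simp
    also have "exp (- (real m * ln 2) * x) = (2 powr (- x)) ^ m"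
      by (simp add: powr_def exp_of_nat_mult[symmetric] mult_ac)
    finally have "cmod (exp (of_real L * z)) \<le> 2 * (2 powr (- x)) ^ m" .
    then have "\<mu> k * cmod (exp (of_real L * z)) \<le> (M * (1/2) ^ m) * (2 * (2 powr (- x)) ^ m)"
      using mu_le[of k] k mu(1)[of k] M by (intro mult_mono) auto
    then show ?thesis using mu(1)[of k] by (simp add: q_def norm_mult L_def x_def mult_ac)
  next
    case False
    then have "\<mu> k = 0" using mu(1)[of k] by simp
    then show ?thesis using M by (simp add: q_def)
  qed
  have block_q: "(\<Sum>j | n j = m. cmod (q z j)) \<le> 2 * C * M * (2 powr (- Re z)) ^ m" if z: "\<bar>Re z\<bar> \<le> 1" for z m
  proof -
    have "(\<Sum>j | n j = m. cmod (q z j)) \<le> (\<Sum>j | n j = m. 2 * M * (1/2) ^ m * (2 powr (- Re z)) ^ m)"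
      by (intro sum_mono q_bound z) simp
    also have "\<dots> = real (card {j. n j = m}) * (2 * M * (1/2) ^ m * (2 powr (- Re z)) ^ m)" by simp
    also have "\<dots> \<le> C * 2 ^ m * (2 * M * (1/2) ^ m * (2 powr (- Re z)) ^ m)"
      using M by (intro mult_right_mono blocks) simp
    also have "\<dots> = 2 * C * M * (2 powr (- Re z)) ^ m" by (simp add: power_divide)
    finally show ?thesis .
  qed
  \<comment> \<open>The subtracted terms form the geometric series whose sum removes the pole; at
    \<open>z = 0\<close> they all become \<open>c * of_real (ln 2)\<close>.\<close>
  define H where "H m z = (\<Sum>j | n j = m. q z j * a j) - c * of_real (ln 2) * exp (- (of_real (ln 2) * z)) ^ m" for m z
  have Hhol: "H m holomorphic_on UNIV" for m
    unfolding H_def q_def by (intro holomorphic_intros)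
  have exp_mod: "cmod (exp (- (of_real (ln 2) * z))) = 2 powr (- Re z)" for z
    by (simp add: powr_def mult.commute)
  have Hbound: "cmod (H m z) \<le> (2 * C * M * \<alpha> + cmod c * ln 2) * (2 powr (- Re z)) ^ m" if z: "\<bar>Re z\<bar> \<le> 1" for m z
  proof -
    have "cmod (\<Sum>j | n j = m. q z j * a j) \<le> (\<Sum>j | n j = m. cmod (q z j) * \<alpha>)"
      by (rule sum_norm_le) (simp add: norm_mult a mult_left_mono)
    also have "\<dots> \<le> 2 * C * M * (2 powr (- Re z)) ^ m * \<alpha>"
      unfolding sum_distrib_right[symmetric] using \<alpha> by (intro mult_right_mono block_q z) simp
    finally have 1: "cmod (\<Sum>j | n j = m. q z j * a j) \<le> 2 * C * M * (2 powr (- Re z)) ^ m * \<alpha>" .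
    have 2: "cmod (c * of_real (ln 2) * exp (- (of_real (ln 2) * z)) ^ m) = cmod c * ln 2 * (2 powr (- Re z)) ^ m"
      by (simp only: norm_mult norm_power exp_mod norm_of_real) simp
    have "cmod (H m z) \<le> cmod (\<Sum>j | n j = m. q z j * a j) + cmod (c * of_real (ln 2) * exp (- (of_real (ln 2) * z)) ^ m)"
      unfolding H_def by (rule norm_triangle_ineq4)
    also have "\<dots> \<le> 2 * C * M * (2 powr (- Re z)) ^ m * \<alpha> + cmod c * ln 2 * (2 powr (- Re z)) ^ m"
      unfolding 2 using 1 by simp
    also have "\<dots> = (2 * C * M * \<alpha> + cmod c * ln 2) * (2 powr (- Re z)) ^ m"
      unfolding distrib_right by (simp only: mult_ac)
    finally show ?thesis .
  qed
  \<comment> \<open>Absolute convergence permits grouping the eigenvalues by blocks; the exponential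
    undoes the scaling by \<open>M\<close>.\<close>
  have zeta_sums: "(\<lambda>m. \<Sum>j | n j = m. q z j * a j) sums (F z * exp (- (of_real (ln M) * z)))"
    if z: "0 < Re z" "Re z \<le> 1" for z
  proof -
    let ?I = "Sigma UNIV (\<lambda>m. {j. n j = m})"
    have bij: "bij_betw snd ?I UNIV"
      by (rule bij_betw_byWitness[where f' = "\<lambda>j. (n j, j)"]) auto
    define u where "u = 2 powr (- Re z)"
    have u: "0 < u" "u < 1" using z by (auto simp: u_def powr_less_one)
    have qs: "(\<lambda>k. cmod (q z k)) summable_on UNIV"
    proof -
      have "(\<lambda>p. cmod (q z (snd p))) summable_on ?I"
      proof (rule summable_on_SigmaI)
        show "((\<lambda>j. cmod (q z (snd (m, j)))) has_sum (\<Sum>j | n j = m. cmod (q z j))) {j. n j = m}" for m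
          using has_sum_finite[OF blocks(1), of "\<lambda>j. cmod (q z j)" m] by simp
        have "(\<lambda>m. 2 * C * M * u ^ m) summable_on UNIV"
          using u C_nonneg M by (intro norm_summable_imp_summable_on) (simp add: summable_mult abs_mult power_abs)
        then show "(\<lambda>m. \<Sum>j | n j = m. cmod (q z j)) summable_on UNIV"
          by (rule summable_on_comparison_test) (use block_q[of z] z in \<open>auto simp: u_def intro: sum_nonneg\<close>)
      qed simp
      then show ?thesis using summable_on_reindex_bij_betw[OF bij, of "\<lambda>k. cmod (q z k)"] by simp
    qed
    have powr_q: "complex_of_real (\<mu> k) powr (1 + z) = exp (of_real (ln M) * z) * q z k" for k
    proof (cases "\<mu> k = 0")
      case False
      then have mk: "\<mu> k > 0" using mu(1)[of k] by simp
      have "complex_of_real (\<mu> k) powr (1 + z) = complex_of_real (\<mu> k) * exp (of_real (ln (\<mu> k)) * z)"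
      proof -
        have "complex_of_real (\<mu> k) powr (1 + z) = exp (of_real (ln (\<mu> k)) + of_real (ln (\<mu> k)) * z)"
          using mk by (simp add: powr_def Ln_of_real algebra_simps)
        also have "exp (complex_of_real (ln (\<mu> k))) = complex_of_real (\<mu> k)"
          using mk by (metis exp_ln exp_of_real)
        then have "exp (of_real (ln (\<mu> k)) + of_real (ln (\<mu> k)) * z) = complex_of_real (\<mu> k) * exp (of_real (ln (\<mu> k)) * z)"
          by (simp only: exp_add)
        finally show ?thesis .
      qed
      also have "ln (\<mu> k) = ln M + ln (\<nu> k)" using mk M by (simp add: \<nu>_def ln_div)
      finally show ?thesis by (simp add: q_def distrib_right exp_add)
    qed (simp add: q_def)
    have "(\<lambda>k. cmod (complex_of_real (\<mu> k) powr (1 + z))) summable_on UNIV"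
      unfolding powr_q norm_mult by (rule summable_on_cmult_right[OF qs])
    from zeta_diag[OF A e mu this basis]
    have "F z = (\<Sum>\<^sub>\<infinity>k. exp (of_real (ln M) * z) * q z k * a k)"
      using F(2)[OF z(1)] by (simp add: diag[symmetric] powr_q a_def)
    also have "\<dots> = (\<Sum>\<^sub>\<infinity>k. exp (of_real (ln M) * z) * (q z k * a k))" by (simp add: mult.assoc)
    also have "\<dots> = exp (of_real (ln M) * z) * (\<Sum>\<^sub>\<infinity>k. q z k * a k)"
      by (rule infsum_cmult_right')
    finally have Fz: "F z * exp (- (of_real (ln M) * z)) = (\<Sum>\<^sub>\<infinity>k. q z k * a k)"
      by (simp add: exp_minus field_simps)
    have "(\<lambda>k. cmod (q z k * a k)) summable_on UNIV"
      by (rule summable_on_comparison_test[OF summable_on_cmult_left[OF qs, of \<alpha>]])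
        (auto simp: norm_mult intro: mult_left_mono a)
    then have "(\<lambda>k. q z k * a k) summable_on UNIV" by (rule Infinite_Sum.abs_summable_summable)
    then have "((\<lambda>k. q z k * a k) has_sum (F z * exp (- (of_real (ln M) * z)))) UNIV"
      unfolding Fz by (rule has_sum_infsum)
    then have "((\<lambda>p. q z (snd p) * a (snd p)) has_sum (F z * exp (- (of_real (ln M) * z)))) ?I"
      using has_sum_reindex_bij_betw[OF bij, of "\<lambda>k. q z k * a k"] by simp
    then have "((\<lambda>m. \<Sum>j | n j = m. q z j * a j) has_sum (F z * exp (- (of_real (ln M) * z)))) UNIV"
      by (rule has_sum_SigmaD) (use has_sum_finite[OF blocks(1)] in simp)
    then show ?thesis by (rule has_sum_imp_sums)
  qed
  obtain G where G: "G holomorphic_on ball 0 (min \<epsilon> 1)"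
    "\<And>z. z \<in> ball 0 (min \<epsilon> 1) - {0} \<Longrightarrow>
      G z = F z * exp (- (of_real (ln M) * z)) - c * of_real (ln 2) / (1 - exp (- (of_real (ln 2) * z)))"
    by (rule regularised_extension[OF F(1) eps pole, of "ln M", folded c_def], rule that)
  \<comment> \<open>Halving leaves the closed disc inside the domain of \<open>G\<close> and keeps
    \<bar>Re z\<bar> below 1, as the bound on \<open>H\<close> requires.\<close>
  define R where "R = min \<epsilon> 1 / 2"
  have R: "0 < R" "R < min \<epsilon> 1" "R < 1" using eps by (auto simp: R_def)
  have Re_le: "\<bar>Re z\<bar> \<le> 1" if "cmod z \<le> R" for z using abs_Re_le_cmod[of z] that R by linarith
  obtain D where D: "\<And>N. cmod (\<Sum>m\<le>N. H m 0) \<le> D"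
  proof (rule Riesz_Newman_bounded_partial_sums[OF R(1) _ Hhol _ G(1)])
    show "0 \<le> 2 * C * M * \<alpha> + cmod c * ln 2" using C_nonneg M \<alpha>(1) by simp
    show "cmod (H m z) \<le> (2 * C * M * \<alpha> + cmod c * ln 2) * (2 powr (- Re z)) ^ m" if "cmod z \<le> R" for m z
      by (rule Hbound[OF Re_le[OF that]])
    show "cball 0 R \<subseteq> ball 0 (min \<epsilon> 1)" using R by (auto simp: dist_norm)
    show "(\<lambda>m. H m z) sums G z" if z: "cmod z \<le> R" "0 < Re z" for z
    proof -
      have zb: "z \<in> ball 0 (min \<epsilon> 1) - {0}" using z R by (auto simp: dist_norm)
      have "cmod (exp (- (of_real (ln 2) * z))) < 1" unfolding exp_mod using z by (simp add: powr_less_one)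
      from sums_mult[OF geometric_sums[OF this], of "c * of_real (ln 2)"]
      have "(\<lambda>m. c * of_real (ln 2) * exp (- (of_real (ln 2) * z)) ^ m) sums (c * of_real (ln 2) / (1 - exp (- (of_real (ln 2) * z))))"
        by simp
      moreover have "(\<lambda>m. \<Sum>j | n j = m. q z j * a j) sums (F z * exp (- (of_real (ln M) * z)))"
        using zeta_sums[OF z(2)] Re_le[OF z(1)] by simp
      ultimately show ?thesis unfolding H_def G(2)[OF zb] by (intro sums_diff)
    qed
  qed (use that in auto)
  define S where "S m = (\<Sum>j | n j = m. complex_of_real (\<mu> j) * a j)" for m
  have H0: "H m 0 = S m - c * of_real (ln 2)" for m by (simp add: H_def q_def S_def)
  \<comment> \<open>Replacing the constant ln 2 by the harmonic block sums changes the partial sums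
    by at most \<open>cmod c\<close>.\<close>
  have bounded: "cmod (\<Sum>m\<le>N. S m - c * of_real (harmonic_block m)) \<le> D + cmod c" for N
  proof -
    have "(\<Sum>m\<le>N. S m - c * of_real (harmonic_block m))
      = (\<Sum>m\<le>N. H m 0) - c * of_real ((\<Sum>m\<le>N. harmonic_block m) - (\<Sum>m\<le>N. ln 2))"
      unfolding H0 by (simp add: sum_subtractf sum_distrib_left[symmetric] algebra_simps)
    also have "cmod \<dots> \<le> cmod (\<Sum>m\<le>N. H m 0) + cmod (c * of_real ((\<Sum>m\<le>N. harmonic_block m) - (\<Sum>m\<le>N. ln 2)))"
      by (rule norm_triangle_ineq4)
    also have "\<dots> \<le> D + cmod c * 1"
      unfolding norm_mult norm_of_real by (intro add_mono D mult_left_mono harmonic_block_sums) simp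
    finally show ?thesis by simp
  qed
  \<comment> \<open>\<open>V = G\<^sub>0 W\<close> with \<open>G\<^sub>0\<close> bounded, so that \<open>A V = B W\<close> for the bounded operator \<open>B = A G\<^sub>0\<close>.\<close>
  define g where "g j = complex_of_real (\<mu> j / bt.w j)" for j
  have gM: "cmod (g j) \<le> M" for j
  proof -
    have "\<mu> j \<le> M * bt.w j" unfolding bt.w_def by (rule mu_le)
    then have "\<mu> j / bt.w j \<le> M" by (simp only: pos_divide_le_eq[OF bt.w_pos])
    moreover have "0 \<le> \<mu> j / bt.w j" using mu(1)[of j] bt.w_pos[of j] by simp
    ultimately show ?thesis unfolding g_def norm_of_real by simp
  qed
  define B where "B x = A (diag_operator e g x)" for x
  have Gb: "diag_operator e g \<in> bounded_operators" by (rule onb_bop_diag[where y = g, OF e gM])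
  have B: "B \<in> bounded_operators" unfolding B_def by (rule bop_comp[OF A Gb])
  have VW: "V x = diag_operator e g (bt.W x)" for x
  proof (rule onb_eqI[OF e])
    fix i
    have "cinner (V x) (e i) = complex_of_real (\<mu> i) * cinner x (e i)"
      unfolding diag by (rule onb_diag_coeff[where y = "\<lambda>k. complex_of_real (\<mu> k)", OF e bd])
    also have "\<dots> = g i * (complex_of_real (bt.w i) * cinner x (e i))"
      using bt.w_pos[of i] by (simp add: g_def)
    also have "\<dots> = cinner (diag_operator e g (bt.W x)) (e i)"
      unfolding onb_diag_coeff[where y = g, OF e gM] bt.W_coeff ..
    finally show "cinner (V x) (e i) = cinner (diag_operator e g (bt.W x)) (e i)" .
  qed
  have AV: "A \<circ> V = (\<lambda>x. B (bt.W x))" by (simp add: fun_eq_iff B_def VW)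
  have Bdiag: "complex_of_real ((1/2) ^ m) * cinner (B (e j)) (e j) = complex_of_real (\<mu> j) * a j" if "n j = m" for j m
    using that bt.w_pos[of j] onb_diag_basis[where y = g and k = j, OF e gM]
    by (simp add: B_def bop_scaleC[OF A] cinner_scaleC_left a_def g_def bt.w_def[symmetric] flip: of_real_power)
      (simp add: bt.w_def)
  \<comment> \<open>The relation between block sums and traces was established for symmetric
    operators, so \<open>B\<close> is split into its real and imaginary parts.\<close>
  define B1 where "B1 x = (1/2) *\<^sub>C (B x + cadjoint B x)" for x
  define B2 where "B2 x = (- \<i> / 2) *\<^sub>C (B x - cadjoint B x)" for x
  note Bs = bop_adjoint[OF B]
  have B1: "B1 \<in> bounded_operators" unfolding B1_def by (intro bop_scale bop_plus B Bs)
  have B2: "B2 \<in> bounded_operators" unfolding B2_def by (intro bop_scale bop_minus B Bs)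
  have sym1: "cinner (B1 x) y = cinner x (B1 y)" for x y
    by (simp add: B1_def cinner_scaleC_left cinner_scaleC_right cinner_add_left cinner_add_right
        cinner_adjoint[OF B] cinner_adjoint'[OF B])
  have sym2: "cinner (B2 x) y = cinner x (B2 y)" for x y
    by (simp add: B2_def cinner_scaleC_left cinner_scaleC_right cinner_diff_left cinner_diff_right
        cinner_adjoint[OF B] cinner_adjoint'[OF B] algebra_simps)
  have conj: "cinner (cadjoint B (e j)) (e j) = cnj (cinner (B (e j)) (e j))" for j
    by (simp add: cinner_adjoint'[OF B] cinner_cnj)
  have d1: "Re (cinner (B1 (e j)) (e j)) = Re (cinner (B (e j)) (e j))" for j
    by (simp add: B1_def cinner_scaleC_left cinner_add_left conj)
  have d2: "Re (cinner (B2 (e j)) (e j)) = Im (cinner (B (e j)) (e j))" for j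
    by (simp add: B2_def cinner_scaleC_left cinner_diff_left cinner_minus_left conj)
  \<comment> \<open>One argument for both parts: \<open>p\<close> is \<open>Re\<close> or
    \<open>Im\<close>, and the block sums belonging to \<open>X\<close> are then
    \<open>p (S m)\<close>.\<close>
  have part: "\<phi> (\<lambda>x. X (bt.W x)) = complex_of_real (p c)"
    if X: "X \<in> bounded_operators" and sym: "\<And>x y. cinner (X x) y = cinner x (X y)"
      and d: "\<And>j. Re (cinner (X (e j)) (e j)) = p (cinner (B (e j)) (e j))"
      and p: "p = Re \<or> p = Im" for X p
  proof -
    obtain \<beta> where \<beta>: "\<beta> > 0" "\<And>x. norm (X x) \<le> \<beta> * norm x" using bop_bound[OF X] by blast
    have p_scale: "p (complex_of_real t * x) = t * p x" and p_le: "\<bar>p x\<bar> \<le> cmod x"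
      and p_diff: "p (x - y) = p x - p y" for t x y
      using p abs_Re_le_cmod abs_Im_le_cmod by auto
    have p_sum: "p (sum f I) = (\<Sum>i\<in>I. p (f i))" for f :: "nat \<Rightarrow> complex" and I
      using p by auto
    have eq: "(\<Sum>j | n j = m. (1/2) ^ m * Re (cinner (X (e j)) (e j))) = p (S m)" for m
      unfolding S_def p_sum d
    proof (rule sum.cong[OF refl])
      fix j assume "j \<in> {j. n j = m}"
      then show "(1/2) ^ m * p (cinner (B (e j)) (e j)) = p (complex_of_real (\<mu> j) * a j)"
        using Bdiag[of j m] by (simp only: p_scale[symmetric] mem_Collect_eq)
    qed
    have "block_trace_rel (\<lambda>m. p (S m)) (\<phi> (\<lambda>x. X (bt.W x)))"
      using bt.symmetric_trace_rel[OF X \<beta> sym] unfolding eq .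
    \<comment> \<open>Subtracting \<open>p c\<close> times the harmonic sequence, whose trace is 1,
      leaves block sums with bounded partial sums, hence trace 0.\<close>
    from block_trace_rel_add[OF this block_trace_rel_scale[OF block_trace_rel_harmonic[OF norm1], of "- p c"]]
    have "block_trace_rel (\<lambda>m. p (S m) + - p c * harmonic_block m) (\<phi> (\<lambda>x. X (bt.W x)) + complex_of_real (- p c) * 1)"
      unfolding harmonic_block_def .
    then have "\<phi> (\<lambda>x. X (bt.W x)) + complex_of_real (- p c) * 1 = 0"
    proof (rule block_trace_rel_bounded)
      fix N
      have "p (c * of_real t) = p c * t" for t
        using p by auto
      then have "(\<Sum>m\<le>N. p (S m) + - p c * harmonic_block m) = p (\<Sum>m\<le>N. S m - c * of_real (harmonic_block m))"
        by (simp add: p_sum p_diff)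
      then show "\<bar>\<Sum>m\<le>N. p (S m) + - p c * harmonic_block m\<bar> \<le> D + cmod c"
        by (simp only:) (rule order_trans[OF p_le bounded])
    qed
    then show ?thesis by simp
  qed
  have BB: "B x = B1 x + \<i> *\<^sub>C B2 x" for x
    by (simp add: B1_def B2_def scaleC_scaleC scaleC_add_right complex_vector.scale_right_diff_distrib
        scaleC_add_left[symmetric])
  have m1: "(\<lambda>x. B1 (bt.W x)) \<in> weak_L1" and m2: "(\<lambda>x. B2 (bt.W x)) \<in> weak_L1"
    by (rule weak_L1_left[OF bt.W_weak_L1 B1] weak_L1_left[OF bt.W_weak_L1 B2])+
  have "\<phi> (A \<circ> V) = \<phi> (\<lambda>x. B1 (bt.W x)) + \<i> * \<phi> (\<lambda>x. B2 (bt.W x))"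
    unfolding AV BB phi_add[OF m1 weak_L1_scale[OF m2]] phi_scale[OF m2] ..
  also have "\<dots> = complex_of_real (Re c) + \<i> * complex_of_real (Im c)"
    using part[OF B1 sym1 d1] part[OF B2 sym2 d2] by simp
  also have "\<dots> = c" by (rule complex_eq[symmetric])
  finally show ?thesis unfolding c_def .
qed

end

theorem theorem1p2p7:
  fixes b :: "nat \<Rightarrow> 'h::complex_hilbert"
    and A V :: "'h \<Rightarrow> 'h"
    and F :: "complex \<Rightarrow> complex"
    and \<epsilon> :: real
  assumes separable: "separable_space (euclidean :: 'h topology)"
    and infinite_dimensional: "\<nexists>B :: 'h set. finite B \<and> cspan B = UNIV"
    and basis: "inj b" "orthonormal_basis (range b)"
    and V: "V \<in> weak_L1" "positive_operator V"
    and A: "A \<in> bounded_operators"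
    and eps: "\<epsilon> > 0"
    and continuation: "F holomorphic_on ({z. Re z > - \<epsilon>} - {0})"
      "\<And>z. Re z > 0 \<Longrightarrow> F z = zeta A V z"
    and simple_pole: "is_pole F 0" "zorder F 0 = -1"
  shows "(\<forall>\<phi>. normalised_trace b \<phi> \<longrightarrow> \<phi> (A \<circ> V) = residue F 0) \<and>
         universally_measurable b (A \<circ> V)"
proof -
  have "onb b"
    unfolding onb_def orthonormal_on_def
  proof (intro conjI ballI allI impI)
    fix i j
    show "cinner (b i) (b j) = (if i = j then 1 else 0)"
      using basis unfolding orthonormal_basis_def by (simp add: inj_eq)
  next
    fix x assume "\<forall>i. cinner x (b i) = 0"
    then show "x = 0"
      using basis(2) unfolding orthonormal_basis_def by (intro dense_span_total[of "range b"]) auto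
  qed
  then interpret separable_hilbert b
    by unfold_locales (use separable infinite_dimensional in auto)
  have res: "\<phi> (A \<circ> V) = residue F 0" if "normalised_trace b \<phi>" for \<phi>
  proof -
    interpret weak_trace b \<phi>
      by unfold_locales (use that in \<open>simp add: normalised_trace_def\<close>)
    show ?thesis
      by (rule trace_eq_residue[OF _ V A eps continuation simple_pole basis(2)])
        (use that in \<open>simp_all add: normalised_trace_def\<close>)
  qed
  moreover have "A \<circ> V \<in> weak_L1" unfolding comp_def by (rule weak_L1_left[OF V(1) A])
  ultimately show ?thesis unfolding universally_measurable_def
    by (intro conjI allI impI) (simp_all add: res)
qed

end
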